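(* Let ${\bf S}\subset\mathbb{R}^3$ be the sphere of center $(0,0,1/2)$ and radius $1/2$, let $K$ be a closed subset of ${\bf S}$ which is not log-polar, and let $Q\in\mathcal A(K)$. Let $p_k(x)=\prod_{j=1}^k|x-x_j|$, $x\in{\bf S}$, with $x_1,\dots,x_k\in{\bf S}$, and assume $|p_k(x)e^{-kQ(x)}|\le M$ for $x\in S_w\setminus P$ with $P$ log-polar (possibly empty). Then $|p_k(x)|\le M\exp\big(k(-U^{\mu_{K,Q}}(x)+F_w)\big)$ for all $x\in{\bf S}$, and $|p_k(x)e^{-kQ(x)}|\le M$ for $x\in K\setminus\tilde P$ with $\tilde P$ log-polar (possibly empty).
   Context: $I(\mu)=\int\int\log\frac1{|x-y|}d\mu d\mu$ (Euclidean distance in $\mathbb{R}^3$); a compact set is log-polar if every Borel probability measure on it has $I(\mu)=\infty$, a Borel set if all its compact subsets are. $\mathcal A(K)$: lower semicontinuous $Q:K\to(-\infty,\infty]$ with $\{Q<\infty\}$ not log-polar. $I^Q(\mu)=I(\mu)+2\int Q\,d\mu$, $V_w=\inf I^Q$ over probability measures on $K$, $\mu_{K,Q}$ the unique minimizer, $S_w=\operatorname{supp}\mu_{K,Q}$, $F_w=V_w-\int Q\,d\mu_{K,Q}$, $U^\mu(x)=\int\log\frac1{|x-y|}d\mu(y)$. *)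

theory Defs
  imports "HOL-Probability.Probability"
begin

type_synonym pt = "real ^ 3"

definition Sph :: "pt set" where
  "Sph = sphere (vector [0, 0, 1/2]) (1/2)"

definition logkern :: "pt \<Rightarrow> pt \<Rightarrow> ereal" where
  "logkern x y = (if x = y then \<infinity> else ereal (- ln (dist x y)))"

definition eint :: "'a measure \<Rightarrow> ('a \<Rightarrow> ereal) \<Rightarrow> ereal" where
  "eint M f = enn2ereal (\<integral>\<^sup>+ x. e2ennreal (f x) \<partial>M)
              - enn2ereal (\<integral>\<^sup>+ x. e2ennreal (- f x) \<partial>M)"

definition probs :: "pt set \<Rightarrow> pt measure set" where
  "probs K = {\<mu>. prob_space \<mu> \<and> sets \<mu> = sets borel \<and> emeasure \<mu> (UNIV - K) = 0}"

definition energy :: "pt measure \<Rightarrow> ereal" where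
  "energy \<mu> = eint (\<mu> \<Otimes>\<^sub>M \<mu>) (\<lambda>(x, y). logkern x y)"

definition potential :: "pt measure \<Rightarrow> pt \<Rightarrow> ereal" where
  "potential \<mu> x = eint \<mu> (\<lambda>y. logkern x y)"

text \<open>Log-polar: every compact subset carries no probability measure of finite energy.
  (For compact sets this is the paper's definition; for Borel sets it is the paper's extension.)\<close>
definition log_polar :: "pt set \<Rightarrow> bool" where
  "log_polar E = (\<forall>C. C \<subseteq> E \<and> compact C \<longrightarrow> (\<forall>\<mu>\<in>probs C. energy \<mu> = \<infinity>))"

definition lsc_on :: "'a::topological_space set \<Rightarrow> ('a \<Rightarrow> ereal) \<Rightarrow> bool" where
  "lsc_on K f = (\<forall>x\<in>K. f x \<le> Liminf (at x within K) f)"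

definition admissible :: "pt set \<Rightarrow> (pt \<Rightarrow> ereal) \<Rightarrow> bool" where
  "admissible K Q = (lsc_on K Q \<and> (\<forall>x\<in>K. Q x \<noteq> -\<infinity>) \<and> \<not> log_polar {x\<in>K. Q x < \<infinity>})"

definition intQ :: "pt set \<Rightarrow> (pt \<Rightarrow> ereal) \<Rightarrow> pt measure \<Rightarrow> ereal" where
  "intQ K Q \<mu> = eint \<mu> (\<lambda>x. if x \<in> K then Q x else 0)"

definition wenergy :: "pt set \<Rightarrow> (pt \<Rightarrow> ereal) \<Rightarrow> pt measure \<Rightarrow> ereal" where
  "wenergy K Q \<mu> = energy \<mu> + 2 * intQ K Q \<mu>"

definition Vw :: "pt set \<Rightarrow> (pt \<Rightarrow> ereal) \<Rightarrow> ereal" where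
  "Vw K Q = (INF \<mu>\<in>probs K. wenergy K Q \<mu>)"

definition eqmeasure :: "pt set \<Rightarrow> (pt \<Rightarrow> ereal) \<Rightarrow> pt measure" where
  "eqmeasure K Q = (THE \<mu>. \<mu> \<in> probs K \<and> wenergy K Q \<mu> = Vw K Q)"

definition msupp :: "pt measure \<Rightarrow> pt set" where
  "msupp \<mu> = {x. \<forall>e>0. emeasure \<mu> (ball x e) > 0}"

definition Sw :: "pt set \<Rightarrow> (pt \<Rightarrow> ereal) \<Rightarrow> pt set" where
  "Sw K Q = msupp (eqmeasure K Q)"

definition Fw :: "pt set \<Rightarrow> (pt \<Rightarrow> ereal) \<Rightarrow> ereal" where
  "Fw K Q = Vw K Q - intQ K Q (eqmeasure K Q)"

definition eexp :: "ereal \<Rightarrow> ereal" where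
  "eexp t = (case t of ereal r \<Rightarrow> ereal (exp r) | PInfty \<Rightarrow> \<infinity> | MInfty \<Rightarrow> 0)"

end

(*
  The weighted energy has a minimizer because probability measures on K are weakly compact and the
  logarithmic kernel and Q are lower semicontinuous. On the sphere the kernel is a constant plus a
  power series in the inner product of unit vectors with nonnegative coefficients, hence positive
  definite, and the energy of a difference of two measures controls all its moments, so the
  minimizer mu is unique. Varying mu gives U^mu + Q = F_w mu-almost everywhere and
  U^mu + Q >= F_w on K off a log-polar set. Since mu does not charge log-polar sets, the
  hypothesis on p_k says that log|p_k| + k U^mu <= log M + k F_w holds mu-almost everywhere, and
  the principle of domination extends this to the whole sphere. Domination in turn follows from a
  maximum principle for parts of mu with continuous potential: at a maximum off the support the
  average over four nearby points would be larger. On K off the exceptional set one then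
  replaces F_w - U^mu by the larger Q.
*)
theory Submission
  imports Defs
begin

text \<open>The radius 1/2 gives the sphere diameter 1, so the kernel is nonnegative; once Q is
  shifted by a lower bound, energies and potentials are extended nonnegative integrals, to which
  Tonelli and Fatou apply without integrability conditions. Weak compactness enters as a pointwise
  convergent representation, for the same reason. The power series of the kernel diverges on the
  diagonal, so it is damped; in the limit a uniform error controls the energies of single measures
  and Fatou the mixed energy. In the domination principle two terms balance exactly: off the
  support, k times the potential of a probability measure has a constant positive Laplacian on the
  sphere, and log|p_k| with its k zeros has the opposite one. A maximum of a harmonic function is no
  contradiction, so the measure first receives a total mass slightly above 1, the excess taken from
  one fixed part with bounded potential, and the excess tends to 0 at the end. The potential of mu
  may be discontinuous, which forces the passage through parts of mu with uniformly small
  tails.\<close>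

section \<open>Compactness of probability measures on a compact set\<close>

text \<open>For a countable base \<open>A\<close> this code embeds a compact metric space into the line with uniformly
  continuous inverse, which reduces compactness of its probability measures to Helly's selection
  theorem and Skorohod's theorem on the line.\<close>

definition ternary_code :: "(nat \<Rightarrow> 'a set) \<Rightarrow> 'a \<Rightarrow> real" where
  "ternary_code A x = (\<Sum>n. 2 * indicator (A n) x * (1/3) ^ Suc n)"

lemma summable_ternary: "summable (\<lambda>n. 2 * (indicator (A n) x :: real) * (1/3) ^ Suc n)"
proof (rule summable_comparison_test')
  show "summable (\<lambda>n. 2 * (1/3 :: real) ^ Suc n)"
    by (intro summable_mult) (simp add: summable_geometric summable_mult)
  show "norm (2 * (indicator (A n) x :: real) * (1/3) ^ Suc n) \<le> 2 * (1/3 :: real) ^ Suc n"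
    if "n \<ge> 0" for n
    by (auto simp: indicator_def)
qed

lemma ternary_tail: "(\<lambda>n. 2 * (1/3 :: real) ^ Suc (n + m)) sums ((1/3) ^ m)"
proof -
  have "(\<lambda>n. (2 * (1/3) ^ Suc m) * (1/3 :: real) ^ n) sums ((2 * (1/3) ^ Suc m) * (1 / (1 - 1/3)))"
    by (intro sums_mult geometric_sums) auto
  then show ?thesis
    by (simp add: power_add mult_ac)
qed

lemma ternary_code_bounds: "0 \<le> ternary_code A x" "ternary_code A x \<le> 1"
proof -
  show "0 \<le> ternary_code A x"
    unfolding ternary_code_def by (intro suminf_nonneg summable_ternary) auto
  have "ternary_code A x \<le> (\<Sum>n. 2 * (1/3 :: real) ^ Suc n)"
    unfolding ternary_code_def
    by (intro suminf_le summable_ternary)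
       (use ternary_tail[of 0] in \<open>auto simp: indicator_def sums_iff\<close>)
  also have "\<dots> = 1"
    using ternary_tail[of 0] by (simp add: sums_iff)
  finally show "ternary_code A x \<le> 1" .
qed

text \<open>The digits are 0 and 2, as for the Cantor set: at the first index \<open>m\<close> where
  they differ the codes are \<open>2 * (1/3) ^ Suc m\<close> apart, and all later digits together
  recover at most half of that.\<close>

lemma ternary_code_separates:
  assumes close: "\<bar>ternary_code A x - ternary_code A y\<bar> < (1/3) ^ N" and "n < N"
  shows "x \<in> A n \<longleftrightarrow> y \<in> A n"
proof (rule ccontr)
  assume neq: "\<not> (x \<in> A n \<longleftrightarrow> y \<in> A n)"
  define d where "d i = 2 * (indicator (A i) x - indicator (A i) y) * (1/3 :: real) ^ Suc i" for i
  define m where "m = (LEAST i. \<not> (x \<in> A i \<longleftrightarrow> y \<in> A i))"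
  have m: "\<not> (x \<in> A m \<longleftrightarrow> y \<in> A m)" and m_le: "m \<le> n"
    using neq unfolding m_def by (rule LeastI, intro Least_le)
  have below: "x \<in> A i \<longleftrightarrow> y \<in> A i" if "i < m" for i
    using not_less_Least[OF that[unfolded m_def]] by simp
  have d_eq: "d i = 2 * indicator (A i) x * (1/3) ^ Suc i - 2 * indicator (A i) y * (1/3) ^ Suc i" for i
    by (simp add: d_def algebra_simps)
  have sd: "summable d"
    unfolding d_eq by (intro summable_diff summable_ternary)
  have diff: "ternary_code A x - ternary_code A y = (\<Sum>i. d i)"
    unfolding ternary_code_def d_eq by (intro suminf_diff summable_ternary)
  have "(\<Sum>i. d i) = (\<Sum>i. d (i + Suc m)) + (\<Sum>i<Suc m. d i)"
    by (intro suminf_split_initial_segment sd)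
  also have "(\<Sum>i<Suc m. d i) = d m"
    using below by (simp add: d_def indicator_def)
  finally have sum_eq: "(\<Sum>i. d i) = (\<Sum>i. d (i + Suc m)) + d m" .
  have bd: "\<bar>d i\<bar> \<le> 2 * (1/3) ^ Suc i" for i
    by (auto simp: d_def indicator_def)
  have sa: "summable (\<lambda>i. \<bar>d (i + Suc m)\<bar>)"
  proof (rule summable_comparison_test')
    show "summable (\<lambda>n. 2 * (1/3 :: real) ^ Suc (n + Suc m))"
      using ternary_tail[of "Suc m"] by (simp add: sums_iff)
    show "norm \<bar>d (n + Suc m)\<bar> \<le> 2 * (1/3 :: real) ^ Suc (n + Suc m)" if "n \<ge> 0" for n
      using bd[of "n + Suc m"] by simp
  qed
  have bd': "\<bar>d (i + Suc m)\<bar> \<le> 2 * (1/3) ^ Suc (i + Suc m)" for i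
    by (rule bd)
  have "\<bar>\<Sum>i. d (i + Suc m)\<bar> \<le> (\<Sum>i. \<bar>d (i + Suc m)\<bar>)"
    by (rule summable_rabs[OF sa])
  also have "\<dots> \<le> (\<Sum>i. 2 * (1/3 :: real) ^ Suc (i + Suc m))"
    using sums_summable[OF ternary_tail[of "Suc m"]] by (rule suminf_le[OF bd' sa])
  also have "\<dots> = (1/3) ^ Suc m"
    using ternary_tail[of "Suc m"] by (simp add: sums_iff)
  finally have t: "\<bar>\<Sum>i. d (i + Suc m)\<bar> \<le> (1/3) ^ Suc m" .
  have "\<bar>d m\<bar> = 2 * (1/3) ^ Suc m"
    using m by (auto simp: d_def indicator_def abs_mult)
  with t sum_eq diff have "(1/3) ^ Suc m \<le> \<bar>ternary_code A x - ternary_code A y\<bar>"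
    by linarith
  moreover have "(1/3 :: real) ^ N \<le> (1/3) ^ Suc m"
    using m_le \<open>n < N\<close> by (intro power_decreasing) auto
  ultimately show False
    using close by linarith
qed

text \<open>Finitely many basic sets, each inside a ball of radius \<open>e/2\<close>, cover
  \<open>K\<close>. Codes close enough to agree on these finitely many digits put both points into a
  common one.\<close>

lemma compact_code_uniformly_separates:
  fixes K :: "'a::metric_space set" and A :: "nat \<Rightarrow> 'a set"
  assumes K: "compact K" and base: "topological_basis (range A)" and "e > 0"
  shows "\<exists>d>0. \<forall>x\<in>K. \<forall>y\<in>K. \<bar>ternary_code A x - ternary_code A y\<bar> < d \<longrightarrow> dist x y < e"
proof -
  define I where "I = {n. \<exists>z. A n \<subseteq> ball z (e/2)}"
  have "K \<subseteq> (\<Union>n\<in>I. A n)"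
  proof
    fix x assume "x \<in> K"
    have "\<exists>B'\<in>range A. x \<in> B' \<and> B' \<subseteq> ball x (e/2)"
      by (rule topological_basisE[OF base, of "ball x (e/2)" x]) (use \<open>e > 0\<close> in auto)
    then show "x \<in> (\<Union>n\<in>I. A n)"
      unfolding I_def by blast
  qed
  moreover have "open (A n)" for n
    using base by (simp add: topological_basis_open)
  ultimately obtain J where J: "J \<subseteq> I" "finite J" "K \<subseteq> (\<Union>n\<in>J. A n)"
    using compactE_image[OF K, of I A] by metis
  define N where "N = Suc (Max (insert 0 J))"
  have JN: "n < N" if "n \<in> J" for n
    using that J(2) by (simp add: N_def less_Suc_eq_le)
  show ?thesis
  proof (intro exI conjI ballI impI)
    show "(0::real) < (1/3) ^ N" by simp
    fix x y assume xy: "x \<in> K" "y \<in> K" "\<bar>ternary_code A x - ternary_code A y\<bar> < (1/3) ^ N"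
    obtain n where n: "n \<in> J" "x \<in> A n" using J xy by blast
    have "y \<in> A n" using ternary_code_separates[OF xy(3) JN[OF n(1)]] n by blast
    obtain z where "A n \<subseteq> ball z (e/2)" using n J unfolding I_def by blast
    with n \<open>y \<in> A n\<close> have "dist z x < e/2" "dist z y < e/2" by auto
    then show "dist x y < e"
      using dist_triangle3[of x y z] by linarith
  qed
qed

text \<open>Weak compactness in a form that combines directly with lower semicontinuity and Fatou's
  lemma. The image measures on the line are tight because all codes lie in [0, 1].\<close>

lemma skorohod_compact:
  fixes \<mu> :: "nat \<Rightarrow> 'a::polish_space measure"
  assumes K: "compact K" and prob: "\<And>n. prob_space (\<mu> n)"
    and sets: "\<And>n. sets (\<mu> n) = sets borel" and carr: "\<And>n. emeasure (\<mu> n) (UNIV - K) = 0"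
  obtains \<Omega> :: "real measure" and r :: "nat \<Rightarrow> nat" and X X0 where
    "strict_mono r" "prob_space \<Omega>" "\<And>n. X n \<in> borel_measurable \<Omega>" "X0 \<in> borel_measurable \<Omega>"
    "\<And>n. distr \<Omega> borel (X n) = \<mu> (r n)"
    "\<And>n \<omega>. \<omega> \<in> space \<Omega> \<Longrightarrow> X n \<omega> \<in> K"
    "\<And>\<omega>. \<omega> \<in> space \<Omega> \<Longrightarrow> (\<lambda>n. X n \<omega>) \<longlonglongrightarrow> X0 \<omega>"
proof -
  have space\<mu>: "space (\<mu> n) = UNIV" for n
    using sets_eq_imp_space_eq[OF sets[of n]] by simp
  have K_ne: "K \<noteq> {}"
    using carr[of 0] prob_space.emeasure_space_1[OF prob[of 0]] space\<mu>[of 0] by auto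
  obtain B :: "'a set set" where B: "countable B" "topological_basis B"
    using ex_countable_basis by blast
  \<comment> \<open>The empty set is added so that the enumerated family is certainly nonempty, as
    \<open>range_from_nat_into\<close> demands.\<close>
  define A where "A = from_nat_into (insert {} B)"
  have "range A = insert {} B"
    using B(1) by (simp add: A_def range_from_nat_into)
  with B(2) have base: "topological_basis (range A)"
    unfolding topological_basis_def by (metis insert_iff open_empty Sup_insert sup_bot_left subset_insertI2)
  have [measurable]: "A n \<in> sets borel" for n
    using topological_basis_open[OF base, of "A n"] by auto
  define g where "g = ternary_code A"
  have g_meas[measurable]: "g \<in> borel_measurable borel"
    unfolding g_def ternary_code_def by measurable
  have inj: "inj_on g K"
  proof (rule inj_onI, rule ccontr)
    fix x y assume "x \<in> K" "y \<in> K" "g x = g y" "x \<noteq> y"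
    with compact_code_uniformly_separates[OF K base, of "dist x y"] show False
      unfolding g_def by (metis abs_zero diff_self less_irrefl zero_less_dist_iff)
  qed
  have uc: "uniformly_continuous_on (g ` K) (inv_into K g)"
    unfolding uniformly_continuous_on_def
  proof (intro allI impI)
    fix e :: real assume "e > 0"
    from compact_code_uniformly_separates[OF K base this] obtain d where
      d: "d > 0" "\<And>x y. x \<in> K \<Longrightarrow> y \<in> K \<Longrightarrow> \<bar>g x - g y\<bar> < d \<Longrightarrow> dist x y < e"
      unfolding g_def by blast
    show "\<exists>d>0. \<forall>x\<in>g ` K. \<forall>x'\<in>g ` K. dist x' x < d \<longrightarrow> dist (inv_into K g x') (inv_into K g x) < e"
      using d inj by (intro exI[of _ d]) (auto simp: dist_real_def inv_into_f_f)
  qed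
  \<comment> \<open>The code \<open>g\<close> is only Borel, so the image of \<open>K\<close> need
    not be closed and limits of codes can leave it. Uniform continuity extends the inverse of
    \<open>g\<close> to the closure \<open>D\<close>, which keeps such limits.\<close>
  define D where "D = closure (g ` K)"
  obtain h where h: "uniformly_continuous_on D h" "\<And>x. x \<in> g ` K \<Longrightarrow> inv_into K g x = h x"
    using uniformly_continuous_on_extension_on_closure[OF uc] unfolding D_def by metis
  have hg: "h (g x) = x" if "x \<in> K" for x
    using h(2)[of "g x"] that inj by simp
  have hcont: "continuous_on D h"
    using h(1) by (rule uniformly_continuous_imp_continuous)
  have hD: "h x \<in> K" if "x \<in> D" for x
  proof -
    have "h ` g ` K \<subseteq> K" using hg by auto
    then have "h ` closure (g ` K) \<subseteq> K"
      by (intro image_closure_subset compact_imp_closed[OF K] hcont[unfolded D_def])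
    then show ?thesis
      using that imageI[of x "closure (g ` K)" h] by (auto simp only: D_def)
  qed
  have gD: "g x \<in> D" if "x \<in> K" for x
    using that closure_subset[of "g ` K"] by (auto simp: D_def)
  have [measurable]: "D \<in> sets borel" by (simp add: D_def)
  obtain k0 where k0: "k0 \<in> K" using K_ne by blast
  define hm where "hm y = (if y \<in> D then h y else k0)" for y
  have hm_meas[measurable]: "hm \<in> borel_measurable borel"
    unfolding hm_def by (intro borel_measurable_continuous_on_if hcont continuous_on_const) auto
  define m where "m n = distr (\<mu> n) borel g" for n
  have g_meas'[measurable]: "g \<in> borel_measurable (\<mu> n)" for n
    using g_meas measurable_cong_sets[OF sets[of n] refl] by blast
  have AEK: "AE x in \<mu> n. x \<in> K" for n
    using carr[of n] K
    by (intro AE_I[of _ _ "UNIV - K"]) (auto simp: space\<mu> sets compact_imp_closed borel_closed)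
  have rd: "real_distribution (m n)" for n
    unfolding m_def real_distribution_def real_distribution_axioms_def
    by (auto intro: prob_space.prob_space_distr prob)
  have tight: "tight m"
    unfolding tight_def
  proof (intro conjI allI impI rd)
    fix e :: real assume "e > 0"
    have "measure (m n) {-1<..1} = 1" for n
    proof -
      interpret prob_space "\<mu> n" by (rule prob)
      have g_gt: "-1 < ternary_code A x" for x
        using ternary_code_bounds(1)[of A x] by linarith
      have "g -` {-1<..1} \<inter> space (\<mu> n) = space (\<mu> n)"
        using ternary_code_bounds(2) g_gt by (auto simp: g_def)
      then show ?thesis
        unfolding m_def by (subst measure_distr) (auto simp: prob_space)
    qed
    then show "\<exists>a b. a < b \<and> (\<forall>n. 1 - e < measure (m n) {a<..b})"
      using \<open>e > 0\<close> by (intro exI[of _ "-1"] exI[of _ 1]) auto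
  qed
  obtain r M where r: "strict_mono r" "real_distribution M" "weak_conv_m (m \<circ> id \<circ> r) M"
    using tight_imp_convergent_subsubsequence[OF tight strict_mono_id] by blast
  have rd': "real_distribution ((m \<circ> id \<circ> r) n)" for n by (simp add: rd)
  obtain \<Omega> :: "real measure" and Y Y0 where \<Omega>: "prob_space \<Omega>"
    and Y[measurable]: "\<And>n. Y n \<in> borel_measurable \<Omega>"
    and distrY: "\<And>n. distr \<Omega> borel (Y n) = m (r n)"
    and convY: "\<And>\<omega>. \<omega> \<in> space \<Omega> \<Longrightarrow> (\<lambda>n. Y n \<omega>) \<longlonglongrightarrow> Y0 \<omega>"
    using Skorohod[OF rd' r(2) r(3)] unfolding comp_def id_apply by metis
  have AEY: "AE \<omega> in \<Omega>. Y n \<omega> \<in> D" for n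
  proof -
    have "AE y in m (r n). y \<in> D"
      unfolding m_def by (subst AE_distr_iff) (use AEK[of "r n"] gD in auto)
    then show ?thesis
      unfolding distrY[symmetric] by (subst (asm) AE_distr_iff) auto
  qed
  \<comment> \<open>On the exceptional null set all variables are moved to one fixed code:
    membership in \<open>D\<close> then holds everywhere, convergence persists, and no distribution
    changes.\<close>
  define Z where "Z n \<omega> = (if \<forall>n. Y n \<omega> \<in> D then Y n \<omega> else g k0)" for n \<omega>
  have Z[measurable]: "Z n \<in> borel_measurable \<Omega>" for n
    unfolding Z_def by measurable
  have ZD: "Z n \<omega> \<in> D" for n \<omega>
    using gD[OF k0] by (simp add: Z_def)
  have AEZ: "AE \<omega> in \<Omega>. Z n \<omega> = Y n \<omega>" for n
  proof -
    have "AE \<omega> in \<Omega>. \<forall>n. Y n \<omega> \<in> D"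
      unfolding AE_all_countable using AEY by blast
    then show ?thesis
      by eventually_elim (simp add: Z_def)
  qed
  define Z0 where "Z0 \<omega> = (if \<forall>n. Y n \<omega> \<in> D then Y0 \<omega> else g k0)" for \<omega>
  have convZ: "(\<lambda>n. Z n \<omega>) \<longlonglongrightarrow> Z0 \<omega>" if "\<omega> \<in> space \<Omega>" for \<omega>
    using convY[OF that] by (cases "\<forall>n. Y n \<omega> \<in> D") (simp_all only: Z_def Z0_def if_True if_False simp_thms tendsto_const)
  have Z0D: "Z0 \<omega> \<in> D" if "\<omega> \<in> space \<Omega>" for \<omega>
    by (rule closed_sequentially[OF _ _ convZ[OF that]]) (auto simp: D_def ZD[unfolded D_def])
  define X where "X n \<omega> = hm (Z n \<omega>)" for n \<omega>
  have Xm: "X n \<in> borel_measurable \<Omega>" for n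
    unfolding X_def by measurable
  have convX: "(\<lambda>n. X n \<omega>) \<longlonglongrightarrow> hm (Z0 \<omega>)" if "\<omega> \<in> space \<Omega>" for \<omega>
    unfolding X_def hm_def using ZD Z0D[OF that]
    by (auto intro!: continuous_on_tendsto_compose[OF hcont convZ[OF that]])
  have X0m: "(\<lambda>\<omega>. hm (Z0 \<omega>)) \<in> borel_measurable \<Omega>"
    by (rule borel_measurable_LIMSEQ_metric[OF Xm convX])
  have distrX: "distr \<Omega> borel (X n) = \<mu> (r n)" for n
  proof -
    have "distr \<Omega> borel (X n) = distr \<Omega> borel (hm \<circ> Y n)"
      by (rule distr_cong_AE) (use AEZ[of n] Xm in \<open>auto simp: X_def\<close>)
    also have "\<dots> = distr (m (r n)) borel hm"
      by (subst distrY[symmetric], subst distr_distr) auto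
    also have "\<dots> = distr (\<mu> (r n)) borel (hm \<circ> g)"
      unfolding m_def by (subst distr_distr) auto
    also have "\<dots> = distr (\<mu> (r n)) borel (\<lambda>x. x)"
      by (rule distr_cong_AE)
         (use AEK[of "r n"] sets[of "r n"] in \<open>auto simp: hm_def gD hg measurable_ident_sets intro!: measurable_comp[OF g_meas' hm_meas]\<close>)
    also have "\<dots> = \<mu> (r n)"
      using distr_id2[of borel "\<mu> (r n)"] sets[of "r n"] by simp
    finally show ?thesis .
  qed
  show thesis
    by (rule that[OF r(1) \<Omega> Xm X0m distrX _ convX]) (auto simp: X_def hm_def ZD hD)
qed

section \<open>Potentials and energies in the extended nonnegative reals\<close>

text \<open>\<open>e2ennreal\<close> cuts negative values to 0, which changes nothing on
  \<open>Sph\<close>, where distances are at most 1.\<close>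

definition lk :: "pt \<Rightarrow> pt \<Rightarrow> ennreal" where
  "lk x y = e2ennreal (logkern x y)"

definition Upot :: "pt measure \<Rightarrow> pt \<Rightarrow> ennreal" where
  "Upot \<mu> x = (\<integral>\<^sup>+ y. lk x y \<partial>\<mu>)"

definition mutual :: "pt measure \<Rightarrow> pt measure \<Rightarrow> ennreal" where
  "mutual \<mu> \<nu> = (\<integral>\<^sup>+ x. Upot \<nu> x \<partial>\<mu>)"

text \<open>This is the kernel capped at \<open>L\<close>. With the maximum inside the logarithm it
  is continuous across the diagonal and never meets the default value
  \<open>ln 0 = 0\<close>.\<close>

definition trunc_kern :: "real \<Rightarrow> pt \<Rightarrow> pt \<Rightarrow> real" where
  "trunc_kern L x y = - ln (max (dist x y) (exp (- L)))"

lemma compact_Sph: "compact Sph"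
  by (simp add: Sph_def)

lemma closed_Sph: "closed Sph"
  by (simp add: Sph_def)

lemma dist_Sph_le_1: "x \<in> Sph \<Longrightarrow> y \<in> Sph \<Longrightarrow> dist x y \<le> 1"
  using dist_triangle3[of x y "vector [0, 0, 1/2]"] by (simp add: Sph_def)

lemma lk_eq: "lk x y = (if x = y then \<infinity> else ennreal (- ln (dist x y)))"
  by (auto simp: lk_def logkern_def e2ennreal_ereal)

lemma lk_commute: "lk x y = lk y x"
  by (simp add: lk_eq dist_commute)

lemma logkern_nonneg: "x \<in> Sph \<Longrightarrow> y \<in> Sph \<Longrightarrow> 0 \<le> logkern x y"
  using dist_Sph_le_1[of x y] by (auto simp: logkern_def)

lemma measurable_logkern_pair [measurable]:
  "(\<lambda>p. logkern (fst p) (snd p)) \<in> borel_measurable (borel \<Otimes>\<^sub>M borel)"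
  unfolding logkern_def by measurable

lemma measurable_lk [measurable]:
  assumes [measurable]: "f \<in> borel_measurable M" "g \<in> borel_measurable M"
  shows "(\<lambda>x. lk (f x) (g x)) \<in> borel_measurable M"
  unfolding lk_eq by measurable

lemma measurable_trunc_kern [measurable]:
  assumes [measurable]: "f \<in> borel_measurable M" "g \<in> borel_measurable M"
  shows "(\<lambda>x. trunc_kern L (f x) (g x)) \<in> borel_measurable M"
  unfolding trunc_kern_def by measurable

lemma trunc_kern_le: "trunc_kern L x y \<le> L"
proof -
  have "ln (exp (-L)) \<le> ln (max (dist x y) (exp (- L)))"
    by (subst ln_le_cancel_iff) (auto simp: less_max_iff_disj)
  then show ?thesis by (simp add: trunc_kern_def)
qed

lemma trunc_kern_nonneg: "x \<in> Sph \<Longrightarrow> y \<in> Sph \<Longrightarrow> 0 \<le> L \<Longrightarrow> 0 \<le> trunc_kern L x y"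
  using dist_Sph_le_1[of x y]
  by (auto simp: trunc_kern_def less_max_iff_disj intro!: ln_le_zero_iff[THEN iffD2])

lemma trunc_kern_eq: "x \<noteq> y \<Longrightarrow> exp (- L) \<le> dist x y \<Longrightarrow> trunc_kern L x y = - ln (dist x y)"
  by (simp add: trunc_kern_def max_absorb1)

lemma trunc_kern_eq': "dist x y \<le> exp (- L) \<Longrightarrow> trunc_kern L x y = L"
  by (simp add: trunc_kern_def max_absorb2)

text \<open>Subtraction in \<open>ennreal\<close> stops at 0 and preserves infinity, so
  \<open>lk x y - ennreal L\<close> is exactly the excess over the cap, also on the
  diagonal.\<close>

lemma lk_split:
  assumes "x \<in> Sph" "y \<in> Sph" "0 \<le> L"
  shows "lk x y = ennreal (trunc_kern L x y) + (lk x y - ennreal L)"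
proof (cases "exp (- L) \<le> dist x y")
  case True
  then have "x \<noteq> y"
    by (metis dist_self exp_gt_zero less_le_not_le)
  have "ln (exp (- L)) \<le> ln (dist x y)"
    using True \<open>x \<noteq> y\<close> by (subst ln_le_cancel_iff) auto
  then have "ennreal (- ln (dist x y)) \<le> ennreal L"
    by (intro ennreal_leI) simp
  then show ?thesis
    using True \<open>x \<noteq> y\<close> by (simp add: lk_eq trunc_kern_eq diff_eq_0_ennreal less_top[symmetric])
next
  case False
  then have t: "trunc_kern L x y = L"
    by (intro trunc_kern_eq') simp
  show ?thesis
  proof (cases "x = y")
    case False
    then have "ln (dist x y) \<le> ln (exp (- L))"
      using \<open>\<not> exp (- L) \<le> dist x y\<close> by (subst ln_le_cancel_iff) auto
    then show ?thesis
      using False assms t by (simp add: lk_eq ennreal_minus flip: ennreal_plus)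
  qed (use assms in \<open>auto simp: lk_eq t\<close>)
qed

lemma trunc_kern_le_lk:
  assumes "x \<in> Sph" "y \<in> Sph" "0 \<le> L"
  shows "ennreal (trunc_kern L x y) \<le> lk x y"
  by (subst lk_split[OF assms]) simp

lemma lk_SUP_trunc:
  assumes "x \<in> Sph" "y \<in> Sph"
  shows "lk x y = (SUP n::nat. ennreal (trunc_kern (real n) x y))"
proof (rule antisym)
  show "(SUP n::nat. ennreal (trunc_kern (real n) x y)) \<le> lk x y"
    using assms by (auto intro!: SUP_least trunc_kern_le_lk)
  show "lk x y \<le> (SUP n::nat. ennreal (trunc_kern (real n) x y))"
  proof (cases "x = y")
    case True
    have "trunc_kern (real n) x y = real n" for n
      using True by (intro trunc_kern_eq') simp
    then show ?thesis
      using True by (simp add: lk_eq ennreal_SUP_of_nat_eq_top ennreal_of_nat_eq_real_of_nat[symmetric])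
  next
    case False
    obtain n :: nat where n: "- ln (dist x y) \<le> real n"
      using real_arch_simple by blast
    have "exp (- real n) \<le> exp (ln (dist x y))"
      using n by simp
    then have "exp (- real n) \<le> dist x y"
      using False by simp
    then have "lk x y = ennreal (trunc_kern (real n) x y)"
      using False by (simp add: lk_eq trunc_kern_eq)
    then show ?thesis
      by (auto intro: SUP_upper2)
  qed
qed

lemma tendsto_trunc_kern:
  assumes "(f \<longlongrightarrow> x) F" "(g \<longlongrightarrow> y) F"
  shows "((\<lambda>n. trunc_kern L (f n) (g n)) \<longlongrightarrow> trunc_kern L x y) F"
proof -
  have "max (dist x y) (exp (- L)) \<noteq> 0"
    using exp_gt_zero[of "- L"] by (metis less_le_not_le max.cobounded2)
  then show ?thesis
    unfolding trunc_kern_def by (intro tendsto_intros assms)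
qed

text \<open>As a supremum of continuous truncations the kernel is lower semicontinuous, even at
  diagonal points, where it is infinite.\<close>

lemma lk_le_liminf:
  assumes X: "X \<longlonglongrightarrow> x" and Y: "Y \<longlonglongrightarrow> y" and S: "\<And>n. X n \<in> Sph" "\<And>n. Y n \<in> Sph"
  shows "lk x y \<le> liminf (\<lambda>n. lk (X n) (Y n))"
proof -
  have xy: "x \<in> Sph" "y \<in> Sph"
    using closed_sequentially[OF closed_Sph S(1) X] closed_sequentially[OF closed_Sph S(2) Y] by auto
  have "ennreal (trunc_kern (real m) x y) \<le> liminf (\<lambda>n. lk (X n) (Y n))" for m
  proof -
    have "ennreal (trunc_kern (real m) x y) = liminf (\<lambda>n. ennreal (trunc_kern (real m) (X n) (Y n)))"
      by (intro lim_imp_Liminf[symmetric] tendsto_ennrealI tendsto_trunc_kern X Y) auto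
    also have "\<dots> \<le> liminf (\<lambda>n. lk (X n) (Y n))"
      by (intro Liminf_mono always_eventually allI trunc_kern_le_lk S) auto
    finally show ?thesis .
  qed
  then show ?thesis
    unfolding lk_SUP_trunc[OF xy] by (intro SUP_least)
qed

section \<open>Measures carried by a set, their potentials and energies\<close>

lemma probsD:
  assumes "\<mu> \<in> probs K"
  shows "prob_space \<mu>" "sets \<mu> = sets borel" "emeasure \<mu> (UNIV - K) = 0" "space \<mu> = UNIV"
  using assms sets_eq_imp_space_eq[of \<mu> borel] by (auto simp: probs_def)

lemma probs_measurable:
  assumes "\<mu> \<in> probs K"
  shows "measurable \<mu> N = measurable borel N"
  by (rule measurable_cong_sets) (use probsD[OF assms] in auto)

lemma probs_mono:
  assumes \<mu>: "\<mu> \<in> probs K" and KL: "K \<subseteq> L" and K: "K \<in> sets borel" 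
  shows "\<mu> \<in> probs L"
proof -
  have "emeasure \<mu> (UNIV - L) \<le> emeasure \<mu> (UNIV - K)"
    using KL K probsD[OF \<mu>] by (intro emeasure_mono) auto
  then show ?thesis
    using \<mu> by (auto simp: probs_def)
qed

lemma probs_AE:
  assumes "\<mu> \<in> probs K" "K \<in> sets borel"
  shows "AE x in \<mu>. x \<in> K"
  using probsD[OF assms(1)] assms(2) by (intro AE_I[of _ _ "UNIV - K"]) auto

lemma probs_Sph_AE: "\<mu> \<in> probs Sph \<Longrightarrow> AE x in \<mu>. x \<in> Sph"
  by (rule probs_AE) (simp_all add: closed_Sph)

lemma probs_closed_AE: "\<mu> \<in> probs K \<Longrightarrow> closed K \<Longrightarrow> AE x in \<mu>. x \<in> K"
  by (rule probs_AE) auto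

lemma probs_closed_Sph: "\<mu> \<in> probs K \<Longrightarrow> K \<subseteq> Sph \<Longrightarrow> closed K \<Longrightarrow> \<mu> \<in> probs Sph"
  by (rule probs_mono) auto

lemma measurable_Upot [measurable]:
  assumes "\<mu> \<in> probs K"
  shows "Upot \<mu> \<in> borel_measurable borel"
proof -
  interpret prob_space \<mu> using probsD[OF assms] by simp
  have [measurable_cong]: "sets \<mu> = sets borel" using probsD[OF assms] by simp
  show ?thesis
    unfolding Upot_def by measurable
qed

lemma eint_nonneg:
  assumes "AE x in M. 0 \<le> f x"
  shows "eint M f = enn2ereal (\<integral>\<^sup>+ x. e2ennreal (f x) \<partial>M)"
proof -
  have "(\<integral>\<^sup>+ x. e2ennreal (- f x) \<partial>M) = (\<integral>\<^sup>+ x. 0 \<partial>M)"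
    by (rule nn_integral_cong_AE) (use assms in \<open>auto simp: e2ennreal_neg\<close>)
  then show ?thesis by (simp add: eint_def zero_ennreal.rep_eq)
qed

lemma potential_eq:
  assumes "\<mu> \<in> probs Sph" "x \<in> Sph"
  shows "potential \<mu> x = enn2ereal (Upot \<mu> x)"
  unfolding potential_def Upot_def lk_def
  using probs_Sph_AE[OF assms(1)] by (intro eint_nonneg) (auto simp: logkern_nonneg assms)

lemma energy_eq:
  assumes "\<mu> \<in> probs Sph"
  shows "energy \<mu> = enn2ereal (mutual \<mu> \<mu>)"
proof -
  interpret prob_space \<mu> using probsD[OF assms] by simp
  have [measurable_cong]: "sets \<mu> = sets borel" using probsD[OF assms] by simp
  have 1: "(\<integral>\<^sup>+ p. e2ennreal (case p of (x, y) \<Rightarrow> logkern x y) \<partial>(\<mu> \<Otimes>\<^sub>M \<mu>)) = mutual \<mu> \<mu>"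
  proof -
    have "(\<lambda>p. lk (fst p) (snd p)) \<in> borel_measurable (\<mu> \<Otimes>\<^sub>M \<mu>)" by measurable
    from nn_integral_fst[OF this] show ?thesis
      by (simp add: mutual_def Upot_def lk_def split_beta')
  qed
  have 2: "(\<integral>\<^sup>+ p. e2ennreal (- (case p of (x, y) \<Rightarrow> logkern x y)) \<partial>(\<mu> \<Otimes>\<^sub>M \<mu>)) = 0"
  proof -
    have "(\<lambda>p. e2ennreal (- logkern (fst p) (snd p))) \<in> borel_measurable (\<mu> \<Otimes>\<^sub>M \<mu>)" by measurable
    from nn_integral_fst[OF this, symmetric]
    have "(\<integral>\<^sup>+ p. e2ennreal (- (case p of (x, y) \<Rightarrow> logkern x y)) \<partial>(\<mu> \<Otimes>\<^sub>M \<mu>))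
      = (\<integral>\<^sup>+ x. \<integral>\<^sup>+ y. e2ennreal (- logkern x y) \<partial>\<mu> \<partial>\<mu>)"
      by (simp add: split_beta')
    also have "\<dots> = (\<integral>\<^sup>+ x. 0 \<partial>\<mu>)"
    proof (rule nn_integral_cong_AE, use probs_Sph_AE[OF assms] in eventually_elim)
      fix x assume "x \<in> Sph"
      have "(\<integral>\<^sup>+ y. e2ennreal (- logkern x y) \<partial>\<mu>) = (\<integral>\<^sup>+ y. 0 \<partial>\<mu>)"
        by (rule nn_integral_cong_AE, use probs_Sph_AE[OF assms] in eventually_elim)
           (use \<open>x \<in> Sph\<close> in \<open>auto simp: logkern_nonneg e2ennreal_neg\<close>)
      then show "(\<integral>\<^sup>+ y. e2ennreal (- logkern x y) \<partial>\<mu>) = 0" by simp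
    qed
    finally show ?thesis by simp
  qed
  show ?thesis
    unfolding energy_def eint_def 1 2 by (simp add: zero_ennreal.rep_eq)
qed

lemma mutual_commute:
  assumes "\<mu> \<in> probs K" "\<nu> \<in> probs L"
  shows "mutual \<mu> \<nu> = mutual \<nu> \<mu>"
proof -
  interpret \<mu>: prob_space \<mu> using probsD[OF assms(1)] by simp
  interpret \<nu>: prob_space \<nu> using probsD[OF assms(2)] by simp
  interpret pair_sigma_finite \<mu> \<nu> ..
  have [measurable_cong]: "sets \<mu> = sets borel" "sets \<nu> = sets borel"
    using probsD assms by auto
  have "(\<lambda>(x, y). lk x y) \<in> borel_measurable (\<mu> \<Otimes>\<^sub>M \<nu>)"
    unfolding split_beta' by measurable
  from Fubini'[OF this] show ?thesis
    unfolding mutual_def Upot_def by (simp add: lk_commute)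
qed

section \<open>Lower semicontinuous functions on a set\<close>

lemma lsc_on_nbhd:
  assumes "lsc_on K Q" "x \<in> K" "c < Q x"
  obtains S where "open S" "x \<in> S" "\<And>y. y \<in> S \<Longrightarrow> y \<in> K \<Longrightarrow> c < Q y"
proof -
  have "Q x \<le> Liminf (at x within K) Q"
    using assms unfolding lsc_on_def by blast
  with assms(3) have "eventually (\<lambda>y. c < Q y) (at x within K)"
    unfolding le_Liminf_iff by blast
  \<comment> \<open>The filter \<open>at x within K\<close> leaves out \<open>x\<close> itself,
    where the bound is the assumption \<open>c < Q x\<close>.\<close>
  then show ?thesis
    using assms(3) that unfolding eventually_at_topological by metis
qed

lemma lsc_on_bounded_below:
  fixes K :: "'a::topological_space set"
  assumes "lsc_on K Q" "compact K" "\<And>x. x \<in> K \<Longrightarrow> Q x \<noteq> -\<infinity>"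
  obtains q :: real where "q \<ge> 0" "\<And>x. x \<in> K \<Longrightarrow> - ereal q \<le> Q x"
proof -
  have "\<exists>S c. open S \<and> x \<in> S \<and> (\<forall>y\<in>K. y \<in> S \<longrightarrow> ereal c < Q y)" if xK: "x \<in> K" for x
  proof -
    obtain c where "ereal c < Q x"
      using assms(3)[OF xK] ereal_dense2[of "-\<infinity>" "Q x"] by auto
    then show ?thesis
      using lsc_on_nbhd[OF assms(1) xK, of "ereal c"] by metis
  qed
  then obtain S and c :: "'a \<Rightarrow> real" where S: "\<And>x. x \<in> K \<Longrightarrow> open (S x)" "\<And>x. x \<in> K \<Longrightarrow> x \<in> S x"
    "\<And>x y. x \<in> K \<Longrightarrow> y \<in> S x \<Longrightarrow> y \<in> K \<Longrightarrow> ereal (c x) < Q y"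
    by metis
  obtain J where J: "J \<subseteq> K" "finite J" "K \<subseteq> (\<Union>x\<in>J. S x)"
    using compactE_image[OF assms(2), of K S] S by blast
  define q where "q = (\<Sum>x\<in>J. \<bar>c x\<bar>)"
  show ?thesis
  proof
    show "q \<ge> 0" by (simp add: q_def sum_nonneg)
    fix y assume "y \<in> K"
    then obtain x where x: "x \<in> J" "y \<in> S x" using J by blast
    have "\<bar>c x\<bar> \<le> q" unfolding q_def by (rule member_le_sum) (use x J in auto)
    then have "- ereal q \<le> ereal (c x)" by simp
    also have "\<dots> \<le> Q y" using S(3)[of x y] x J \<open>y \<in> K\<close> by (auto intro: less_imp_le)
    finally show "- ereal q \<le> Q y" .
  qed
qed

lemma lsc_on_measurable:
  fixes K :: "'a::topological_space set"
  assumes "lsc_on K Q" and [measurable]: "K \<in> sets borel"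
  shows "(\<lambda>x. if x \<in> K then Q x else 0) \<in> borel_measurable borel"
proof (rule borel_measurableI_greater)
  fix c :: ereal
  define T where "T = \<Union>{S. open S \<and> (\<forall>y\<in>S \<inter> K. c < Q y)}"
  have "open T" unfolding T_def by auto
  have "{x \<in> K. c < Q x} = T \<inter> K"
  proof
    show "{x \<in> K. c < Q x} \<subseteq> T \<inter> K"
    proof
      fix x assume "x \<in> {x \<in> K. c < Q x}"
      then have x: "x \<in> K" "c < Q x" by auto
      obtain S where "open S" "x \<in> S" "\<And>y. y \<in> S \<Longrightarrow> y \<in> K \<Longrightarrow> c < Q y"
        using lsc_on_nbhd[OF assms(1) x] by blast
      then show "x \<in> T \<inter> K" using x unfolding T_def by blast
    qed
  qed (auto simp: T_def)
  then have eq: "{x \<in> space borel. c < (if x \<in> K then Q x else 0)} = (T \<inter> K) \<union> (if c < 0 then UNIV - K else {})"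
    by auto
  have [measurable]: "T \<in> sets borel" using \<open>open T\<close> by simp
  show "{x \<in> space borel. c < (if x \<in> K then Q x else 0)} \<in> sets borel"
    unfolding eq by auto
qed

section \<open>Existence of the weighted equilibrium measure\<close>

lemma ennreal_liminf_add:
  fixes a b :: "nat \<Rightarrow> ennreal"
  shows "liminf a + liminf b \<le> liminf (\<lambda>n. a n + b n)"
proof -
  have "liminf a + liminf b = (SUP m. (INF n\<in>{m..}. a n) + (INF n\<in>{m..}. b n))"
    unfolding liminf_SUP_INF
    by (intro ennreal_SUP_add[symmetric] incseq_SucI INF_superset_mono) auto
  also have "\<dots> \<le> liminf (\<lambda>n. a n + b n)"
    unfolding liminf_SUP_INF
    by (intro SUP_mono) (auto intro!: INF_greatest add_mono INF_lower)
  finally show ?thesis .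
qed

section \<open>Normalised restrictions of measures of finite energy\<close>

lemma uniform_in_probs:
  assumes \<eta>: "\<eta> \<in> probs L" and A: "A \<in> sets borel" "emeasure \<eta> A \<noteq> 0"
  shows "uniform_measure \<eta> A \<in> probs A"
proof -
  interpret prob_space \<eta> using probsD[OF \<eta>] by simp
  have "sets \<eta> = sets borel" "space \<eta> = UNIV" using probsD[OF \<eta>] by auto
  then show ?thesis
    using A prob_space_uniform_measure[of \<eta> A] by (auto simp: probs_def)
qed

lemma nn_integral_uniform_le:
  assumes \<eta>: "\<eta> \<in> probs L" and A: "A \<in> sets borel" and f: "f \<in> borel_measurable borel"
  shows "(\<integral>\<^sup>+ x. f x \<partial>uniform_measure \<eta> A) \<le> (\<integral>\<^sup>+ x. f x \<partial>\<eta>) / emeasure \<eta> A"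
proof -
  have "(\<integral>\<^sup>+ x. f x \<partial>uniform_measure \<eta> A) = (\<integral>\<^sup>+ x. f x * indicator A x \<partial>\<eta>) / emeasure \<eta> A"
    by (rule nn_integral_uniform_measure) (use A f probsD[OF \<eta>] probs_measurable[OF \<eta>] in auto)
  also have "\<dots> \<le> (\<integral>\<^sup>+ x. f x \<partial>\<eta>) / emeasure \<eta> A"
    by (intro divide_right_mono_ennreal nn_integral_mono) (auto simp: indicator_def)
  finally show ?thesis .
qed

text \<open>The kernel is nonnegative, so restricting both variables to \<open>A\<close> cannot
  raise the double integral; normalising costs the factor \<open>1 / emeasure \<eta> A\<close>
  twice.\<close>

lemma mutual_uniform_finite:
  assumes \<eta>: "\<eta> \<in> probs L" and A: "A \<in> sets borel" "emeasure \<eta> A \<noteq> 0"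
    and fin: "mutual \<eta> \<eta> < \<infinity>"
  shows "mutual (uniform_measure \<eta> A) (uniform_measure \<eta> A) < \<infinity>"
proof -
  interpret prob_space \<eta> using probsD[OF \<eta>] by simp
  let ?u = "uniform_measure \<eta> A"
  define a where "a = emeasure \<eta> A"
  have [measurable]: "Upot \<eta> \<in> borel_measurable borel" by (rule measurable_Upot[OF \<eta>])
  have [measurable_cong]: "sets \<eta> = sets borel" "sets ?u = sets borel" using probsD[OF \<eta>] by auto
  have "mutual ?u ?u \<le> (\<integral>\<^sup>+ x. Upot \<eta> x / a \<partial>?u)"
    unfolding mutual_def a_def
    by (intro nn_integral_mono) (auto simp: Upot_def intro!: nn_integral_uniform_le[OF \<eta> A(1)])
  also have "\<dots> \<le> (\<integral>\<^sup>+ x. Upot \<eta> x / a \<partial>\<eta>) / a"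
    unfolding a_def[symmetric] by (subst (2) a_def, rule nn_integral_uniform_le[OF \<eta> A(1)]) measurable
  also have "\<dots> = (mutual \<eta> \<eta> / a) / a"
    unfolding mutual_def by (subst nn_integral_divide) auto
  also have "\<dots> < \<infinity>"
    using fin A(2) by (simp add: a_def ennreal_divide_eq_top_iff flip: less_top)
  finally show ?thesis .
qed

text \<open>If \<open>P\<close> had positive mass, inner regularity would give a compact subset of
  positive mass, and the normalised restriction of \<open>\<mu>\<close> to it would have finite
  energy.\<close>

lemma log_polar_null:
  assumes \<mu>: "\<mu> \<in> probs Sph" and fin: "mutual \<mu> \<mu> < \<infinity>"
    and P: "P \<in> sets borel" "log_polar P"
  shows "emeasure \<mu> P = 0"
proof (rule ccontr)
  assume nz: "emeasure \<mu> P \<noteq> 0"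
  interpret prob_space \<mu> using probsD[OF \<mu>] by simp
  have sets: "sets \<mu> = sets borel" using probsD[OF \<mu>] by auto
  have "emeasure \<mu> (P \<inter> Sph) = emeasure \<mu> P"
    by (rule emeasure_eq_AE, use probs_Sph_AE[OF \<mu>] in eventually_elim)
       (use P closed_Sph in \<open>auto simp: sets\<close>)
  also have "\<dots> > 0" using nz by (simp add: pos2 zero_less_iff_neq_zero)
  finally have "0 < (SUP C\<in>{C. C \<subseteq> P \<inter> Sph \<and> compact C}. emeasure \<mu> C)"
    using P closed_Sph by (subst (asm) inner_regular) (auto simp: sets)
  then obtain C where C: "C \<subseteq> P \<inter> Sph" "compact C" "0 < emeasure \<mu> C"
    unfolding less_SUP_iff by blast
  have Cb: "C \<in> sets borel" using C(2) by (simp add: compact_imp_closed)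
  let ?u = "uniform_measure \<mu> C"
  have u: "?u \<in> probs C" using uniform_in_probs[OF \<mu> Cb] C(3) by simp
  have uS: "?u \<in> probs Sph" by (rule probs_mono[OF u _ Cb]) (use C in auto)
  have "energy ?u \<noteq> \<infinity>"
    using mutual_uniform_finite[OF \<mu> Cb _ fin] C(3)
    by (simp add: energy_eq[OF uS] enn2ereal_eq_top_iff less_top)
  then show False
    using P(2) C(1,2) u unfolding log_polar_def by auto
qed

locale weighted_problem =
  fixes K :: "pt set" and Q :: "pt \<Rightarrow> ereal" and q :: real
  assumes closed_K: "closed K" and K_Sph: "K \<subseteq> Sph" and lsc: "lsc_on K Q"
    and q_nonneg: "0 \<le> q" and Q_lower: "\<And>x. x \<in> K \<Longrightarrow> - ereal q \<le> Q x"
begin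

text \<open>The shift by \<open>q\<close> makes the field nonnegative; \<open>J\<close> is the weighted energy plus \<open>2 * q\<close>.\<close>

definition Qp :: "pt \<Rightarrow> ennreal" where
  "Qp x = (if x \<in> K then e2ennreal (Q x + ereal q) else 0)"

definition J :: "pt measure \<Rightarrow> ennreal" where
  "J \<mu> = mutual \<mu> \<mu> + 2 * (\<integral>\<^sup>+ x. Qp x \<partial>\<mu>)"

lemma K_borel [measurable]: "K \<in> sets borel"
  using closed_K by simp

lemma compact_K: "compact K"
  using compact_Int_closed[OF compact_Sph closed_K] K_Sph by (simp add: Int_absorb1)

lemma probs_K_Sph: "\<mu> \<in> probs K \<Longrightarrow> \<mu> \<in> probs Sph"
  using probs_closed_Sph[OF _ K_Sph closed_K] .

lemma probs_K_AE: "\<mu> \<in> probs K \<Longrightarrow> AE x in \<mu>. x \<in> K"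
  using probs_closed_AE[OF _ closed_K] .

lemma Q_measurable [measurable]: "(\<lambda>x. if x \<in> K then Q x else 0) \<in> borel_measurable borel"
  by (rule lsc_on_measurable[OF lsc K_borel])

lemma Qp_measurable [measurable]: "Qp \<in> borel_measurable borel"
proof -
  have "Qp = (\<lambda>x. if x \<in> K then e2ennreal ((if x \<in> K then Q x else 0) + ereal q) else 0)"
    by (auto simp: Qp_def fun_eq_iff)
  then show ?thesis by simp
qed

lemma Qp_nonneg: "x \<in> K \<Longrightarrow> 0 \<le> Q x + ereal q"
  using Q_lower[of x] by (cases "Q x") auto

lemma enn2ereal_Qp: "x \<in> K \<Longrightarrow> enn2ereal (Qp x) = Q x + ereal q"
  by (simp add: Qp_def Qp_nonneg enn2ereal_e2ennreal)

text \<open>The negative part of \<open>Q\<close> has integral at most \<open>q\<close>, so the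
  difference in \<open>eint\<close> is never infinity minus infinity. The identity is first proved
  in \<open>ennreal\<close> with both negative terms moved across; the finite one is cancelled
  afterwards.\<close>

lemma intQ_eq:
  assumes \<mu>: "\<mu> \<in> probs K"
  shows "intQ K Q \<mu> = enn2ereal (\<integral>\<^sup>+ x. Qp x \<partial>\<mu>) - ereal q"
proof -
  interpret prob_space \<mu> using probsD[OF \<mu>] by simp
  have [measurable_cong]: "sets \<mu> = sets borel" using probsD[OF \<mu>] by auto
  let ?f = "\<lambda>x. if x \<in> K then Q x else 0"
  let ?P = "\<integral>\<^sup>+ x. e2ennreal (?f x) \<partial>\<mu>"
  let ?N = "\<integral>\<^sup>+ x. e2ennreal (- ?f x) \<partial>\<mu>"
  have "?N \<le> (\<integral>\<^sup>+ x. ennreal q \<partial>\<mu>)"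
  proof (rule nn_integral_mono)
    fix x
    have "- ?f x \<le> ereal q"
      using Q_lower[of x] q_nonneg by (auto simp: ereal_uminus_le_reorder)
    then show "e2ennreal (- ?f x) \<le> ennreal q"
      by (metis e2ennreal_ereal e2ennreal_mono)
  qed
  also have "\<dots> = ennreal q"
    using emeasure_space_1 by simp
  finally have N: "?N \<noteq> \<infinity>"
    by (auto simp: top_unique)
  have pt: "e2ennreal (?f x) + ennreal q = Qp x + e2ennreal (- ?f x)" if "x \<in> K" for x
  proof (cases "Q x")
    case (real t)
    then have "0 \<le> t + q" using Q_lower[OF that] by simp
    then show ?thesis
      using real that q_nonneg
      by (cases "0 \<le> t") (simp_all add: Qp_def e2ennreal_ereal ennreal_neg flip: ennreal_plus)
  qed (use that Q_lower[OF that] in \<open>auto simp: Qp_def e2ennreal_neg\<close>)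
  have "?P + ennreal q = (\<integral>\<^sup>+ x. e2ennreal (?f x) + ennreal q \<partial>\<mu>)"
    using emeasure_space_1 by (subst nn_integral_add) auto
  also have "\<dots> = (\<integral>\<^sup>+ x. Qp x + e2ennreal (- ?f x) \<partial>\<mu>)"
    by (rule nn_integral_cong_AE, use probs_K_AE[OF \<mu>] in eventually_elim) (rule pt)
  also have "\<dots> = (\<integral>\<^sup>+ x. Qp x \<partial>\<mu>) + ?N"
    by (subst nn_integral_add) auto
  finally have eq: "?P + ennreal q = (\<integral>\<^sup>+ x. Qp x \<partial>\<mu>) + ?N" .
  have "enn2ereal ?P + ereal q = enn2ereal (\<integral>\<^sup>+ x. Qp x \<partial>\<mu>) + enn2ereal ?N"
    using arg_cong[OF eq, of enn2ereal]
    unfolding plus_ennreal.rep_eq enn2ereal_ennreal[OF q_nonneg] .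
  moreover obtain n where "enn2ereal ?N = ereal n"
    using N by (cases ?N) auto
  moreover have "a - b = c - ereal q" if "a + ereal q = c + b" "b = ereal n" for a b c n
    using that by (cases a; cases c) auto
  ultimately show ?thesis
    unfolding intQ_def eint_def by blast
qed

lemma wenergy_eq:
  assumes \<mu>: "\<mu> \<in> probs K"
  shows "wenergy K Q \<mu> = enn2ereal (J \<mu>) - ereal (2 * q)"
proof -
  have 1: "a + 2 * (b - ereal q) = a + (b + b) - ereal (2 * q)" if "0 \<le> a" "0 \<le> b" for a b :: ereal
    using that by (cases a; cases b) (simp_all add: numeral_eq_ereal)
  have "wenergy K Q \<mu> = enn2ereal (mutual \<mu> \<mu>) + 2 * (enn2ereal (\<integral>\<^sup>+ x. Qp x \<partial>\<mu>) - ereal q)"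
    by (simp only: wenergy_def intQ_eq[OF \<mu>] energy_eq[OF probs_K_Sph[OF \<mu>]])
  also have "\<dots> = enn2ereal (mutual \<mu> \<mu>) + (enn2ereal (\<integral>\<^sup>+ x. Qp x \<partial>\<mu>) + enn2ereal (\<integral>\<^sup>+ x. Qp x \<partial>\<mu>)) - ereal (2 * q)"
    by (rule 1[OF enn2ereal_nonneg enn2ereal_nonneg])
  also have "\<dots> = enn2ereal (J \<mu>) - ereal (2 * q)"
    by (simp only: J_def mult_2 plus_ennreal.rep_eq)
  finally show ?thesis .
qed

lemma Qp_le_liminf:
  assumes X: "\<And>n. X n \<in> K" "X \<longlonglongrightarrow> x"
  shows "Qp x \<le> liminf (\<lambda>n. Qp (X n))"
proof -
  have x: "x \<in> K" using closed_sequentially[OF closed_K X] .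
  show ?thesis
    unfolding le_Liminf_iff
  proof (intro allI impI)
    fix c assume "c < Qp x"
    then have "enn2ereal c < Q x + ereal q"
      by (simp add: less_ennreal.rep_eq enn2ereal_Qp x)
    then have "enn2ereal c - ereal q < Q x"
      by (cases "Q x"; cases "enn2ereal c") auto
    then obtain S where S: "open S" "x \<in> S" "\<And>y. y \<in> S \<Longrightarrow> y \<in> K \<Longrightarrow> enn2ereal c - ereal q < Q y"
      using lsc_on_nbhd[OF lsc x] by blast
    have "eventually (\<lambda>n. X n \<in> S) sequentially"
      by (rule topological_tendstoD[OF X(2) S(1,2)])
    then show "eventually (\<lambda>n. c < Qp (X n)) sequentially"
    proof eventually_elim
      case (elim n)
      have "enn2ereal c - ereal q < Q (X n)" using S(3) elim X by blast
      then have "enn2ereal c < Q (X n) + ereal q"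
        by (cases "Q (X n)"; cases "enn2ereal c") auto
      then show ?case
        by (simp add: less_ennreal.rep_eq enn2ereal_Qp X)
    qed
  qed
qed

text \<open>A measure of finite energy on {Q < \<infinity>} may still give \<open>Q\<close> an
  infinite integral. The sets {Qp \<le> n} exhaust its carrier, so one of them has positive mass,
  and the restriction to it works.\<close>

lemma exists_finite_J:
  assumes "\<not> log_polar {x\<in>K. Q x < \<infinity>}"
  shows "\<exists>\<mu>\<in>probs K. J \<mu> < \<infinity>"
proof -
  obtain C \<eta> where C: "C \<subseteq> {x\<in>K. Q x < \<infinity>}" "compact C" and \<eta>: "\<eta> \<in> probs C" "energy \<eta> \<noteq> \<infinity>"
    using assms unfolding log_polar_def by blast
  interpret prob_space \<eta> using probsD[OF \<eta>(1)] by simp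
  have [measurable]: "C \<in> sets borel" using C(2) by (simp add: compact_imp_closed)
  have [measurable_cong]: "sets \<eta> = sets borel" using probsD[OF \<eta>(1)] by auto
  have \<eta>S: "\<eta> \<in> probs Sph"
    by (rule probs_closed_Sph[OF \<eta>(1)]) (use C K_Sph compact_imp_closed in auto)
  have fin: "mutual \<eta> \<eta> < \<infinity>"
    using \<eta>(2) energy_eq[OF \<eta>S] by (simp add: less_top enn2ereal_eq_top_iff)
  define D where "D n = {x\<in>C. Qp x \<le> ennreal (real n)}" for n
  have Dm [measurable]: "D n \<in> sets borel" for n
    unfolding D_def by measurable
  have "\<exists>n. emeasure \<eta> (D n) \<noteq> 0"
  proof (rule ccontr)
    assume "\<not> ?thesis"
    then have "emeasure \<eta> (\<Union>n. D n) = 0"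
      by (intro emeasure_UN_eq_0) auto
    moreover have "C \<subseteq> (\<Union>n. D n)"
    proof
      fix x assume x: "x \<in> C"
      then have "Qp x < \<infinity>"
        using C(1) Q_lower[of x] by (cases "Q x") (auto simp: Qp_def e2ennreal_ereal less_top[symmetric])
      then obtain n where "Qp x \<le> of_nat n"
        using ennreal_Ex_less_of_nat[of "Qp x"] by (auto intro: less_imp_le)
      then show "x \<in> (\<Union>n. D n)"
        using x by (auto simp: D_def ennreal_of_nat_eq_real_of_nat)
    qed
    ultimately have "emeasure \<eta> C = 0"
      using emeasure_mono[of C "\<Union>n. D n" \<eta>] by auto
    moreover have "emeasure \<eta> C = 1"
      using probs_AE[OF \<eta>(1)] by (intro emeasure_eq_1_AE) auto
    ultimately show False by simp
  qed
  then obtain n where n: "emeasure \<eta> (D n) \<noteq> 0" by blast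
  let ?u = "uniform_measure \<eta> (D n)"
  have uD: "?u \<in> probs (D n)" by (rule uniform_in_probs[OF \<eta>(1) Dm n])
  then have u: "?u \<in> probs K"
    by (rule probs_mono) (use C in \<open>auto simp: D_def\<close>)
  interpret u: prob_space ?u using probsD[OF u] by simp
  have "(\<integral>\<^sup>+ x. Qp x \<partial>?u) \<le> (\<integral>\<^sup>+ x. ennreal (real n) \<partial>?u)"
    by (rule nn_integral_mono_AE, use probs_AE[OF uD Dm] in eventually_elim) (simp add: D_def)
  also have "\<dots> = ennreal (real n)"
    using u.emeasure_space_1 by simp
  also have "\<dots> < \<infinity>" by simp
  finally have "J ?u < \<infinity>"
    unfolding J_def using mutual_uniform_finite[OF \<eta>(1) Dm n fin]
    by (simp add: ennreal_mult_eq_top_iff flip: less_top)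
  with u show ?thesis by blast
qed

text \<open>The direct method: a minimizing sequence is represented by pointwise convergent
  variables, and the law of the limit inherits the lower bound by Fatou.\<close>

lemma exists_minimizer:
  assumes "probs K \<noteq> {}"
  shows "\<exists>\<mu>\<in>probs K. \<forall>\<nu>\<in>probs K. J \<mu> \<le> J \<nu>"
proof -
  obtain v where v: "\<And>n. v n \<in> J ` probs K" "v \<longlonglongrightarrow> Inf (J ` probs K)"
    using Inf_as_limit[of "J ` probs K"] assms by auto
  then have "\<exists>\<mu>. \<mu> \<in> probs K \<and> v n = J \<mu>" for n
    by (auto simp: image_iff)
  then obtain \<mu> where \<mu>: "\<And>n. \<mu> n \<in> probs K" "\<And>n. v n = J (\<mu> n)"
    by metis
  obtain \<Omega> :: "real measure" and r :: "nat \<Rightarrow> nat" and X X0 where r: "strict_mono r"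
    and \<Omega>: "prob_space \<Omega>" and X: "\<And>n. X n \<in> borel_measurable \<Omega>" and X0: "X0 \<in> borel_measurable \<Omega>"
    and distrX: "\<And>n. distr \<Omega> borel (X n) = \<mu> (r n)"
    and XK: "\<And>n \<omega>. \<omega> \<in> space \<Omega> \<Longrightarrow> X n \<omega> \<in> K"
    and conv: "\<And>\<omega>. \<omega> \<in> space \<Omega> \<Longrightarrow> (\<lambda>n. X n \<omega>) \<longlonglongrightarrow> X0 \<omega>"
    by (rule skorohod_compact[OF compact_K probsD(1)[OF \<mu>(1)] probsD(2)[OF \<mu>(1)] probsD(3)[OF \<mu>(1)]])
       (rule that)
  interpret prob_space \<Omega> by (rule \<Omega>)
  note [measurable] = X X0
  define \<mu>0 where "\<mu>0 = distr \<Omega> borel X0"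
  have X0K: "X0 \<omega> \<in> K" if "\<omega> \<in> space \<Omega>" for \<omega>
    using closed_sequentially[OF closed_K XK[OF that] conv[OF that]] .
  have \<mu>0: "\<mu>0 \<in> probs K"
  proof -
    have "X0 -` (UNIV - K) \<inter> space \<Omega> = {}"
      using X0K by auto
    then show ?thesis
      unfolding probs_def \<mu>0_def by (auto simp: prob_space_distr emeasure_distr)
  qed
  \<comment> \<open>The energy becomes an integral over two independent copies of
    \<open>\<Omega>\<close>, so pointwise convergence in each variable is all that the kernel
    estimate needs.\<close>
  have mut: "mutual (distr \<Omega> borel Y) (distr \<Omega> borel Y) = (\<integral>\<^sup>+ \<omega>. \<integral>\<^sup>+ \<omega>'. lk (Y \<omega>) (Y \<omega>') \<partial>\<Omega> \<partial>\<Omega>)"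
    if [measurable]: "Y \<in> borel_measurable \<Omega>" for Y
  proof -
    interpret Y: prob_space "distr \<Omega> borel Y" by (rule prob_space_distr) measurable
    show ?thesis
      unfolding mutual_def Upot_def
      by (subst nn_integral_distr, measurable, subst nn_integral_distr, measurable)
  qed
  have "mutual \<mu>0 \<mu>0 \<le> (\<integral>\<^sup>+ \<omega>. \<integral>\<^sup>+ \<omega>'. liminf (\<lambda>n. lk (X n \<omega>) (X n \<omega>')) \<partial>\<Omega> \<partial>\<Omega>)"
    unfolding \<mu>0_def mut[OF X0]
    by (intro nn_integral_mono lk_le_liminf conv) (use XK K_Sph in auto)
  also have "\<dots> \<le> (\<integral>\<^sup>+ \<omega>. liminf (\<lambda>n. \<integral>\<^sup>+ \<omega>'. lk (X n \<omega>) (X n \<omega>') \<partial>\<Omega>) \<partial>\<Omega>)"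
    by (intro nn_integral_mono nn_integral_liminf) measurable
  also have "\<dots> \<le> liminf (\<lambda>n. \<integral>\<^sup>+ \<omega>. \<integral>\<^sup>+ \<omega>'. lk (X n \<omega>) (X n \<omega>') \<partial>\<Omega> \<partial>\<Omega>)"
    by (intro nn_integral_liminf) measurable
  finally have E: "mutual \<mu>0 \<mu>0 \<le> liminf (\<lambda>n. mutual (\<mu> (r n)) (\<mu> (r n)))"
    unfolding mut[OF X, symmetric] distrX .
  have "(\<integral>\<^sup>+ x. Qp x \<partial>\<mu>0) = (\<integral>\<^sup>+ \<omega>. Qp (X0 \<omega>) \<partial>\<Omega>)"
    unfolding \<mu>0_def by (subst nn_integral_distr) auto
  also have "\<dots> \<le> (\<integral>\<^sup>+ \<omega>. liminf (\<lambda>n. Qp (X n \<omega>)) \<partial>\<Omega>)"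
    by (intro nn_integral_mono Qp_le_liminf conv XK)
  also have "\<dots> \<le> liminf (\<lambda>n. \<integral>\<^sup>+ \<omega>. Qp (X n \<omega>) \<partial>\<Omega>)"
    by (intro nn_integral_liminf) measurable
  also have "\<dots> = liminf (\<lambda>n. \<integral>\<^sup>+ x. Qp x \<partial>\<mu> (r n))"
    unfolding distrX[symmetric] by (subst nn_integral_distr) auto
  finally have QQ: "(\<integral>\<^sup>+ x. Qp x \<partial>\<mu>0) \<le> liminf (\<lambda>n. \<integral>\<^sup>+ x. Qp x \<partial>\<mu> (r n))" .
  have "J \<mu>0 = mutual \<mu>0 \<mu>0 + (\<integral>\<^sup>+ x. Qp x \<partial>\<mu>0) + (\<integral>\<^sup>+ x. Qp x \<partial>\<mu>0)"
    by (simp add: J_def mult_2 add.assoc)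
  also have "\<dots> \<le> liminf (\<lambda>n. mutual (\<mu> (r n)) (\<mu> (r n))) + liminf (\<lambda>n. \<integral>\<^sup>+ x. Qp x \<partial>\<mu> (r n))
      + liminf (\<lambda>n. \<integral>\<^sup>+ x. Qp x \<partial>\<mu> (r n))"
    by (intro add_mono E QQ)
  also have "\<dots> \<le> liminf (\<lambda>n. mutual (\<mu> (r n)) (\<mu> (r n)) + (\<integral>\<^sup>+ x. Qp x \<partial>\<mu> (r n)))
      + liminf (\<lambda>n. \<integral>\<^sup>+ x. Qp x \<partial>\<mu> (r n))"
    by (intro add_right_mono ennreal_liminf_add)
  also have "\<dots> \<le> liminf (\<lambda>n. mutual (\<mu> (r n)) (\<mu> (r n)) + (\<integral>\<^sup>+ x. Qp x \<partial>\<mu> (r n)) + (\<integral>\<^sup>+ x. Qp x \<partial>\<mu> (r n)))"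
    by (intro ennreal_liminf_add)
  also have "\<dots> = liminf (\<lambda>n. v (r n))"
    by (simp add: \<mu>(2) J_def mult_2 add.assoc)
  also have "\<dots> = Inf (J ` probs K)"
    using LIMSEQ_subseq_LIMSEQ[OF v(2) r] by (intro lim_imp_Liminf) (auto simp: comp_def)
  finally have "J \<mu>0 \<le> Inf (J ` probs K)" .
  then show ?thesis
    using \<mu>0 by (metis INF_lower order_trans)
qed

end

section \<open>Frostman inequalities\<close>

text \<open>The mixture is a Bernoulli choice between the two measures; the monadic bind supplies
  its integral formula.\<close>

lemma convex_combination_probs:
  assumes \<mu>: "\<mu> \<in> probs K" and \<nu>: "\<nu> \<in> probs K" and K: "K \<in> sets borel" and t: "0 \<le> t" "t \<le> 1"
  obtains m where "m \<in> probs K"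
    "\<And>f. f \<in> borel_measurable borel \<Longrightarrow>
      (\<integral>\<^sup>+ x. f x \<partial>m) = ennreal (1 - t) * (\<integral>\<^sup>+ x. f x \<partial>\<mu>) + ennreal t * (\<integral>\<^sup>+ x. f x \<partial>\<nu>)"
proof -
  define N where "N b = (if b then \<nu> else \<mu>)" for b
  define m where "m = measure_pmf (bernoulli_pmf t) \<bind> N"
  have N: "N \<in> measurable (measure_pmf (bernoulli_pmf t)) (subprob_algebra borel)"
    using probsD[OF \<mu>] probsD[OF \<nu>]
    by (auto simp: N_def space_subprob_algebra prob_space_imp_subprob_space)
  have int: "(\<integral>\<^sup>+ x. f x \<partial>m) = ennreal (1 - t) * (\<integral>\<^sup>+ x. f x \<partial>\<mu>) + ennreal t * (\<integral>\<^sup>+ x. f x \<partial>\<nu>)"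
    if "f \<in> borel_measurable borel" for f
    unfolding m_def by (subst nn_integral_bind[OF that N]) (use t in \<open>simp add: N_def mult.commute add.commute\<close>)
  have sets: "sets m = sets borel"
    unfolding m_def by (rule sets_bind[of _ _ borel]) (use probsD[OF \<mu>] probsD[OF \<nu>] in \<open>auto simp: N_def\<close>)
  have em: "emeasure m A = ennreal (1 - t) * emeasure \<mu> A + ennreal t * emeasure \<nu> A" if "A \<in> sets borel" for A
    using int[of "indicator A"] that sets probsD[OF \<mu>] probsD[OF \<nu>] by simp
  have "emeasure m (space m) = ennreal (1 - t) + ennreal t"
    using em[of UNIV] prob_space.emeasure_space_1 probsD[OF \<mu>] probsD[OF \<nu>] sets_eq_imp_space_eq[OF sets]
    by (metis UNIV_I mult.right_neutral sets.top space_borel)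
  also have "\<dots> = 1" using t by (simp flip: ennreal_plus)
  finally have "prob_space m" by (rule prob_spaceI)
  then have "m \<in> probs K"
    using em[of "UNIV - K"] K sets probsD[OF \<mu>] probsD[OF \<nu>] by (auto simp: probs_def)
  then show thesis using that int by blast
qed

lemma mutual_convex_combination:
  assumes \<mu>: "\<mu> \<in> probs K" and \<nu>: "\<nu> \<in> probs K" and m: "m \<in> probs K"
    and int: "\<And>f. f \<in> borel_measurable borel \<Longrightarrow>
      (\<integral>\<^sup>+ x. f x \<partial>m) = s * (\<integral>\<^sup>+ x. f x \<partial>\<mu>) + t * (\<integral>\<^sup>+ x. f x \<partial>\<nu>)"
  shows "mutual m m = s * (s * mutual \<mu> \<mu> + t * mutual \<mu> \<nu>) + t * (s * mutual \<mu> \<nu> + t * mutual \<nu> \<nu>)"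
proof -
  note [measurable] = measurable_Upot[OF \<mu>] measurable_Upot[OF \<nu>] measurable_Upot[OF m]
  have [measurable_cong]: "sets \<mu> = sets borel" "sets \<nu> = sets borel"
    using probsD[OF \<mu>] probsD[OF \<nu>] by auto
  have U: "Upot m x = s * Upot \<mu> x + t * Upot \<nu> x" for x
    unfolding Upot_def by (rule int) measurable
  have "mutual m m = s * mutual \<mu> m + t * mutual \<nu> m"
    unfolding mutual_def by (rule int) measurable
  moreover have "mutual \<rho> m = s * mutual \<rho> \<mu> + t * mutual \<rho> \<nu>"
    if [measurable_cong]: "sets \<rho> = sets borel" for \<rho>
    unfolding mutual_def U
    by (subst nn_integral_add) (auto simp: nn_integral_cmult)
  ultimately show ?thesis
    using mutual_commute[OF \<mu> \<nu>] probsD[OF \<mu>] probsD[OF \<nu>] by simp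
qed

context weighted_problem
begin

text \<open>The one-sided derivative of \<open>J\<close> at the minimizer, along the segment towards
  \<open>\<eta>\<close>, cannot be negative. Finite energy of \<open>\<eta>\<close> keeps the
  second-order coefficient finite; if the right-hand side is infinite there is nothing to
  show.\<close>

lemma variational_inequality:
  assumes \<mu>: "\<mu> \<in> probs K" and fin: "J \<mu> < \<infinity>" and min: "\<And>\<nu>. \<nu> \<in> probs K \<Longrightarrow> J \<mu> \<le> J \<nu>"
    and \<eta>: "\<eta> \<in> probs K" "mutual \<eta> \<eta> < \<infinity>"
  shows "mutual \<mu> \<mu> + (\<integral>\<^sup>+ x. Qp x \<partial>\<mu>) \<le> mutual \<mu> \<eta> + (\<integral>\<^sup>+ x. Qp x \<partial>\<eta>)"
proof (rule ccontr)
  assume "\<not> ?thesis"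
  then have less: "mutual \<mu> \<eta> + (\<integral>\<^sup>+ x. Qp x \<partial>\<eta>) < mutual \<mu> \<mu> + (\<integral>\<^sup>+ x. Qp x \<partial>\<mu>)" by simp
  have "mutual \<mu> \<mu> < \<infinity>" "(\<integral>\<^sup>+ x. Qp x \<partial>\<mu>) < \<infinity>"
    using fin by (auto simp: J_def ennreal_mult_eq_top_iff simp flip: less_top)
  moreover have "mutual \<mu> \<eta> < \<infinity>" "(\<integral>\<^sup>+ x. Qp x \<partial>\<eta>) < \<infinity>"
    using less by (auto simp flip: less_top)
  ultimately obtain a p b s c where
    a: "mutual \<mu> \<mu> = ennreal a" "0 \<le> a" and p: "(\<integral>\<^sup>+ x. Qp x \<partial>\<mu>) = ennreal p" "0 \<le> p"
    and b: "mutual \<mu> \<eta> = ennreal b" "0 \<le> b" and s: "(\<integral>\<^sup>+ x. Qp x \<partial>\<eta>) = ennreal s" "0 \<le> s"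
    and c: "mutual \<eta> \<eta> = ennreal c" "0 \<le> c"
    using \<eta>(2) by (auto simp: less_top_ennreal)
  have \<delta>: "b + s < a + p"
    using less a p b s by (simp add: ennreal_less_iff flip: ennreal_plus)
  \<comment> \<open>The right-hand side is \<open>J\<close> of the mixture minus
    \<open>J \<mu>\<close>, as a polynomial in \<open>t\<close>.\<close>
  have key: "0 \<le> 2 * t * (b + s - a - p) + t\<^sup>2 * (a - 2 * b + c)" if t: "0 \<le> t" "t \<le> 1" for t
  proof -
    obtain m where m: "m \<in> probs K" and
      int: "\<And>f. f \<in> borel_measurable borel \<Longrightarrow>
        (\<integral>\<^sup>+ x. f x \<partial>m) = ennreal (1 - t) * (\<integral>\<^sup>+ x. f x \<partial>\<mu>) + ennreal t * (\<integral>\<^sup>+ x. f x \<partial>\<eta>)"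
      using convex_combination_probs[OF \<mu> \<eta>(1) K_borel t] by blast
    have mm: "mutual m m = ennreal (1 - t) * (ennreal (1 - t) * mutual \<mu> \<mu> + ennreal t * mutual \<mu> \<eta>)
        + ennreal t * (ennreal (1 - t) * mutual \<mu> \<eta> + ennreal t * mutual \<eta> \<eta>)"
      by (rule mutual_convex_combination[OF \<mu> \<eta>(1) m int])
    have "J m = ennreal (1 - t) * (ennreal (1 - t) * ennreal a + ennreal t * ennreal b)
        + ennreal t * (ennreal (1 - t) * ennreal b + ennreal t * ennreal c)
        + 2 * (ennreal (1 - t) * ennreal p + ennreal t * ennreal s)"
      unfolding J_def mm int[OF Qp_measurable] a p b s c ..
    also have "\<dots> = ennreal ((1 - t) * ((1 - t) * a + t * b) + t * ((1 - t) * b + t * c) + 2 * ((1 - t) * p + t * s))"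
      using t a p b s c by (simp flip: ennreal_plus ennreal_mult' ennreal_numeral)
    finally have Jm: "J m = \<dots>" .
    have "J \<mu> = ennreal (a + 2 * p)"
      unfolding J_def a p using a p by (simp add: ennreal_plus ennreal_mult flip: ennreal_numeral)
    have "0 \<le> (1 - t) * ((1 - t) * a + t * b) + t * ((1 - t) * b + t * c) + 2 * ((1 - t) * p + t * s)"
      using t a(2) b(2) p(2) s(2) c(2)
      by (intro add_nonneg_nonneg mult_nonneg_nonneg) auto
    moreover note min[OF m, unfolded Jm \<open>J \<mu> = _\<close>]
    ultimately have "a + 2 * p \<le> (1 - t) * ((1 - t) * a + t * b) + t * ((1 - t) * b + t * c) + 2 * ((1 - t) * p + t * s)"
      by (simp only: ennreal_le_iff)
    then show ?thesis
      by (simp add: algebra_simps power2_eq_square)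
  qed
  define d where "d = a + p - b - s"
  define X where "X = a - 2 * b + c"
  \<comment> \<open>Small enough that the quadratic term is at most half of the linear term
    \<open>2 * t * d\<close>.\<close>
  define t where "t = min 1 (d / (\<bar>X\<bar> + 1))"
  have "0 < d" using \<delta> by (simp add: d_def)
  then have t: "0 < t" "t \<le> 1" by (auto simp: t_def)
  have "t * X \<le> t * \<bar>X\<bar>" using t by (intro mult_left_mono) auto
  also have "\<dots> \<le> d / (\<bar>X\<bar> + 1) * \<bar>X\<bar>" by (intro mult_right_mono) (auto simp: t_def)
  also have "\<dots> \<le> d" using \<open>0 < d\<close> by (simp add: divide_simps)
  finally have "t * X < 2 * d" using \<open>0 < d\<close> by simp
  then have "t * (t * X) < t * (2 * d)" using t by (intro mult_strict_left_mono)
  then show False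
    using key[of t] t unfolding d_def X_def by (simp add: algebra_simps power2_eq_square)
qed

text \<open>A measure of finite energy on a compact part of this set could be integrated against the
  strict inequality. Strictness survives because the constant is finite, and
  \<open>variational_inequality\<close> fails.\<close>

lemma frostman_log_polar:
  assumes \<mu>: "\<mu> \<in> probs K" and fin: "J \<mu> < \<infinity>" and min: "\<And>\<nu>. \<nu> \<in> probs K \<Longrightarrow> J \<mu> \<le> J \<nu>"
  shows "log_polar {x \<in> K. Upot \<mu> x + Qp x < mutual \<mu> \<mu> + (\<integral>\<^sup>+ x. Qp x \<partial>\<mu>)}"
  unfolding log_polar_def
proof (intro allI impI ballI, rule ccontr)
  fix C \<eta>
  let ?F = "mutual \<mu> \<mu> + (\<integral>\<^sup>+ x. Qp x \<partial>\<mu>)"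
  assume C: "C \<subseteq> {x \<in> K. Upot \<mu> x + Qp x < ?F} \<and> compact C"
    and \<eta>: "\<eta> \<in> probs C" and e: "energy \<eta> \<noteq> \<infinity>"
  have Cb: "C \<in> sets borel" using C by (simp add: compact_imp_closed)
  have \<eta>K: "\<eta> \<in> probs K" by (rule probs_mono[OF \<eta> _ Cb]) (use C in auto)
  interpret prob_space \<eta> using probsD[OF \<eta>] by simp
  have [measurable_cong]: "sets \<eta> = sets borel" using probsD[OF \<eta>] by simp
  note [measurable] = measurable_Upot[OF \<mu>]
  have fin\<eta>: "mutual \<eta> \<eta> < \<infinity>"
    using e energy_eq[OF probs_K_Sph[OF \<eta>K]] by (simp add: enn2ereal_eq_top_iff flip: less_top)
  have lt: "AE x in \<eta>. Upot \<mu> x + Qp x < ?F"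
    using probs_AE[OF \<eta> Cb] by eventually_elim (use C in auto)
  have const: "(\<integral>\<^sup>+ x. ?F \<partial>\<eta>) = ?F" using emeasure_space_1 by simp
  have "(\<integral>\<^sup>+ x. Upot \<mu> x + Qp x \<partial>\<eta>) \<le> (\<integral>\<^sup>+ x. ?F \<partial>\<eta>)"
    by (rule nn_integral_mono_AE) (use lt in eventually_elim, simp)
  moreover have "?F < \<infinity>"
    using fin by (auto simp: J_def ennreal_mult_eq_top_iff simp flip: less_top)
  ultimately have ne: "(\<integral>\<^sup>+ x. Upot \<mu> x + Qp x \<partial>\<eta>) \<noteq> \<infinity>"
    unfolding const by (auto simp: top_unique)
  have "(\<integral>\<^sup>+ x. Upot \<mu> x + Qp x \<partial>\<eta>) < (\<integral>\<^sup>+ x. ?F \<partial>\<eta>)"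
  proof (rule nn_integral_less[OF _ _ ne])
    show "\<not> (AE x in \<eta>. ?F \<le> Upot \<mu> x + Qp x)"
    proof
      assume "AE x in \<eta>. ?F \<le> Upot \<mu> x + Qp x"
      with lt have "AE x in \<eta>. False" by eventually_elim simp
      then show False by (simp add: AE_False)
    qed
    show "AE x in \<eta>. Upot \<mu> x + Qp x \<le> ?F" using lt by eventually_elim simp
  qed measurable
  also have "(\<integral>\<^sup>+ x. Upot \<mu> x + Qp x \<partial>\<eta>) = mutual \<mu> \<eta> + (\<integral>\<^sup>+ x. Qp x \<partial>\<eta>)"
    by (subst mutual_commute[OF \<mu> \<eta>], unfold mutual_def, subst nn_integral_add) auto
  finally show False
    using variational_inequality[OF \<mu> fin min \<eta>K fin\<eta>] unfolding const by simp
qed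

text \<open>One inequality holds off a log-polar set, which is null for \<open>\<mu>\<close>. Both
  sides have the same finite integral against \<open>\<mu>\<close>, which leaves only
  equality.\<close>

lemma frostman_AE:
  assumes \<mu>: "\<mu> \<in> probs K" and fin: "J \<mu> < \<infinity>" and min: "\<And>\<nu>. \<nu> \<in> probs K \<Longrightarrow> J \<mu> \<le> J \<nu>"
  shows "AE x in \<mu>. Upot \<mu> x + Qp x = mutual \<mu> \<mu> + (\<integral>\<^sup>+ x. Qp x \<partial>\<mu>)"
proof -
  let ?F = "mutual \<mu> \<mu> + (\<integral>\<^sup>+ x. Qp x \<partial>\<mu>)"
  interpret prob_space \<mu> using probsD[OF \<mu>] by simp
  have [measurable_cong]: "sets \<mu> = sets borel" using probsD[OF \<mu>] by simp
  note [measurable] = measurable_Upot[OF \<mu>]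
  have finE: "mutual \<mu> \<mu> < \<infinity>" and finF: "?F < \<infinity>"
    using fin by (auto simp: J_def ennreal_mult_eq_top_iff simp flip: less_top)
  have Bm: "{x \<in> K. Upot \<mu> x + Qp x < ?F} \<in> sets borel"
    by measurable
  have ge: "AE x in \<mu>. ?F \<le> Upot \<mu> x + Qp x"
  proof -
    have "AE x in \<mu>. x \<notin> {x \<in> K. Upot \<mu> x + Qp x < ?F}"
      using log_polar_null[OF probs_K_Sph[OF \<mu>] finE Bm frostman_log_polar[OF assms]] Bm
      by (intro AE_I[of _ _ "{x \<in> K. Upot \<mu> x + Qp x < ?F}"]) auto
    then show ?thesis
      using probs_K_AE[OF \<mu>] by eventually_elim auto
  qed
  have const: "(\<integral>\<^sup>+ x. ?F \<partial>\<mu>) = ?F" using emeasure_space_1 by simp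
  have tot: "(\<integral>\<^sup>+ x. Upot \<mu> x + Qp x \<partial>\<mu>) = ?F"
    unfolding mutual_def by (subst nn_integral_add) auto
  have "AE x in \<mu>. Upot \<mu> x + Qp x \<le> ?F"
  proof (rule ccontr)
    assume "\<not> ?thesis"
    then have "(\<integral>\<^sup>+ x. ?F \<partial>\<mu>) < (\<integral>\<^sup>+ x. Upot \<mu> x + Qp x \<partial>\<mu>)"
      using ge finF const by (intro nn_integral_less) auto
    then show False using const tot by simp
  qed
  with ge show ?thesis by eventually_elim simp
qed

end

section \<open>Positive definiteness and uniqueness\<close>

definition sph_centre :: pt where
  "sph_centre = vector [0, 0, 1/2]"

text \<open>Set to \<open>0\<close> off \<open>Sph\<close>, so that the kernels built from it are bounded everywhere.\<close>

definition unit_vec :: "pt \<Rightarrow> pt" where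
  "unit_vec x = (if x \<in> Sph then 2 *\<^sub>R (x - sph_centre) else 0)"

lemma norm_unit_vec: "x \<in> Sph \<Longrightarrow> norm (unit_vec x) = 1"
  by (simp add: unit_vec_def Sph_def sph_centre_def dist_norm norm_minus_commute)

lemma norm_unit_vec_le: "norm (unit_vec x) \<le> 1"
  by (cases "x \<in> Sph") (auto simp: norm_unit_vec, simp add: unit_vec_def)

lemma inner_unit_vec_le: "\<bar>unit_vec x \<bullet> unit_vec y\<bar> \<le> 1"
proof -
  have "\<bar>unit_vec x \<bullet> unit_vec y\<bar> \<le> norm (unit_vec x) * norm (unit_vec y)"
    by (rule Cauchy_Schwarz_ineq2)
  also have "\<dots> \<le> 1 * 1"
    by (intro mult_mono norm_unit_vec_le) auto
  finally show ?thesis by simp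
qed

lemma dist_Sph_inner:
  assumes "x \<in> Sph" "y \<in> Sph"
  shows "(dist x y)\<^sup>2 = (1 - unit_vec x \<bullet> unit_vec y) / 2"
proof -
  have "unit_vec x - unit_vec y = 2 *\<^sub>R (x - y)"
    using assms by (simp add: unit_vec_def algebra_simps)
  then have "(norm (unit_vec x - unit_vec y))\<^sup>2 = 4 * (dist x y)\<^sup>2"
    by (simp add: dist_norm power_mult_distrib)
  moreover have "(norm (unit_vec x - unit_vec y))\<^sup>2 = 2 - 2 * (unit_vec x \<bullet> unit_vec y)"
    using norm_unit_vec[OF assms(1)] norm_unit_vec[OF assms(2)]
    by (simp add: power2_norm_eq_inner inner_diff inner_commute norm_eq_1)
  ultimately show ?thesis by simp
qed

lemma measurable_unit_vec [measurable]: "unit_vec \<in> borel_measurable borel"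
  unfolding unit_vec_def using closed_Sph
  by (intro borel_measurable_continuous_on_if continuous_intros) auto

text \<open>Words are used instead of multi-indices: a power of the inner product is then a sum over
  words with all coefficients 1, without multinomial coefficients.\<close>

definition monomial :: "3 list \<Rightarrow> pt \<Rightarrow> real" where
  "monomial w v = (\<Prod>i\<leftarrow>w. v $ i)"

lemma monomial_simps [simp]:
  "monomial [] v = 1" "monomial (i # w) v = v $ i * monomial w v"
  "monomial (w @ w') v = monomial w v * monomial w' v"
  by (simp_all add: monomial_def)

lemma measurable_monomial [measurable]: "(\<lambda>x. monomial w (unit_vec x)) \<in> borel_measurable borel"
proof (induction w)
  case (Cons i w)
  have "(\<lambda>x. unit_vec x $ i) \<in> borel_measurable borel"
    by (rule borel_measurable_continuous_on[OF _ measurable_unit_vec]) (intro continuous_intros)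
  with Cons show ?case by simp
qed simp

lemma abs_monomial_le: "\<bar>monomial w (unit_vec x)\<bar> \<le> 1"
proof (induction w)
  case (Cons i w)
  have "\<bar>unit_vec x $ i\<bar> \<le> 1"
    using component_le_norm_cart[of "unit_vec x" i] norm_unit_vec_le[of x] by linarith
  with Cons have "\<bar>unit_vec x $ i\<bar> * \<bar>monomial w (unit_vec x)\<bar> \<le> 1 * 1"
    by (intro mult_mono) auto
  then show ?case by (simp add: abs_mult)
qed simp

lemma finite_words: "finite {w :: 3 list. length w = n}"
  using finite_lists_length_eq[of "UNIV :: 3 set" n] by simp

lemma inner_power_eq_sum_monomials:
  "(u \<bullet> v) ^ n = (\<Sum>w | length w = n. monomial w u * monomial w v)"
proof (induction n)
  case (Suc n)
  have eq: "{w :: 3 list. length w = Suc n} = (\<lambda>(i, w). i # w) ` (UNIV \<times> {w. length w = n})"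
    by (auto simp: length_Suc_conv image_iff)
  have "(\<Sum>w | length w = Suc n. monomial w u * monomial w v)
      = (\<Sum>(i, w)\<in>UNIV \<times> {w. length w = n}. (u $ i * v $ i) * (monomial w u * monomial w v))"
    unfolding eq by (subst sum.reindex) (auto simp: inj_on_def mult_ac split_beta intro!: sum.cong)
  also have "\<dots> = (\<Sum>i\<in>UNIV. \<Sum>w | length w = n. (u $ i * v $ i) * (monomial w u * monomial w v))"
    by (simp add: sum.cartesian_product)
  also have "\<dots> = (\<Sum>i\<in>UNIV. u $ i * v $ i) * (\<Sum>w | length w = n. monomial w u * monomial w v)"
    by (simp add: sum_product)
  finally show ?case
    using Suc by (simp add: inner_vec_def)
qed simp

section \<open>Moments and the damped energy\<close>

definition moment :: "pt measure \<Rightarrow> 3 list \<Rightarrow> real" where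
  "moment \<mu> w = (\<integral>x. monomial w (unit_vec x) \<partial>\<mu>)"

text \<open>On \<open>Sph\<close> one has \<open>- ln (dist x y) = (ln 2 - ln (1 - t)) / 2\<close> with
  \<open>t = unit_vec x \<bullet> unit_vec y\<close>. The factor \<open>\<rho> < 1\<close> makes the expansion
  \<open>- ln (1 - \<rho> * t) = (\<Sum>n. \<rho> ^ n * t ^ n / n)\<close> absolutely convergent; its term \<open>n = 0\<close> is
  \<open>1 / 0 = 0\<close>.\<close>

definition abel_kern :: "real \<Rightarrow> pt \<Rightarrow> pt \<Rightarrow> real" where
  "abel_kern \<rho> x y = (ln 2 - ln (1 - \<rho> * (unit_vec x \<bullet> unit_vec y))) / 2"

lemma measurable_abel_kern [measurable]:
  assumes [measurable]: "f \<in> borel_measurable M" "g \<in> borel_measurable M"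
  shows "(\<lambda>p. abel_kern \<rho> (f p) (g p)) \<in> borel_measurable M"
  unfolding abel_kern_def by measurable

lemma rho_inner_bounds:
  assumes "0 < \<rho>" "\<rho> < 1"
  shows "1 - \<rho> \<le> 1 - \<rho> * (unit_vec x \<bullet> unit_vec y)" "1 - \<rho> * (unit_vec x \<bullet> unit_vec y) \<le> 2"
    "\<bar>\<rho> * (unit_vec x \<bullet> unit_vec y)\<bar> \<le> \<rho>"
proof -
  have "\<bar>\<rho> * (unit_vec x \<bullet> unit_vec y)\<bar> \<le> \<rho> * 1"
    unfolding abs_mult using inner_unit_vec_le[of x y] assms by (intro mult_mono) auto
  then show "1 - \<rho> \<le> 1 - \<rho> * (unit_vec x \<bullet> unit_vec y)" "1 - \<rho> * (unit_vec x \<bullet> unit_vec y) \<le> 2"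
    "\<bar>\<rho> * (unit_vec x \<bullet> unit_vec y)\<bar> \<le> \<rho>" using assms by linarith+
qed

lemma abel_kern_nonneg:
  assumes "0 < \<rho>" "\<rho> < 1"
  shows "0 \<le> abel_kern \<rho> x y"
proof -
  have "ln (1 - \<rho> * (unit_vec x \<bullet> unit_vec y)) \<le> ln 2"
    using rho_inner_bounds[OF assms, of x y] assms by (subst ln_le_cancel_iff) auto
  then show ?thesis by (simp add: abel_kern_def)
qed

lemma abel_kern_le:
  assumes "0 < \<rho>" "\<rho> < 1"
  shows "abel_kern \<rho> x y \<le> (ln 2 - ln (1 - \<rho>)) / 2"
proof -
  have "ln (1 - \<rho>) \<le> ln (1 - \<rho> * (unit_vec x \<bullet> unit_vec y))"
    using rho_inner_bounds[OF assms, of x y] assms by (subst ln_le_cancel_iff) auto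
  then show ?thesis by (simp add: abel_kern_def)
qed

lemma ln_dist_Sph:
  assumes "x \<in> Sph" "y \<in> Sph" "x \<noteq> y"
  shows "unit_vec x \<bullet> unit_vec y < 1" "- ln (dist x y) = (ln 2 - ln (1 - unit_vec x \<bullet> unit_vec y)) / 2"
proof -
  have "0 < (dist x y)\<^sup>2" using assms by simp
  then show 1: "unit_vec x \<bullet> unit_vec y < 1"
    using dist_Sph_inner[OF assms(1,2)] by simp
  have "2 * ln (dist x y) = ln ((dist x y)\<^sup>2)"
    using assms by (simp add: ln_realpow)
  also have "\<dots> = ln (1 - unit_vec x \<bullet> unit_vec y) - ln 2"
    unfolding dist_Sph_inner[OF assms(1,2)] using 1 by (simp add: ln_div)
  finally show "- ln (dist x y) = (ln 2 - ln (1 - unit_vec x \<bullet> unit_vec y)) / 2" by simp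
qed

text \<open>For a negative inner product \<open>t\<close> the damped kernel exceeds the true one, so
  an error term is needed. The inequality \<open>\<rho> * (1 - t) \<le> 1 - \<rho> * t\<close> makes
  it uniform, and it vanishes as \<open>\<rho>\<close> tends to 1.\<close>

lemma abel_kern_le_lk:
  assumes "0 < \<rho>" "\<rho> < 1" "x \<in> Sph" "y \<in> Sph"
  shows "ennreal (abel_kern \<rho> x y) \<le> lk x y + ennreal (- ln \<rho> / 2)"
proof (cases "x = y")
  case False
  let ?t = "unit_vec x \<bullet> unit_vec y"
  have t: "?t < 1" and l: "- ln (dist x y) = (ln 2 - ln (1 - ?t)) / 2"
    using ln_dist_Sph[OF assms(3,4) False] by auto
  have "ln \<rho> + ln (1 - ?t) = ln (\<rho> * (1 - ?t))"
    using t assms by (simp add: ln_mult)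
  also have "\<dots> \<le> ln (1 - \<rho> * ?t)"
  proof -
    have "\<rho> * (1 - ?t) \<le> 1 - \<rho> * ?t" "0 < \<rho> * (1 - ?t)"
      using t assms by (simp_all add: right_diff_distrib flip: right_diff_distrib')
    then show ?thesis by simp
  qed
  finally have "abel_kern \<rho> x y \<le> - ln (dist x y) + - ln \<rho> / 2"
    unfolding l by (simp add: abel_kern_def field_simps)
  then have "ennreal (abel_kern \<rho> x y) \<le> ennreal (- ln (dist x y) + - ln \<rho> / 2)"
    by (rule ennreal_leI)
  also have "\<dots> = ennreal (- ln (dist x y)) + ennreal (- ln \<rho> / 2)"
    using assms dist_Sph_le_1[OF assms(3,4)] False by (intro ennreal_plus) (auto simp: ln_le_zero_iff)
  finally show ?thesis using False by (simp add: lk_eq)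
qed (simp add: lk_eq)

definition rho_seq :: "nat \<Rightarrow> real" where
  "rho_seq i = 1 - 1 / (real i + 2)"

lemma rho_seq: "0 < rho_seq i" "rho_seq i < 1"
  by (auto simp: rho_seq_def field_simps)

lemma rho_seq_tendsto: "rho_seq \<longlonglongrightarrow> 1"
  unfolding rho_seq_def by real_asymp

lemma lk_eq_lim_abel:
  assumes "x \<in> Sph" "y \<in> Sph"
  shows "(\<lambda>i. ennreal (abel_kern (rho_seq i) x y)) \<longlonglongrightarrow> lk x y"
proof (cases "x = y")
  case True
  have "unit_vec x \<bullet> unit_vec y = 1"
    using True norm_unit_vec[OF assms(1)] by (simp add: norm_eq_1)
  then have "(\<lambda>i. abel_kern (rho_seq i) x y) = (\<lambda>i. (ln 2 - ln (1 / (real i + 2))) / 2)"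
    by (simp add: abel_kern_def rho_seq_def)
  moreover have "filterlim (\<lambda>i. (ln 2 - ln (1 / (real i + 2))) / 2) at_top sequentially"
    by real_asymp
  ultimately show ?thesis
    using True by (simp add: lk_eq ennreal_tendsto_top_eq_at_top)
next
  case False
  have "(\<lambda>i. abel_kern (rho_seq i) x y) \<longlonglongrightarrow> (ln 2 - ln (1 - 1 * (unit_vec x \<bullet> unit_vec y))) / 2"
    unfolding abel_kern_def
    using ln_dist_Sph[OF assms False] by (intro tendsto_intros rho_seq_tendsto) auto
  moreover have "lk x y = ennreal ((ln 2 - ln (1 - 1 * (unit_vec x \<bullet> unit_vec y))) / 2)"
    unfolding mult_1_left ln_dist_Sph(2)[OF assms False, symmetric] using False by (simp add: lk_eq)
  ultimately show ?thesis
    by (simp only: tendsto_ennrealI)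
qed

text \<open>To be interpreted for the three pairs (\<mu>, \<nu>), (\<mu>, \<mu>) and (\<nu>, \<nu>)
  of a polarisation argument.\<close>

locale sph_pair =
  fixes \<mu> \<nu> :: "pt measure"
  assumes \<mu>: "\<mu> \<in> probs Sph" and \<nu>: "\<nu> \<in> probs Sph"
begin

sublocale M1: prob_space \<mu> using probsD[OF \<mu>] by simp
sublocale M2: prob_space \<nu> using probsD[OF \<nu>] by simp
sublocale pair_prob_space \<mu> \<nu> ..

lemma sets_pair [measurable_cong]: "sets \<mu> = sets borel" "sets \<nu> = sets borel"
  using probsD[OF \<mu>] probsD[OF \<nu>] by auto

lemma bounded_integrable:
  assumes "f \<in> borel_measurable (\<mu> \<Otimes>\<^sub>M \<nu>)" "\<And>p. \<bar>f p\<bar> \<le> B"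
  shows "integrable (\<mu> \<Otimes>\<^sub>M \<nu>) (f :: _ \<Rightarrow> real)"
  using assms by (intro integrable_const_bound[of _ B]) auto

lemma integral_inner_power:
  "(\<integral>p. (unit_vec (fst p) \<bullet> unit_vec (snd p)) ^ n \<partial>(\<mu> \<Otimes>\<^sub>M \<nu>))
    = (\<Sum>w | length w = n. moment \<mu> w * moment \<nu> w)"
proof -
  have int: "integrable (\<mu> \<Otimes>\<^sub>M \<nu>) (\<lambda>p. monomial w (unit_vec (fst p)) * monomial w (unit_vec (snd p)))" for w
  proof (rule bounded_integrable[of _ "1 * 1"])
    show "\<bar>monomial w (unit_vec (fst p)) * monomial w (unit_vec (snd p))\<bar> \<le> 1 * 1" for p
      unfolding abs_mult by (intro mult_mono abs_monomial_le) auto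
  qed measurable
  have "(\<integral>p. monomial w (unit_vec (fst p)) * monomial w (unit_vec (snd p)) \<partial>(\<mu> \<Otimes>\<^sub>M \<nu>)) = moment \<mu> w * moment \<nu> w" for w
    using integral_fst'[OF int[of w]] by (simp add: moment_def)
  then show ?thesis
    unfolding inner_power_eq_sum_monomials by (subst Bochner_Integration.integral_sum) (auto simp: int)
qed

definition abel_energy :: "real \<Rightarrow> real" where
  "abel_energy \<rho> = (\<integral>p. abel_kern \<rho> (fst p) (snd p) \<partial>(\<mu> \<Otimes>\<^sub>M \<nu>))"

text \<open>Fubini separates the monomials, and the geometric bound \<open>\<rho> ^ n\<close>
  permits integrating term by term. The damped energy thus becomes a diagonal form in the moments
  with nonnegative coefficients.\<close>

lemma abel_energy_sums:
  assumes \<rho>: "0 < \<rho>" "\<rho> < 1"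
  shows "(\<lambda>n. \<rho> ^ n / real n * (\<Sum>w | length w = n. moment \<mu> w * moment \<nu> w)) sums (2 * abel_energy \<rho> - ln 2)"
proof -
  let ?t = "\<lambda>p. unit_vec (fst p) \<bullet> unit_vec (snd p)"
  let ?f = "\<lambda>n p. \<rho> ^ n / real n * ?t p ^ n"
  have fb: "\<bar>?f n p\<bar> \<le> \<rho> ^ n" for n p
  proof -
    have "\<bar>?f n p\<bar> = \<rho> ^ n / real n * \<bar>?t p\<bar> ^ n"
      using \<rho> by (simp add: abs_mult power_abs)
    also have "\<dots> \<le> \<rho> ^ n * 1"
      using \<rho> inner_unit_vec_le[of "fst p" "snd p"]
      by (intro mult_mono power_le_one) (auto simp: divide_simps mult_le_cancel_left1)
    finally show ?thesis by simp
  qed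
  have geo: "summable (\<lambda>n. \<rho> ^ n)" using \<rho> by (intro summable_geometric) auto
  have int: "integrable (\<mu> \<Otimes>\<^sub>M \<nu>) (?f n)" for n
    by (rule bounded_integrable[OF _ fb]) measurable
  have s: "(\<lambda>n. ?f n p) sums (2 * abel_kern \<rho> (fst p) (snd p) - ln 2)" for p
  proof -
    have "\<bar>- (\<rho> * ?t p)\<bar> < 1" using rho_inner_bounds[OF \<rho>, of "fst p" "snd p"] \<rho> by simp
    from sums_minus[OF ln_series'[OF this]] show ?thesis
      by (simp add: abel_kern_def power_mult_distrib diff_divide_distrib)
  qed
  have "(\<lambda>n. \<integral>p. ?f n p \<partial>(\<mu> \<Otimes>\<^sub>M \<nu>)) sums (\<integral>p. (\<Sum>n. ?f n p) \<partial>(\<mu> \<Otimes>\<^sub>M \<nu>))"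
  proof (rule sums_integral[OF int])
    show "AE p in \<mu> \<Otimes>\<^sub>M \<nu>. summable (\<lambda>n. norm (?f n p))"
      by (intro AE_I2 summable_comparison_test'[OF geo, of 0]) (use fb in auto)
    show "summable (\<lambda>n. \<integral>p. norm (?f n p) \<partial>(\<mu> \<Otimes>\<^sub>M \<nu>))"
    proof (rule summable_comparison_test'[OF geo, of 0])
      fix n :: nat
      have "(\<integral>p. norm (?f n p) \<partial>(\<mu> \<Otimes>\<^sub>M \<nu>)) \<le> (\<integral>p. \<rho> ^ n \<partial>(\<mu> \<Otimes>\<^sub>M \<nu>))"
        by (intro integral_mono integrable_norm int) (use fb in auto)
      then show "norm (\<integral>p. norm (?f n p) \<partial>(\<mu> \<Otimes>\<^sub>M \<nu>)) \<le> \<rho> ^ n"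
        by (simp add: prob_space)
    qed
  qed
  moreover have "(\<integral>p. (\<Sum>n. ?f n p) \<partial>(\<mu> \<Otimes>\<^sub>M \<nu>)) = 2 * abel_energy \<rho> - ln 2"
  proof -
    have ik: "integrable (\<mu> \<Otimes>\<^sub>M \<nu>) (\<lambda>p. abel_kern \<rho> (fst p) (snd p))"
      by (rule bounded_integrable[of _ "(ln 2 - ln (1 - \<rho>)) / 2"])
         (use abel_kern_nonneg[OF \<rho>] abel_kern_le[OF \<rho>] in auto)
    have "(\<integral>p. (\<Sum>n. ?f n p) \<partial>(\<mu> \<Otimes>\<^sub>M \<nu>)) = (\<integral>p. 2 * abel_kern \<rho> (fst p) (snd p) - ln 2 \<partial>(\<mu> \<Otimes>\<^sub>M \<nu>))"
      using s by (simp add: sums_iff)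
    also have "\<dots> = 2 * abel_energy \<rho> - ln 2"
      using ik by (simp add: abel_energy_def prob_space)
    finally show ?thesis .
  qed
  moreover have "(\<integral>p. ?f n p \<partial>(\<mu> \<Otimes>\<^sub>M \<nu>)) = \<rho> ^ n / real n * (\<Sum>w | length w = n. moment \<mu> w * moment \<nu> w)" for n
    by (simp add: integral_inner_power)
  ultimately show ?thesis by (simp only:)
qed

lemma abel_energy_nn_integral:
  assumes \<rho>: "0 < \<rho>" "\<rho> < 1"
  shows "(\<integral>\<^sup>+ x. \<integral>\<^sup>+ y. ennreal (abel_kern \<rho> x y) \<partial>\<nu> \<partial>\<mu>) = ennreal (abel_energy \<rho>)"
proof -
  have ik: "integrable (\<mu> \<Otimes>\<^sub>M \<nu>) (\<lambda>p. abel_kern \<rho> (fst p) (snd p))"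
    by (rule bounded_integrable[of _ "(ln 2 - ln (1 - \<rho>)) / 2"])
       (use abel_kern_nonneg[OF \<rho>] abel_kern_le[OF \<rho>] in auto)
  have "(\<lambda>p. ennreal (abel_kern \<rho> (fst p) (snd p))) \<in> borel_measurable (\<mu> \<Otimes>\<^sub>M \<nu>)" by measurable
  from M2.nn_integral_fst[OF this] show ?thesis
    using nn_integral_eq_integral[OF ik] abel_kern_nonneg[OF \<rho>]
    by (simp add: abel_energy_def)
qed

lemma abel_energy_nonneg: "0 < \<rho> \<Longrightarrow> \<rho> < 1 \<Longrightarrow> 0 \<le> abel_energy \<rho>"
  unfolding abel_energy_def by (intro integral_nonneg_AE) (simp add: abel_kern_nonneg)

lemma abel_energy_le:
  assumes \<rho>: "0 < \<rho>" "\<rho> < 1"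
  shows "ennreal (abel_energy \<rho>) \<le> mutual \<mu> \<nu> + ennreal (- ln \<rho> / 2)"
proof -
  have "ennreal (abel_energy \<rho>) \<le> (\<integral>\<^sup>+ x. \<integral>\<^sup>+ y. lk x y + ennreal (- ln \<rho> / 2) \<partial>\<nu> \<partial>\<mu>)"
    unfolding abel_energy_nn_integral[OF \<rho>, symmetric]
  proof (rule nn_integral_mono_AE, use probs_Sph_AE[OF \<mu>] in eventually_elim)
    fix x assume x: "x \<in> Sph"
    show "(\<integral>\<^sup>+ y. ennreal (abel_kern \<rho> x y) \<partial>\<nu>) \<le> (\<integral>\<^sup>+ y. lk x y + ennreal (- ln \<rho> / 2) \<partial>\<nu>)"
      by (rule nn_integral_mono_AE, use probs_Sph_AE[OF \<nu>] in eventually_elim) (rule abel_kern_le_lk[OF \<rho> x])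
  qed
  also have "\<dots> = (\<integral>\<^sup>+ x. Upot \<nu> x + ennreal (- ln \<rho> / 2) \<partial>\<mu>)"
    unfolding Upot_def by (subst nn_integral_add) (auto simp: M2.emeasure_space_1)
  also have "\<dots> = mutual \<mu> \<nu> + ennreal (- ln \<rho> / 2)"
    unfolding mutual_def using measurable_Upot[OF \<nu>]
    by (subst nn_integral_add) (auto simp: M1.emeasure_space_1)
  finally show ?thesis .
qed

text \<open>Fatou gives this direction, the one needed for the mixed energy, which stands on the
  smaller side of \<open>positive_definite\<close>. The energies of single measures need the
  opposite bound, \<open>abel_energy_le\<close>.\<close>

lemma mutual_le_liminf_abel: "mutual \<mu> \<nu> \<le> liminf (\<lambda>i. ennreal (abel_energy (rho_seq i)))"
proof -
  have "mutual \<mu> \<nu> \<le> (\<integral>\<^sup>+ x. \<integral>\<^sup>+ y. liminf (\<lambda>i. ennreal (abel_kern (rho_seq i) x y)) \<partial>\<nu> \<partial>\<mu>)"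
    unfolding mutual_def Upot_def
  proof (rule nn_integral_mono_AE, use probs_Sph_AE[OF \<mu>] in eventually_elim)
    fix x assume x: "x \<in> Sph"
    show "(\<integral>\<^sup>+ y. lk x y \<partial>\<nu>) \<le> (\<integral>\<^sup>+ y. liminf (\<lambda>i. ennreal (abel_kern (rho_seq i) x y)) \<partial>\<nu>)"
      by (rule nn_integral_mono_AE, use probs_Sph_AE[OF \<nu>] in eventually_elim)
         (simp add: lim_imp_Liminf[OF _ lk_eq_lim_abel[OF x]])
  qed
  also have "\<dots> \<le> (\<integral>\<^sup>+ x. liminf (\<lambda>i. \<integral>\<^sup>+ y. ennreal (abel_kern (rho_seq i) x y) \<partial>\<nu>) \<partial>\<mu>)"
    by (intro nn_integral_mono nn_integral_liminf) measurable
  also have "\<dots> \<le> liminf (\<lambda>i. \<integral>\<^sup>+ x. \<integral>\<^sup>+ y. ennreal (abel_kern (rho_seq i) x y) \<partial>\<nu> \<partial>\<mu>)"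
    by (intro nn_integral_liminf) measurable
  finally show ?thesis
    by (simp add: abel_energy_nn_integral[OF rho_seq])
qed

end

text \<open>The damped energy of the difference is a sum of squared moment differences with weights
  \<open>\<rho> ^ n / (2 * n)\<close>, the 2 from the halved logarithm and the n from its series;
  the term of \<open>w\<close> is kept and \<open>\<rho>\<close> tends to 1. The empty word has
  weight 0. Nothing is subtracted, because energies may be infinite.\<close>

lemma positive_definite:
  assumes \<mu>: "\<mu> \<in> probs Sph" and \<nu>: "\<nu> \<in> probs Sph" and w: "w \<noteq> []"
  shows "mutual \<mu> \<nu> + mutual \<mu> \<nu> + ennreal ((moment \<mu> w - moment \<nu> w)\<^sup>2 / (2 * real (length w)))
    \<le> mutual \<mu> \<mu> + mutual \<nu> \<nu>"
proof -
  interpret mn: sph_pair \<mu> \<nu> by standard (use assms in auto)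
  interpret mm: sph_pair \<mu> \<mu> by standard (use assms in auto)
  interpret nn: sph_pair \<nu> \<nu> by standard (use assms in auto)
  let ?n = "length w" and ?\<delta> = "(moment \<mu> w - moment \<nu> w)\<^sup>2"
  have real: "2 * mn.abel_energy \<rho> + \<rho> ^ ?n * (?\<delta> / (2 * real ?n)) \<le> mm.abel_energy \<rho> + nn.abel_energy \<rho>"
    if \<rho>: "0 < \<rho>" "\<rho> < 1" for \<rho>
  proof -
    \<comment> \<open>The constants \<open>ln 2\<close> cancel, since both measures have total mass
      1.\<close>
    have "(\<lambda>n. \<rho> ^ n / real n * (\<Sum>w | length w = n. (moment \<mu> w - moment \<nu> w)\<^sup>2)) sums
      ((2 * mm.abel_energy \<rho> - ln 2) + (2 * nn.abel_energy \<rho> - ln 2) - 2 * (2 * mn.abel_energy \<rho> - ln 2))"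
    proof -
      have "\<rho> ^ n / real n * (\<Sum>w | length w = n. (moment \<mu> w - moment \<nu> w)\<^sup>2)
        = \<rho> ^ n / real n * (\<Sum>w | length w = n. moment \<mu> w * moment \<mu> w)
        + \<rho> ^ n / real n * (\<Sum>w | length w = n. moment \<nu> w * moment \<nu> w)
        - 2 * (\<rho> ^ n / real n * (\<Sum>w | length w = n. moment \<mu> w * moment \<nu> w))" for n
      proof -
        have "(\<Sum>w | length w = n. (moment \<mu> w - moment \<nu> w)\<^sup>2)
          = (\<Sum>w | length w = n. moment \<mu> w * moment \<mu> w) + (\<Sum>w | length w = n. moment \<nu> w * moment \<nu> w)
           - 2 * (\<Sum>w | length w = n. moment \<mu> w * moment \<nu> w)"
          by (simp add: sum.distrib[symmetric] sum_distrib_left sum_subtractf[symmetric] power2_eq_square algebra_simps)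
        moreover have "c * (A + B - 2 * C) = c * A + c * B - 2 * (c * C)" for c A B C :: real
          by (simp add: algebra_simps)
        ultimately show ?thesis by simp
      qed
      then show ?thesis
        using sums_diff[OF sums_add[OF mm.abel_energy_sums[OF \<rho>] nn.abel_energy_sums[OF \<rho>]]
            sums_mult[OF mn.abel_energy_sums[OF \<rho>], of 2]] by simp
    qed
    then have s: "(\<lambda>n. \<rho> ^ n / real n * (\<Sum>w | length w = n. (moment \<mu> w - moment \<nu> w)\<^sup>2)) sums
      (2 * (mm.abel_energy \<rho> + nn.abel_energy \<rho> - 2 * mn.abel_energy \<rho>))" by (simp add: algebra_simps)
    have "?\<delta> \<le> (\<Sum>w | length w = ?n. (moment \<mu> w - moment \<nu> w)\<^sup>2)"
      by (rule member_le_sum) (auto simp: finite_words)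
    then have "\<rho> ^ ?n / real ?n * ?\<delta> \<le> \<rho> ^ ?n / real ?n * (\<Sum>w | length w = ?n. (moment \<mu> w - moment \<nu> w)\<^sup>2)"
      using \<rho> by (intro mult_left_mono) auto
    also have "\<dots> = (\<Sum>n\<in>{?n}. \<rho> ^ n / real n * (\<Sum>w | length w = n. (moment \<mu> w - moment \<nu> w)\<^sup>2))"
      by simp
    also have "\<dots> \<le> (\<Sum>n. \<rho> ^ n / real n * (\<Sum>w | length w = n. (moment \<mu> w - moment \<nu> w)\<^sup>2))"
      by (rule sum_le_suminf[OF sums_summable[OF s]]) (use \<rho> in \<open>auto intro!: divide_nonneg_nonneg mult_nonneg_nonneg sum_nonneg\<close>)
    also have "\<dots> = 2 * (mm.abel_energy \<rho> + nn.abel_energy \<rho> - 2 * mn.abel_energy \<rho>)"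
      using s by (simp add: sums_iff)
    finally show ?thesis using w by (simp add: field_simps)
  qed
  let ?d = "?\<delta> / (2 * real ?n)"
  have step: "ennreal (mn.abel_energy (rho_seq i)) + ennreal (mn.abel_energy (rho_seq i)) + ennreal (rho_seq i ^ ?n * ?d)
    \<le> mutual \<mu> \<mu> + mutual \<nu> \<nu> + ennreal (- ln (rho_seq i))" for i
  proof -
    note \<rho> = rho_seq[of i]
    have "ennreal (mn.abel_energy (rho_seq i)) + ennreal (mn.abel_energy (rho_seq i)) + ennreal (rho_seq i ^ ?n * ?d)
      = ennreal (2 * mn.abel_energy (rho_seq i) + rho_seq i ^ ?n * ?d)"
      using mn.abel_energy_nonneg[OF \<rho>] \<rho> by (simp flip: ennreal_plus)
    also have "\<dots> \<le> ennreal (mm.abel_energy (rho_seq i) + nn.abel_energy (rho_seq i))"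
      using real[OF \<rho>] by (rule ennreal_leI)
    also have "\<dots> = ennreal (mm.abel_energy (rho_seq i)) + ennreal (nn.abel_energy (rho_seq i))"
      using mm.abel_energy_nonneg[OF \<rho>] nn.abel_energy_nonneg[OF \<rho>] by (rule ennreal_plus)
    also have "\<dots> \<le> (mutual \<mu> \<mu> + ennreal (- ln (rho_seq i) / 2)) + (mutual \<nu> \<nu> + ennreal (- ln (rho_seq i) / 2))"
      by (intro add_mono mm.abel_energy_le nn.abel_energy_le \<rho>)
    also have "\<dots> = mutual \<mu> \<mu> + mutual \<nu> \<nu> + (ennreal (- ln (rho_seq i) / 2) + ennreal (- ln (rho_seq i) / 2))"
      by (simp add: ac_simps)
    also have "ennreal (- ln (rho_seq i) / 2) + ennreal (- ln (rho_seq i) / 2) = ennreal (- ln (rho_seq i))"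
      using \<rho> by (subst ennreal_plus[symmetric]) auto
    finally show ?thesis .
  qed
  have lim1: "(\<lambda>i. ennreal (rho_seq i ^ ?n * ?d)) \<longlonglongrightarrow> ennreal (1 ^ ?n * ?d)"
    by (intro tendsto_ennrealI tendsto_intros rho_seq_tendsto)
  have lim2: "(\<lambda>i. mutual \<mu> \<mu> + mutual \<nu> \<nu> + ennreal (- ln (rho_seq i))) \<longlonglongrightarrow> mutual \<mu> \<mu> + mutual \<nu> \<nu> + ennreal (- ln 1)"
    by (intro tendsto_intros tendsto_ennrealI rho_seq_tendsto) auto
  let ?a = "\<lambda>i. ennreal (mn.abel_energy (rho_seq i))" and ?b = "\<lambda>i. ennreal (rho_seq i ^ ?n * ?d)"
  have "mutual \<mu> \<nu> + mutual \<mu> \<nu> + ennreal ?d \<le> liminf ?a + liminf ?a + liminf ?b"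
    using lim_imp_Liminf[OF _ lim1] mn.mutual_le_liminf_abel by (intro add_mono) auto
  also have "\<dots> \<le> liminf (\<lambda>i. ?a i + ?a i) + liminf ?b"
    by (intro add_right_mono ennreal_liminf_add)
  also have "\<dots> \<le> liminf (\<lambda>i. ?a i + ?a i + ?b i)"
    by (rule ennreal_liminf_add)
  also have "\<dots> \<le> liminf (\<lambda>i. mutual \<mu> \<mu> + mutual \<nu> \<nu> + ennreal (- ln (rho_seq i)))"
    by (intro Liminf_mono always_eventually allI step)
  also have "\<dots> = mutual \<mu> \<mu> + mutual \<nu> \<nu>"
    using lim_imp_Liminf[OF _ lim2] by simp
  finally show ?thesis .
qed

text \<open>A list of terms avoids collecting equal monomials: sums become concatenation of lists,
  products the pairwise concatenation of words.\<close>

lemma polynomial_eq_sum_monomials: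
  assumes "real_polynomial_function (p :: pt \<Rightarrow> real)"
  shows "\<exists>cs. \<forall>v. p v = (\<Sum>(c, w)\<leftarrow>cs. c * monomial w v)"
  using assms
proof (induction p rule: real_polynomial_function.induct)
  case (linear f)
  interpret bounded_linear f by fact
  obtain js :: "3 list" where "set js = UNIV" "distinct js"
    using finite_distinct_list[of "UNIV :: 3 set"] by auto
  have "f v = (\<Sum>(c, w)\<leftarrow>map (\<lambda>i. (f (axis i 1), [i])) js. c * monomial w v)" for v
  proof -
    have "f v = f (\<Sum>i\<in>UNIV. v $ i *\<^sub>R axis i 1)"
      using basis_expansion[of v] by (simp add: scalar_mult_eq_scaleR)
    also have "\<dots> = (\<Sum>i\<in>UNIV. f (axis i 1) * v $ i)"
      by (simp add: sum scaleR mult.commute)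
    also have "\<dots> = (\<Sum>i\<leftarrow>js. f (axis i 1) * v $ i)"
      using \<open>set js = UNIV\<close> \<open>distinct js\<close> by (simp add: sum_list_distinct_conv_sum_set)
    finally show ?thesis by (simp add: comp_def)
  qed
  then show ?case by blast
next
  case (const c)
  have "c = (\<Sum>(c, w)\<leftarrow>[(c, [])]. c * monomial w v)" for v by simp
  then show ?case by blast
next
  case (add f g)
  then obtain cs ds where "\<forall>v. f v = (\<Sum>(c, w)\<leftarrow>cs. c * monomial w v)" "\<forall>v. g v = (\<Sum>(c, w)\<leftarrow>ds. c * monomial w v)"
    by blast
  then have "\<forall>v. f v + g v = (\<Sum>(c, w)\<leftarrow>cs @ ds. c * monomial w v)" by simp
  then show ?case by blast
next
  case (mult f g)
  then obtain cs ds where f: "\<forall>v. f v = (\<Sum>(c, w)\<leftarrow>cs. c * monomial w v)" and g: "\<forall>v. g v = (\<Sum>(c, w)\<leftarrow>ds. c * monomial w v)"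
    by blast
  have one: "(\<Sum>(d, u)\<leftarrow>map (\<lambda>(d, u). (c * d, w @ u)) ds. d * monomial u v) = (c * monomial w v) * (\<Sum>(d, u)\<leftarrow>ds. d * monomial u v)" for c w v
    by (induction ds) (auto simp: algebra_simps)
  have "(\<Sum>(c, w)\<leftarrow>concat (map (\<lambda>(c, w). map (\<lambda>(d, u). (c * d, w @ u)) ds) cs). c * monomial w v)
     = (\<Sum>(c, w)\<leftarrow>cs. c * monomial w v) * (\<Sum>(d, u)\<leftarrow>ds. d * monomial u v)" for v
    by (induction cs) (auto simp: one[unfolded map_map] algebra_simps)
  then have "\<forall>v. f v * g v = (\<Sum>(c, w)\<leftarrow>concat (map (\<lambda>(c, w). map (\<lambda>(d, u). (c * d, w @ u)) ds) cs). c * monomial w v)"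
    using f g by simp
  then show ?case by blast
qed

lemma integrable_monomial:
  assumes "\<mu> \<in> probs Sph"
  shows "integrable \<mu> (\<lambda>x. monomial w (unit_vec x))"
proof -
  interpret prob_space \<mu> using probsD[OF assms] by simp
  show ?thesis
    by (rule integrable_const_bound[of _ 1]) (auto simp: abs_monomial_le probs_measurable[OF assms])
qed

lemma integral_polynomial_moments:
  assumes \<mu>: "\<mu> \<in> probs Sph"
  shows "integrable \<mu> (\<lambda>x. \<Sum>(c, w)\<leftarrow>cs. c * monomial w (unit_vec x)) \<and>
    (\<integral>x. (\<Sum>(c, w)\<leftarrow>cs. c * monomial w (unit_vec x)) \<partial>\<mu>) = (\<Sum>(c, w)\<leftarrow>cs. c * moment \<mu> w)"
  by (induction cs) (auto simp: integrable_monomial[OF \<mu>] moment_def)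

text \<open>Stone-Weierstrass on the unit sphere, to which \<open>Sph\<close> is rescaled: both
  integrals come within \<open>e / 2\<close> of the same combination of moments, which contradicts a
  gap of \<open>2 * e\<close>.\<close>

lemma moments_determine_integral:
  assumes \<mu>: "\<mu> \<in> probs Sph" and \<nu>: "\<nu> \<in> probs Sph" and mom: "\<And>w. moment \<mu> w = moment \<nu> w"
    and f: "continuous_on UNIV f"
  shows "(\<integral>x. f x \<partial>\<mu>) = (\<integral>x. f x \<partial>\<nu> :: real)"
proof (rule ccontr)
  assume neq: "\<not> ?thesis"
  define e where "e = \<bar>(\<integral>x. f x \<partial>\<mu>) - (\<integral>x. f x \<partial>\<nu>)\<bar> / 2"
  have "e > 0" using neq by (simp add: e_def)
  have cont: "continuous_on (sphere 0 1) (\<lambda>v. f (sph_centre + (1/2) *\<^sub>R v))"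
    by (intro continuous_on_compose2[OF f] continuous_intros) auto
  obtain p where p: "real_polynomial_function p"
    and close: "\<And>v. v \<in> sphere 0 1 \<Longrightarrow> \<bar>f (sph_centre + (1/2) *\<^sub>R v) - p v\<bar> < e / 2"
    by (rule Stone_Weierstrass_real_polynomial_function[OF compact_sphere cont half_gt_zero[OF \<open>e > 0\<close>]])
       (rule that)
  obtain cs where cs: "\<And>v. p v = (\<Sum>(c, w)\<leftarrow>cs. c * monomial w v)"
    using polynomial_eq_sum_monomials[OF p] by blast
  have approx: "\<bar>f x - p (unit_vec x)\<bar> < e / 2" if "x \<in> Sph" for x
  proof -
    have "sph_centre + (1/2) *\<^sub>R unit_vec x = x"
      using that by (simp add: unit_vec_def)
    then show ?thesis
      using close[of "unit_vec x"] norm_unit_vec[OF that] by simp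
  qed
  have "\<exists>B. \<forall>x\<in>Sph. \<bar>f x\<bar> \<le> B"
    using compact_continuous_image[OF continuous_on_subset[OF f], OF subset_UNIV compact_Sph]
    by (auto dest!: compact_imp_bounded simp: bounded_real)
  then obtain B where B: "\<And>x. x \<in> Sph \<Longrightarrow> \<bar>f x\<bar> \<le> B" by blast
  have bd: "\<bar>(\<integral>x. f x \<partial>\<rho>) - (\<Sum>(c, w)\<leftarrow>cs. c * moment \<rho> w)\<bar> \<le> e / 2" if \<rho>: "\<rho> \<in> probs Sph" for \<rho>
  proof -
    interpret prob_space \<rho> using probsD[OF \<rho>] by simp
    have fm: "f \<in> borel_measurable \<rho>"
      using borel_measurable_continuous_onI[OF f] by (simp add: probs_measurable[OF \<rho>])
    have fi: "integrable \<rho> f"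
      by (rule integrable_const_bound[OF _ fm, of B]) (use probs_Sph_AE[OF \<rho>] in \<open>eventually_elim, auto simp: B\<close>)
    have pi: "integrable \<rho> (\<lambda>x. p (unit_vec x))"
      and peq: "(\<integral>x. p (unit_vec x) \<partial>\<rho>) = (\<Sum>(c, w)\<leftarrow>cs. c * moment \<rho> w)"
      using integral_polynomial_moments[OF \<rho>, of cs] by (simp_all add: cs)
    have "\<bar>(\<integral>x. f x \<partial>\<rho>) - (\<integral>x. p (unit_vec x) \<partial>\<rho>)\<bar> = \<bar>\<integral>x. f x - p (unit_vec x) \<partial>\<rho>\<bar>"
      using fi pi by simp
    also have "\<dots> \<le> (\<integral>x. \<bar>f x - p (unit_vec x)\<bar> \<partial>\<rho>)"
      by (rule integral_abs_bound)
    also have "\<dots> \<le> (\<integral>x. e / 2 \<partial>\<rho>)"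
      using fi pi probs_Sph_AE[OF \<rho>]
      by (intro integral_mono_AE) (auto elim!: eventually_mono dest: approx)
    also have "\<dots> = e / 2" by (simp add: prob_space)
    finally show ?thesis unfolding peq .
  qed
  have "\<bar>(\<integral>x. f x \<partial>\<mu>) - (\<integral>x. f x \<partial>\<nu>)\<bar> \<le> e"
    using bd[OF \<mu>] bd[OF \<nu>] unfolding mom by linarith
  then show False using \<open>e > 0\<close> by (simp add: e_def)
qed

text \<open>Closed sets form an intersection-stable generator, and the indicator of a closed set is
  the limit of the continuous tents \<open>g n\<close>.\<close>

lemma moments_determine_measure:
  assumes \<mu>: "\<mu> \<in> probs Sph" and \<nu>: "\<nu> \<in> probs Sph" and mom: "\<And>w. moment \<mu> w = moment \<nu> w"
  shows "\<mu> = \<nu>"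
proof (rule measure_eqI_generator_eq[where E = "Collect closed" and \<Omega> = UNIV and A = "\<lambda>_. UNIV"])
  show "sets \<mu> = sigma_sets UNIV (Collect closed)" "sets \<nu> = sigma_sets UNIV (Collect closed)"
    using probsD[OF \<mu>] probsD[OF \<nu>] by (simp_all add: borel_eq_closed)
  show "Int_stable (Collect closed :: pt set set)"
    by (auto simp: Int_stable_def)
  show "emeasure \<mu> UNIV \<noteq> \<infinity>"
    using prob_space.emeasure_space_1[OF probsD(1)[OF \<mu>]] probsD(4)[OF \<mu>] by simp
  fix C :: "pt set" assume "C \<in> Collect closed"
  then have C: "closed C" by simp
  show "emeasure \<mu> C = emeasure \<nu> C"
  proof (cases "C = {}")
    case False
    define g where "g n x = max 0 (1 - real n * infdist x C)" for n x
    have gc: "continuous_on UNIV (g n)" for n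
      unfolding g_def by (intro continuous_intros)
    have gb: "\<bar>g n x\<bar> \<le> 1" for n x
      using infdist_nonneg[of x C] by (auto simp: g_def)
    have glim: "(\<lambda>n. g n x) \<longlonglongrightarrow> indicator C x" for x
    proof (cases "x \<in> C")
      case True
      then show ?thesis by (simp add: g_def)
    next
      case x: False
      then have "infdist x C > 0"
        using C False by (simp add: infdist_pos_not_in_closed)
      then obtain m :: nat where m: "1 / infdist x C \<le> real m"
        using real_arch_simple by blast
      have "g n x = 0" if "n \<ge> m" for n
      proof -
        have "1 / infdist x C \<le> real n" using m that by linarith
        then show ?thesis using \<open>infdist x C > 0\<close> by (simp add: g_def field_simps)
      qed
      then have "eventually (\<lambda>n. g n x = 0) sequentially"
        using eventually_sequentially by blast
      then show ?thesis using x by (simp add: tendsto_eventually)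
    qed
    have lim: "(\<lambda>n. \<integral>x. g n x \<partial>\<rho>) \<longlonglongrightarrow> measure \<rho> C" if \<rho>: "\<rho> \<in> probs Sph" for \<rho>
    proof -
      interpret prob_space \<rho> using probsD[OF \<rho>] by simp
      have "(\<lambda>n. \<integral>x. g n x \<partial>\<rho>) \<longlonglongrightarrow> (\<integral>x. indicator C x \<partial>\<rho>)"
        by (rule integral_dominated_convergence[where w = "\<lambda>_. 1"])
           (use C glim gb borel_measurable_continuous_onI[OF gc] in \<open>auto simp: probs_measurable[OF \<rho>]\<close>)
      then show ?thesis using C probsD[OF \<rho>] by simp
    qed
    have "(\<integral>x. g n x \<partial>\<mu>) = (\<integral>x. g n x \<partial>\<nu>)" for n
      by (rule moments_determine_integral[OF \<mu> \<nu> mom gc])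
    with lim[OF \<mu>] lim[OF \<nu>] have "measure \<mu> C = measure \<nu> C"
      by (simp add: LIMSEQ_unique)
    moreover have "finite_measure \<mu>" "finite_measure \<nu>"
      using probsD[OF \<mu>] probsD[OF \<nu>] by (auto simp: prob_space_def)
    ultimately show ?thesis by (simp add: finite_measure.emeasure_eq_measure)
  qed simp
qed auto

context weighted_problem
begin

text \<open>The parallelogram argument: at the midpoint \<open>J\<close> lies below the common
  minimum by a quarter of the energy of the difference, so that energy is 0, and it bounds the
  squared difference of every moment.\<close>

lemma minimizer_unique:
  assumes \<mu>: "\<mu> \<in> probs K" and min\<mu>: "\<And>\<rho>. \<rho> \<in> probs K \<Longrightarrow> J \<mu> \<le> J \<rho>" and fin: "J \<mu> < \<infinity>"
    and \<nu>: "\<nu> \<in> probs K" and min\<nu>: "\<And>\<rho>. \<rho> \<in> probs K \<Longrightarrow> J \<nu> \<le> J \<rho>"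
  shows "\<mu> = \<nu>"
proof (rule moments_determine_measure[OF probs_K_Sph[OF \<mu>] probs_K_Sph[OF \<nu>]])
  have eqJ: "J \<nu> = J \<mu>" using min\<mu>[OF \<nu>] min\<nu>[OF \<mu>] by (rule antisym[rotated])
  define h :: real where "h = 1/2"
  have h: "0 \<le> h" "h \<le> 1" by (auto simp: h_def)
  obtain m where m: "m \<in> probs K" and
    int: "\<And>f. f \<in> borel_measurable borel \<Longrightarrow>
      (\<integral>\<^sup>+ x. f x \<partial>m) = ennreal (1 - h) * (\<integral>\<^sup>+ x. f x \<partial>\<mu>) + ennreal h * (\<integral>\<^sup>+ x. f x \<partial>\<nu>)"
    by (rule convex_combination_probs[OF \<mu> \<nu> K_borel, of h]) (auto simp: h_def)
  have mm: "mutual m m = ennreal (1 - h) * (ennreal (1 - h) * mutual \<mu> \<mu> + ennreal h * mutual \<mu> \<nu>)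
      + ennreal h * (ennreal (1 - h) * mutual \<mu> \<nu> + ennreal h * mutual \<nu> \<nu>)"
    by (rule mutual_convex_combination[OF \<mu> \<nu> m int])
  fix w
  show "moment \<mu> w = moment \<nu> w"
  proof (cases "w = []")
    \<comment> \<open>The empty word records the total mass, on which
      \<open>positive_definite\<close> is silent.\<close>
    case True
    then show ?thesis
      using prob_space.prob_space[OF probsD(1)[OF \<mu>]] prob_space.prob_space[OF probsD(1)[OF \<nu>]]
      by (simp add: moment_def)
  next
    case False
    let ?d = "(moment \<mu> w - moment \<nu> w)\<^sup>2 / (2 * real (length w))"
    have "mutual \<mu> \<mu> < \<infinity>" "(\<integral>\<^sup>+ x. Qp x \<partial>\<mu>) < \<infinity>" "mutual \<nu> \<nu> < \<infinity>" "(\<integral>\<^sup>+ x. Qp x \<partial>\<nu>) < \<infinity>"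
      using fin fin[folded eqJ] by (auto simp: J_def ennreal_mult_eq_top_iff simp flip: less_top)
    moreover have pd: "mutual \<mu> \<nu> + mutual \<mu> \<nu> + ennreal ?d \<le> mutual \<mu> \<mu> + mutual \<nu> \<nu>"
      by (rule positive_definite[OF probs_K_Sph[OF \<mu>] probs_K_Sph[OF \<nu>] False])
    \<comment> \<open>Finiteness of the mixed energy is itself a consequence of positive
      definiteness.\<close>
    moreover from this have "mutual \<mu> \<nu> < \<infinity>"
      using \<open>mutual \<mu> \<mu> < \<infinity>\<close> \<open>mutual \<nu> \<nu> < \<infinity>\<close> by (auto simp: top_unique simp flip: less_top)
    ultimately obtain a p b s c where
      a: "mutual \<mu> \<mu> = ennreal a" "0 \<le> a" and p: "(\<integral>\<^sup>+ x. Qp x \<partial>\<mu>) = ennreal p" "0 \<le> p"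
      and b: "mutual \<mu> \<nu> = ennreal b" "0 \<le> b" and s: "(\<integral>\<^sup>+ x. Qp x \<partial>\<nu>) = ennreal s" "0 \<le> s"
      and c: "mutual \<nu> \<nu> = ennreal c" "0 \<le> c"
      by (auto simp: less_top_ennreal)
    have d0: "0 \<le> ?d" by simp
    have 1: "b + b + ?d \<le> a + c"
      using pd a b c d0 by (simp add: ennreal_le_iff flip: ennreal_plus)
    have J\<mu>: "J \<mu> = ennreal (a + 2 * p)"
      unfolding J_def a p using a p by (simp add: ennreal_plus ennreal_mult flip: ennreal_numeral)
    have J\<nu>: "J \<nu> = ennreal (c + 2 * s)"
      unfolding J_def c s using c s by (simp add: ennreal_plus ennreal_mult flip: ennreal_numeral)
    have 2: "c + 2 * s = a + 2 * p"
      using eqJ a c p s unfolding J\<mu> J\<nu> by (subst (asm) ennreal_inj) auto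
    have Jm: "J m = ennreal ((1 - h) * ((1 - h) * a + h * b) + h * ((1 - h) * b + h * c) + 2 * ((1 - h) * p + h * s))"
      unfolding J_def mm int[OF Qp_measurable] a p b s c
      using h a p b s c by (simp flip: ennreal_plus ennreal_mult' ennreal_numeral)
    have "a + 2 * p \<le> (1 - h) * ((1 - h) * a + h * b) + h * ((1 - h) * b + h * c) + 2 * ((1 - h) * p + h * s)"
      using min\<mu>[OF m] unfolding J\<mu> Jm by (subst (asm) ennreal_le_iff) (use h a p b s c in auto)
    with 1 2 have "?d \<le> 0" by (simp add: h_def algebra_simps)
    then have "?d = 0" using d0 by (rule antisym)
    then show ?thesis using False by simp
  qed
qed

end

section \<open>Averaging the logarithm over four points\<close>

text \<open>With \<open>z = s + \<i> * t\<close> the left-hand side is the squared modulus of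
  \<open>(1 - r * z) * (1 + r * z) * (1 - \<i> * r * z) * (1 + \<i> * r * z) = 1 - r ^ 4 * z ^ 4\<close>; hence the
  four-point average of the logarithm differs from its value at the centre by a constant
  up to order \<open>r ^ 4\<close>.\<close>

lemma four_point_identity:
  fixes r s t N :: real
  assumes "N = r\<^sup>2 * (s\<^sup>2 + t\<^sup>2)"
  shows "(1 - 2 * r * s + N) * (1 + 2 * r * s + N) * ((1 - 2 * r * t + N) * (1 + 2 * r * t + N))
    = (1 - N\<^sup>2)\<^sup>2 + 16 * r ^ 4 * s\<^sup>2 * t\<^sup>2"
  unfolding assms by algebra

text \<open>\<open>P\<close> is |1 - w|^2 with w = r^4 z^4 of modulus \<open>N\<^sup>2\<close>, so
  it lies between \<open>(1 - N\<^sup>2)\<^sup>2\<close> and \<open>(1 + N\<^sup>2)\<^sup>2\<close>.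
  Smallness of \<open>N\<close> puts the lower end in the range of the quadratic estimate for the
  logarithm.\<close>

lemma abs_ln_four_point:
  fixes r s t N :: real
  assumes N: "N = r\<^sup>2 * (s\<^sup>2 + t\<^sup>2)" and small: "N\<^sup>2 \<le> 1/2"
  defines "P \<equiv> (1 - N\<^sup>2)\<^sup>2 + 16 * r ^ 4 * s\<^sup>2 * t\<^sup>2"
  shows "0 < P" "\<bar>ln P\<bar> \<le> 4 * N\<^sup>2"
proof -
  have lo: "(1 - N\<^sup>2)\<^sup>2 \<le> P" unfolding P_def by simp
  have "4 * s\<^sup>2 * t\<^sup>2 \<le> (s\<^sup>2 + t\<^sup>2)\<^sup>2"
    using zero_le_power2[of "s\<^sup>2 - t\<^sup>2"] by (simp add: power2_eq_square algebra_simps)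
  then have "r ^ 4 * (4 * s\<^sup>2 * t\<^sup>2) \<le> r ^ 4 * (s\<^sup>2 + t\<^sup>2)\<^sup>2"
    by (intro mult_left_mono) auto
  moreover have "r ^ 4 * (s\<^sup>2 + t\<^sup>2)\<^sup>2 = N\<^sup>2"
    unfolding N by (simp add: power_mult_distrib flip: power_mult)
  ultimately have hi: "P \<le> (1 + N\<^sup>2)\<^sup>2"
    unfolding P_def by (simp add: power2_eq_square algebra_simps)
  have N1: "0 < 1 - N\<^sup>2" using small by simp
  show "0 < P" using lo N1 by (meson less_le_trans zero_less_power)
  have "ln P \<le> ln ((1 + N\<^sup>2)\<^sup>2)"
    using hi \<open>0 < P\<close> by (subst ln_le_cancel_iff) (auto intro: less_le_trans)
  also have "\<dots> = 2 * ln (1 + N\<^sup>2)" by (simp add: ln_realpow add_pos_nonneg)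
  also have "\<dots> \<le> 2 * N\<^sup>2" by (simp add: ln_add_one_self_le_self)
  finally have 1: "ln P \<le> 4 * N\<^sup>2" using zero_le_power2[of N] by linarith
  have "- N\<^sup>2 - 2 * (N\<^sup>2)\<^sup>2 \<le> ln (1 - N\<^sup>2)"
    by (rule ln_one_minus_pos_lower_bound) (use small in auto)
  moreover have "(N\<^sup>2)\<^sup>2 \<le> N\<^sup>2 * (1/2)"
    unfolding power2_eq_square[of "N\<^sup>2"] using small by (intro mult_left_mono) auto
  moreover have "ln ((1 - N\<^sup>2)\<^sup>2) \<le> ln P"
    using lo N1 \<open>0 < P\<close> by (subst ln_le_cancel_iff) auto
  moreover have "ln ((1 - N\<^sup>2)\<^sup>2) = 2 * ln (1 - N\<^sup>2)"
    using N1 by (simp add: ln_realpow)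
  ultimately have "- (4 * N\<^sup>2) \<le> ln P" by linarith
  with 1 show "\<bar>ln P\<bar> \<le> 4 * N\<^sup>2" by simp
qed

text \<open>Stereographic images of the points \<open>r, - r, \<i> * r, - \<i> * r\<close>.\<close>

definition axis_pt :: "nat \<Rightarrow> real \<Rightarrow> pt" where
  "axis_pt j r = (1 / (1 + r\<^sup>2)) *\<^sub>R vector [1 - r\<^sup>2, [2 * r, - 2 * r, 0, 0] ! j, [0, 0, 2 * r, - 2 * r] ! j]"

lemma less_4_cases: "j < (4::nat) \<Longrightarrow> j = 0 \<or> j = 1 \<or> j = 2 \<or> j = 3"
  by auto

lemma inner_axis_pt: 
  "axis_pt j r \<bullet> w = ((1 - r\<^sup>2) * w $ 1 + [2 * r, - 2 * r, 0, 0] ! j * w $ 2 + [0, 0, 2 * r, - 2 * r] ! j * w $ 3) / (1 + r\<^sup>2)"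
  by (simp add: axis_pt_def inner_vec_def sum_3 add_divide_distrib)

lemma norm_axis_pt: "j < 4 \<Longrightarrow> norm (axis_pt j r) = 1"
proof -
  assume j: "j < 4"
  have p: "0 < 1 + r\<^sup>2" by (simp add: add_pos_nonneg)
  let ?v = "vector [1 - r\<^sup>2, [2 * r, - 2 * r, 0, 0] ! j, [0, 0, 2 * r, - 2 * r] ! j] :: pt"
  have "?v \<bullet> ?v = (1 + r\<^sup>2)\<^sup>2"
    using less_4_cases[OF j] by (auto simp: inner_vec_def sum_3 power2_eq_square algebra_simps)
  then have "axis_pt j r \<bullet> axis_pt j r = (1 / (1 + r\<^sup>2))\<^sup>2 * (1 + r\<^sup>2)\<^sup>2"
    by (simp add: axis_pt_def power2_eq_square)
  also have "\<dots> = 1"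
    using p by (simp add: power_divide)
  finally show ?thesis by (simp add: norm_eq_1)
qed

text \<open>After a rotation taking the first axis to \<open>x0\<close>, stereographic coordinates
  turn \<open>(dist (X j r) v)\<^sup>2\<close> into
  \<open>(dist x0 v)\<^sup>2 / (1 + r\<^sup>2)\<close> times the squared modulus of one linear
  factor from \<open>four_point_identity\<close>. The conformal factor, the same for all
  \<open>v\<close>, produces the shift \<open>2 * ln (1 + r\<^sup>2)\<close>: this is the constant
  Laplacian of the kernel.\<close>

lemma four_points:
  assumes x0: "x0 \<in> Sph"
  obtains X :: "nat \<Rightarrow> real \<Rightarrow> pt" where
    "\<And>j r. j < 4 \<Longrightarrow> X j r \<in> Sph"
    "\<And>j r. j < 4 \<Longrightarrow> 0 \<le> r \<Longrightarrow> dist (X j r) x0 \<le> r"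
    "\<And>v r d. v \<in> Sph \<Longrightarrow> 0 < d \<Longrightarrow> d \<le> dist x0 v \<Longrightarrow> 0 < r \<Longrightarrow> 2 * r \<le> d \<Longrightarrow>
      \<bar>(\<Sum>j<4. ln (dist (X j r) v)) - 4 * ln (dist x0 v) + 2 * ln (1 + r\<^sup>2)\<bar> \<le> 2 * r ^ 4 / d ^ 4"
proof -
  obtain f :: "pt \<Rightarrow> pt" where f: "orthogonal_transformation f" "f (axis 1 1) = unit_vec x0"
    using orthogonal_transformation_exists_1[of "axis 1 1 :: pt" "unit_vec x0"] norm_unit_vec[OF x0]
    by (auto simp: norm_eq_1 inner_axis_axis)
  have ff: "f u \<bullet> f v = u \<bullet> v" for u v
    using f(1) by (simp add: orthogonal_transformation_def)
  define X where "X j r = sph_centre + (1/2) *\<^sub>R f (axis_pt j r)" for j r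
  have XS: "X j r \<in> Sph" if "j < 4" for j r
    using norm_axis_pt[OF that, of r] orthogonal_transformation_norm[OF f(1), of "axis_pt j r"]
    by (simp add: X_def Sph_def sph_centre_def[symmetric] dist_norm norm_minus_commute)
  have uX: "unit_vec (X j r) = f (axis_pt j r)" if "j < 4" for j r
    using XS[OF that, of r] by (simp add: unit_vec_def X_def)
  have dist0: "dist (X j r) x0 \<le> r" if j: "j < 4" and r: "0 \<le> r" for j r
  proof -
    have p: "0 < 1 + r\<^sup>2" by (simp add: add_pos_nonneg)
    have "(dist (X j r) x0)\<^sup>2 = (1 - axis_pt j r \<bullet> axis 1 1) / 2"
      unfolding dist_Sph_inner[OF XS[OF j] x0] uX[OF j] f(2)[symmetric] ff ..
    also have "\<dots> = r\<^sup>2 / (1 + r\<^sup>2)"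
      unfolding inner_axis_pt using p by (simp add: axis_def field_simps)
    also have "\<dots> \<le> r\<^sup>2"
      using p by (simp add: divide_simps mult_le_cancel_left1)
    finally show ?thesis using r by (rule power2_le_imp_le)
  qed
  have main: "\<bar>(\<Sum>j<4. ln (dist (X j r) v)) - 4 * ln (dist x0 v) + 2 * ln (1 + r\<^sup>2)\<bar> \<le> 2 * r ^ 4 / d ^ 4"
    if v: "v \<in> Sph" and d: "0 < d" "d \<le> dist x0 v" and r: "0 < r" "2 * r \<le> d" for v r d
  proof -
    obtain w where w: "f w = unit_vec v"
      using orthogonal_transformation_surj[OF f(1)] by (metis surjD)
    define a b c where "a = w $ 1" "b = w $ 2" "c = w $ 3"
    note abc = this
    have "norm w = 1" using w norm_unit_vec[OF v] orthogonal_transformation_norm[OF f(1), of w] by simp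
    then have "w \<bullet> w = 1" by (simp add: norm_eq_1)
    then have one: "a\<^sup>2 + b\<^sup>2 + c\<^sup>2 = 1"
      by (simp add: inner_vec_def sum_3 abc power2_eq_square)
    have p: "0 < 1 + r\<^sup>2" by (simp add: add_pos_nonneg)
    have D0: "(dist x0 v)\<^sup>2 = (1 - a) / 2"
      unfolding dist_Sph_inner[OF x0 v] f(2)[symmetric] w[symmetric] ff
      by (simp add: inner_axis' abc)
    have Dpos: "0 < dist x0 v" using d by linarith
    then have a1: "0 < 1 - a" using D0 by (metis zero_less_divide_iff zero_less_power zero_less_numeral less_asym)
    \<comment> \<open>Stereographic coordinates of \<open>v\<close> with pole \<open>x0\<close>. A
      distance at least \<open>d\<close> from the pole bounds them, which is what \<open>N2\<close>
      below quantifies.\<close>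
    define s t where "s = b / (1 - a)" "t = c / (1 - a)"
    note st = this
    define N where "N = r\<^sup>2 * (s\<^sup>2 + t\<^sup>2)"
    have bs: "b = (1 - a) * s" "c = (1 - a) * t" using a1 by (auto simp: st)
    have "(1 - a)\<^sup>2 * (s\<^sup>2 + t\<^sup>2) = b\<^sup>2 + c\<^sup>2"
      unfolding bs by (simp only: power_mult_distrib distrib_left)
    also have "\<dots> = (1 - a) * (1 + a)" using one by (simp add: algebra_simps power2_eq_square)
    finally have "(1 - a) * ((1 - a) * (s\<^sup>2 + t\<^sup>2)) = (1 - a) * (1 + a)"
      by (simp add: power2_eq_square mult.assoc)
    then have q: "(1 - a) * (s\<^sup>2 + t\<^sup>2) = 1 + a" using a1 by simp
    have X: "(dist (X j r) v)\<^sup>2 = (dist x0 v)\<^sup>2 / (1 + r\<^sup>2) * (1 - [2 * r * s, - 2 * r * s, 2 * r * t, - 2 * r * t] ! j + N)"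
      if j: "j < 4" for j
    proof -
      have "(dist (X j r) v)\<^sup>2 = (1 - axis_pt j r \<bullet> w) / 2"
        unfolding dist_Sph_inner[OF XS[OF j] v] uX[OF j] w[symmetric] ff ..
      also have "1 - axis_pt j r \<bullet> w = ((1 - a) + r\<^sup>2 * (1 + a) - (1 - a) * ([2 * r * s, - 2 * r * s, 2 * r * t, - 2 * r * t] ! j)) / (1 + r\<^sup>2)"
        unfolding inner_axis_pt abc[symmetric] bs using p less_4_cases[OF j]
        by (auto simp: divide_simps) (auto simp: algebra_simps)
      also have "(1 - a) + r\<^sup>2 * (1 + a) = (1 - a) * (1 + N)"
        unfolding N_def q[symmetric] by (simp add: algebra_simps)
      finally have "(dist (X j r) v)\<^sup>2 = ((1 - a) * (1 + N) - (1 - a) * ([2 * r * s, - 2 * r * s, 2 * r * t, - 2 * r * t] ! j)) / (1 + r\<^sup>2) / 2" .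
      moreover have "((1 - a) * (1 + N) - (1 - a) * z) / m / 2 = (1 - a) / 2 / m * (1 - z + N)" for z m :: real
        by (simp add: algebra_simps add_divide_distrib diff_divide_distrib)
      ultimately show ?thesis unfolding D0 by (simp only:)
    qed
    let ?Y = "\<lambda>j. 1 - [2 * r * s, - 2 * r * s, 2 * r * t, - 2 * r * t] ! j + N"
    have Xpos: "0 < dist (X j r) v" if "j < 4" for j
    proof -
      have "d \<le> dist x0 (X j r) + dist (X j r) v" using d(2) dist_triangle[of x0 v "X j r"] by linarith
      moreover have "dist x0 (X j r) \<le> r" using dist0[OF that, of r] r by (simp add: dist_commute)
      ultimately show ?thesis using r by linarith
    qed
    have Ypos: "0 < ?Y j" if "j < 4" for j
    proof -
      have "0 < (dist x0 v)\<^sup>2 / (1 + r\<^sup>2) * ?Y j" using X[OF that] Xpos[OF that] by (metis zero_less_power)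
      moreover have "0 < (dist x0 v)\<^sup>2 / (1 + r\<^sup>2)" using Dpos p by simp
      ultimately show ?thesis by (simp only: zero_less_mult_pos)
    qed
    have lnX: "2 * ln (dist (X j r) v) = 2 * ln (dist x0 v) - ln (1 + r\<^sup>2) + ln (?Y j)" if "j < 4" for j
    proof -
      have "2 * ln (dist (X j r) v) = ln ((dist (X j r) v)\<^sup>2)"
        using Xpos[OF that] by (simp add: ln_realpow)
      also have "\<dots> = ln ((dist x0 v)\<^sup>2 / (1 + r\<^sup>2)) + ln (?Y j)"
        unfolding X[OF that] using Ypos[OF that] Dpos p by (intro ln_mult_pos) auto
      also have "ln ((dist x0 v)\<^sup>2 / (1 + r\<^sup>2)) = 2 * ln (dist x0 v) - ln (1 + r\<^sup>2)"
        using Dpos p by (simp add: ln_div ln_realpow)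
      finally show ?thesis by simp
    qed
    have four: "(\<Sum>j<4. h j) = h 0 + h 1 + h 2 + h (3::nat)" for h :: "nat \<Rightarrow> real"
      by (simp add: eval_nat_numeral)
    have "2 * (\<Sum>j<4. ln (dist (X j r) v)) = 8 * ln (dist x0 v) - 4 * ln (1 + r\<^sup>2) + (ln (?Y 0) + ln (?Y 1) + ln (?Y 2) + ln (?Y 3))"
      unfolding four using lnX[of 0] lnX[of 1] lnX[of 2] lnX[of 3] by simp
    also have "ln (?Y 0) + ln (?Y 1) + ln (?Y 2) + ln (?Y 3) = ln (?Y 0 * ?Y 1 * (?Y 2 * ?Y 3))"
      using Ypos[of 0] Ypos[of 1] Ypos[of 2] Ypos[of 3] by (simp add: ln_mult_pos)
    also have "?Y 0 * ?Y 1 * (?Y 2 * ?Y 3) = (1 - N\<^sup>2)\<^sup>2 + 16 * r ^ 4 * s\<^sup>2 * t\<^sup>2"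
      using four_point_identity[OF N_def] by simp
    finally have sum: "2 * (\<Sum>j<4. ln (dist (X j r) v)) = 8 * ln (dist x0 v) - 4 * ln (1 + r\<^sup>2) + ln ((1 - N\<^sup>2)\<^sup>2 + 16 * r ^ 4 * s\<^sup>2 * t\<^sup>2)" .
    have N2: "N\<^sup>2 \<le> r ^ 4 / d ^ 4"
    proof -
      have "d\<^sup>2 * (s\<^sup>2 + t\<^sup>2) \<le> (dist x0 v)\<^sup>2 * (s\<^sup>2 + t\<^sup>2)"
        using d by (intro mult_right_mono power_mono) auto
      also have "\<dots> = (1 + a) / 2" unfolding D0 q[symmetric] by simp
      also have "\<dots> \<le> 1" using a1 by simp
      finally have "s\<^sup>2 + t\<^sup>2 \<le> 1 / d\<^sup>2" using d by (simp add: field_simps)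
      then have "N \<le> r\<^sup>2 * (1 / d\<^sup>2)" unfolding N_def by (intro mult_left_mono) auto
      then have "N\<^sup>2 \<le> (r\<^sup>2 * (1 / d\<^sup>2))\<^sup>2" by (intro power_mono) (auto simp: N_def)
      then show ?thesis by (simp add: power_divide flip: power_mult)
    qed
    also have "\<dots> \<le> (1/2) ^ 4"
      using r d by (simp only: power_divide[symmetric], intro power_mono) (auto simp: field_simps)
    finally have "N\<^sup>2 \<le> 1/2" by (simp add: power_def)
    from abs_ln_four_point(2)[OF N_def this]
    have "\<bar>ln ((1 - N\<^sup>2)\<^sup>2 + 16 * r ^ 4 * s\<^sup>2 * t\<^sup>2)\<bar> \<le> 4 * (r ^ 4 / d ^ 4)" using N2 by simp
    with sum show ?thesis by (simp add: abs_le_iff)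
  qed
  show thesis
    by (rule that[OF XS dist0 main])
qed

section \<open>The principle of domination\<close>

definition tail :: "pt measure \<Rightarrow> real \<Rightarrow> pt \<Rightarrow> ennreal" where
  "tail \<mu> L x = (\<integral>\<^sup>+ y. lk x y - ennreal L \<partial>\<mu>)"

lemma measurable_tail:
  assumes "\<mu> \<in> probs S"
  shows "tail \<mu> L \<in> borel_measurable borel"
proof -
  interpret prob_space \<mu> using probsD[OF assms] by simp
  have [measurable_cong]: "sets \<mu> = sets borel" using probsD[OF assms] by simp
  show ?thesis unfolding tail_def by measurable
qed

lemma tail_antimono: "L \<le> L' \<Longrightarrow> tail \<mu> L' x \<le> tail \<mu> L x"
  unfolding tail_def by (intro nn_integral_mono ennreal_minus_mono ennreal_leI) auto

lemma tail_tendsto_0: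
  assumes \<mu>: "\<mu> \<in> probs S" and fin: "Upot \<mu> x < \<infinity>"
  shows "(\<lambda>n. tail \<mu> (real n) x) \<longlonglongrightarrow> 0"
proof -
  have [measurable_cong]: "sets \<mu> = sets borel" using probsD[OF \<mu>] by simp
  have meas: "(\<lambda>y. lk x y) \<in> borel_measurable \<mu>" by measurable
  have "(\<lambda>n. \<integral>\<^sup>+ y. lk x y - ennreal (real n) \<partial>\<mu>) \<longlonglongrightarrow> (\<integral>\<^sup>+ y. 0 \<partial>\<mu>)"
  proof (rule nn_integral_dominated_convergence[where w = "lk x"])
    have "AE y in \<mu>. lk x y < \<infinity>"
      using nn_integral_noteq_infinite[OF meas] fin unfolding Upot_def by (auto simp flip: less_top)
    then show "AE y in \<mu>. (\<lambda>n. lk x y - ennreal (real n)) \<longlonglongrightarrow> 0"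
    proof eventually_elim
      fix y assume "lk x y < \<infinity>"
      then obtain m where m: "lk x y < of_nat m"
        using ennreal_Ex_less_of_nat by auto
      have "lk x y - ennreal (real n) = 0" if "n \<ge> m" for n
      proof -
        have "of_nat m \<le> ennreal (real n)"
          using that by (simp flip: ennreal_of_nat_eq_real_of_nat)
        with m have "lk x y \<le> ennreal (real n)" by (meson less_imp_le less_le_trans)
        then show ?thesis
          using \<open>lk x y < \<infinity>\<close> by (simp add: diff_eq_0_ennreal)
      qed
      then have "eventually (\<lambda>n. lk x y - ennreal (real n) = 0) sequentially"
        using eventually_sequentially by blast
      then show "(\<lambda>n. lk x y - ennreal (real n)) \<longlonglongrightarrow> 0"
        by (rule tendsto_eventually)
    qed
    show "(\<integral>\<^sup>+ y. lk x y \<partial>\<mu>) < \<infinity>" using fin by (simp add: Upot_def)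
  qed (auto simp: diff_le_self_ennreal)
  then show ?thesis by (simp add: tail_def)
qed

text \<open>Uniform integrability against \<open>\<mu>\<close> of the kernels with pole in
  \<open>A\<close>.\<close>

definition unif_small_tails :: "pt measure \<Rightarrow> pt set \<Rightarrow> bool" where
  "unif_small_tails \<mu> A \<longleftrightarrow> (\<forall>e>0. \<exists>L\<ge>0. \<forall>a\<in>A. tail \<mu> L a \<le> ennreal e)"

lemma unif_small_tails_Un:
  assumes "unif_small_tails \<mu> A" "unif_small_tails \<mu> B"
  shows "unif_small_tails \<mu> (A \<union> B)"
  unfolding unif_small_tails_def
proof (intro allI impI)
  fix e :: real assume "e > 0"
  then obtain L1 L2 where L: "L1 \<ge> 0" "\<forall>a\<in>A. tail \<mu> L1 a \<le> ennreal e" "L2 \<ge> 0" "\<forall>a\<in>B. tail \<mu> L2 a \<le> ennreal e"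
    using assms unfolding unif_small_tails_def by metis
  then show "\<exists>L\<ge>0. \<forall>a\<in>A \<union> B. tail \<mu> L a \<le> ennreal e"
    using order_trans[OF tail_antimono[of L1 "max L1 L2" \<mu>]] order_trans[OF tail_antimono[of L2 "max L1 L2" \<mu>]]
    by (intro exI[of _ "max L1 L2"]) auto
qed

text \<open>Egorov's argument: the tails tend to 0 at every point of finite potential, hence
  uniformly on a set of measure close to 1, and inner regularity makes this set compact.\<close>

lemma exists_unif_small_tails:
  assumes \<mu>: "\<mu> \<in> probs Sph" and G: "G \<in> sets borel" "AE x in \<mu>. x \<in> G"
    and fin: "\<And>x. x \<in> G \<Longrightarrow> Upot \<mu> x < \<infinity>" and e: "0 < e"
  obtains A where "compact A" "A \<subseteq> G \<inter> Sph" "1 - e < measure \<mu> A" "unif_small_tails \<mu> A"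
proof -
  interpret prob_space \<mu> using probsD[OF \<mu>] by simp
  have sets [measurable_cong]: "sets \<mu> = sets borel" and space: "space \<mu> = UNIV"
    using probsD[OF \<mu>] by auto
  note [measurable] = measurable_tail[OF \<mu>] G(1) borel_closed[OF closed_Sph]
  define T where "T m n = {x \<in> G \<inter> Sph. tail \<mu> (real n) x \<le> ennreal (1 / real (Suc m))}" for m n
  have Tm [measurable]: "T m n \<in> sets borel" for m n
    unfolding T_def by measurable
  have one: "measure \<mu> (G \<inter> Sph) = 1"
    using G(2) probs_Sph_AE[OF \<mu>] by (subst prob_eq_1) (auto simp: sets)
  \<comment> \<open>The exceptional measures are summable with total at most \<open>e / 2\<close>;
    the other half of \<open>e\<close> gives the strict inequality.\<close>
  have "\<exists>n. 1 - e / 4 * (1/2) ^ m < measure \<mu> (T m n)" for m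
  proof -
    have inc: "incseq (T m)"
    proof (intro incseq_SucI subsetI)
      fix n x assume "x \<in> T m n"
      then show "x \<in> T m (Suc n)"
        using order_trans[OF tail_antimono[of "real n" "real (Suc n)" \<mu> x]] by (auto simp: T_def)
    qed
    have un: "(\<Union>n. T m n) = G \<inter> Sph"
    proof
      show "G \<inter> Sph \<subseteq> (\<Union>n. T m n)"
      proof
        fix x assume x: "x \<in> G \<inter> Sph"
        have "eventually (\<lambda>n. tail \<mu> (real n) x < ennreal (1 / real (Suc m))) sequentially"
          by (rule order_tendstoD(2)[OF tail_tendsto_0[OF \<mu> fin]]) (use x in auto)
        then obtain n where "tail \<mu> (real n) x < ennreal (1 / real (Suc m))"
          unfolding eventually_sequentially by blast
        then show "x \<in> (\<Union>n. T m n)" using x by (auto simp: T_def intro: less_imp_le)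
      qed
    qed (auto simp: T_def)
    have "range (T m) \<subseteq> sets \<mu>" by (auto simp: sets)
    from finite_Lim_measure_incseq[OF this inc]
    have "(\<lambda>n. measure \<mu> (T m n)) \<longlonglongrightarrow> 1"
      unfolding un one .
    moreover have "1 - e / 4 * (1/2) ^ m < 1" using e by simp
    ultimately have "eventually (\<lambda>n. 1 - e / 4 * (1/2) ^ m < measure \<mu> (T m n)) sequentially"
      by (rule order_tendstoD)
    then show ?thesis unfolding eventually_sequentially by blast
  qed
  then obtain N where N: "\<And>m. 1 - e / 4 * (1/2) ^ m < measure \<mu> (T m (N m))" by metis
  define B where "B = (\<Inter>m. T m (N m))"
  have Bm [measurable]: "B \<in> sets borel" unfolding B_def by measurable
  have geo: "(\<lambda>m. e / 4 * (1/2) ^ m) sums (e / 4 * 2)"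
    using sums_mult[OF geometric_sums[of "1/2 :: real"], of "e / 4"] by simp
  have small: "measure \<mu> (UNIV - T m (N m)) \<le> e / 4 * (1/2) ^ m" for m
    using prob_compl[of "T m (N m)"] N[of m] by (simp add: sets space)
  have summ: "summable (\<lambda>m. measure \<mu> (UNIV - T m (N m)))"
    by (rule summable_comparison_test'[OF sums_summable[OF geo], of 0]) (use small in auto)
  have "measure \<mu> (UNIV - B) = measure \<mu> (\<Union>m. UNIV - T m (N m))"
    by (rule arg_cong[of _ _ "measure \<mu>"]) (auto simp: B_def)
  also have "\<dots> \<le> (\<Sum>m. measure \<mu> (UNIV - T m (N m)))"
    by (rule finite_measure_subadditive_countably[OF _ summ]) (auto simp: sets)
  also have "\<dots> \<le> (\<Sum>m. e / 4 * (1/2) ^ m)"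
    by (rule suminf_le[OF small summ sums_summable[OF geo]])
  also have "\<dots> = e / 2" using geo by (simp add: sums_iff)
  finally have large: "1 - e < measure \<mu> B"
    using prob_compl[of B] e by (simp add: sets space)
  obtain A where A: "compact A" "A \<subseteq> B" "1 - e < measure \<mu> A"
  proof (cases "1 - e < 0")
    case True
    then show thesis by (intro that[of "{}"]) auto
  next
    case False
    then have "ennreal (1 - e) < emeasure \<mu> B"
      using large by (simp add: emeasure_eq_measure ennreal_less_iff)
    also have "emeasure \<mu> B = (SUP C\<in>{C. C \<subseteq> B \<and> compact C}. emeasure \<mu> C)"
      by (rule inner_regular) (auto simp: sets)
    finally obtain C where "C \<subseteq> B" "compact C" "ennreal (1 - e) < emeasure \<mu> C"
      unfolding less_SUP_iff by blast
    then show thesis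
      using False by (intro that[of C]) (auto simp: emeasure_eq_measure ennreal_less_iff)
  qed
  show thesis
  proof (rule that[OF A(1) _ A(3)])
    show "A \<subseteq> G \<inter> Sph" using A(2) by (auto simp: B_def T_def)
    show "unif_small_tails \<mu> A"
      unfolding unif_small_tails_def
    proof (intro allI impI)
      fix \<epsilon> :: real assume "\<epsilon> > 0"
      then obtain m where m: "1 / real (Suc m) < \<epsilon>"
        using nat_approx_posE by metis
      have "tail \<mu> (real (N m)) a \<le> ennreal \<epsilon>" if "a \<in> A" for a
      proof -
        have "tail \<mu> (real (N m)) a \<le> ennreal (1 / real (Suc m))"
          using that A(2) by (auto simp: B_def T_def)
        also have "\<dots> \<le> ennreal \<epsilon>" using m by (intro ennreal_leI) simp
        finally show ?thesis .
      qed
      then show "\<exists>L\<ge>0. \<forall>a\<in>A. tail \<mu> L a \<le> ennreal \<epsilon>"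
        by (intro exI[of _ "real (N m)"]) auto
    qed
  qed
qed

text \<open>Continuity principle: the part of \<open>\<mu>\<close> carried by a set on which the tails are uniformly small
  has a continuous potential, since a nearest point \<open>a\<close> of \<open>A\<close> to \<open>x\<close> satisfies
  \<open>dist a y \<le> 2 * dist x y\<close> for all \<open>y\<close> in \<open>A\<close>.\<close>

locale small_tails =
  fixes \<mu> :: "pt measure" and A :: "pt set" and g :: "pt \<Rightarrow> real"
  assumes \<mu>: "\<mu> \<in> probs Sph" and A: "compact A" "A \<subseteq> Sph" "A \<noteq> {}"
    and small: "unif_small_tails \<mu> A"
    and g [measurable]: "g \<in> borel_measurable borel" and g_nonneg: "\<And>y. 0 \<le> g y" and g_le: "\<And>y. g y \<le> 2"
    and g_off: "\<And>y. y \<notin> A \<Longrightarrow> g y = 0"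
begin

sublocale prob_space \<mu> using probsD[OF \<mu>] by simp

lemma sets_\<mu> [measurable_cong]: "sets \<mu> = sets borel"
  using probsD[OF \<mu>] by simp

definition W :: "pt \<Rightarrow> real" where
  "W x = enn2real (\<integral>\<^sup>+ y. ennreal (g y) * lk x y \<partial>\<mu>)"

definition WL :: "real \<Rightarrow> pt \<Rightarrow> real" where
  "WL L x = (\<integral>y. g y * trunc_kern L x y \<partial>\<mu>)"

definition R :: "real \<Rightarrow> pt \<Rightarrow> ennreal" where
  "R L x = (\<integral>\<^sup>+ y. ennreal (g y) * (lk x y - ennreal L) \<partial>\<mu>)"

lemma WL_bound:
  assumes "x \<in> Sph" "0 \<le> L" "y \<in> Sph"
  shows "0 \<le> g y * trunc_kern L x y" "g y * trunc_kern L x y \<le> 2 * L"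
  using trunc_kern_nonneg[OF assms(1,3,2)] trunc_kern_le[of L x y] g_nonneg[of y] g_le[of y]
  by (auto intro!: mult_nonneg_nonneg mult_mono)

lemma WL_integrable:
  assumes "x \<in> Sph" "0 \<le> L"
  shows "integrable \<mu> (\<lambda>y. g y * trunc_kern L x y)"
proof (rule integrable_const_bound[of _ "2 * L"])
  show "AE y in \<mu>. norm (g y * trunc_kern L x y) \<le> 2 * L"
    using probs_Sph_AE[OF \<mu>] by eventually_elim (use WL_bound[OF assms] in auto)
qed measurable

lemma WL_nonneg: "x \<in> Sph \<Longrightarrow> 0 \<le> L \<Longrightarrow> 0 \<le> WL L x"
  unfolding WL_def using probs_Sph_AE[OF \<mu>]
  by (intro integral_nonneg_AE) (auto elim!: eventually_mono intro: WL_bound)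

lemma split_potential:
  assumes "x \<in> Sph" "0 \<le> L"
  shows "(\<integral>\<^sup>+ y. ennreal (g y) * lk x y \<partial>\<mu>) = ennreal (WL L x) + R L x"
proof -
  have "(\<integral>\<^sup>+ y. ennreal (g y) * lk x y \<partial>\<mu>)
    = (\<integral>\<^sup>+ y. ennreal (g y * trunc_kern L x y) + ennreal (g y) * (lk x y - ennreal L) \<partial>\<mu>)"
    by (rule nn_integral_cong_AE, use probs_Sph_AE[OF \<mu>] in eventually_elim)
       (subst lk_split[OF assms(1) _ assms(2)], simp_all add: distrib_left ennreal_mult' g_nonneg)
  also have "\<dots> = (\<integral>\<^sup>+ y. ennreal (g y * trunc_kern L x y) \<partial>\<mu>) + R L x"
    unfolding R_def by (rule nn_integral_add) measurable
  also have "(\<integral>\<^sup>+ y. ennreal (g y * trunc_kern L x y) \<partial>\<mu>) = ennreal (WL L x)"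
    unfolding WL_def using probs_Sph_AE[OF \<mu>]
    by (intro nn_integral_eq_integral WL_integrable assms) (auto elim!: eventually_mono intro: WL_bound assms)
  finally show ?thesis .
qed

lemma lk_nearest:
  assumes a: "a \<in> A" "\<And>y. y \<in> A \<Longrightarrow> dist x a \<le> dist x y" and y: "y \<in> A" and x: "x \<in> Sph"
  shows "lk x y \<le> lk a y + ennreal (ln 2)"
proof (cases "a = y \<or> x = y")
  case True
  then have "a = y" using a(2)[OF y] by auto
  then show ?thesis by (simp add: lk_eq)
next
  case False
  have "dist a y \<le> 2 * dist x y"
    using a(2)[OF y] dist_triangle3[of a y x] by linarith
  then have "ln (dist a y) \<le> ln (2 * dist x y)"
    using False by (subst ln_le_cancel_iff) auto
  also have "\<dots> = ln 2 + ln (dist x y)"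
    using False by (simp add: ln_mult)
  finally have "- ln (dist x y) \<le> - ln (dist a y) + ln 2" by simp
  then have "ennreal (- ln (dist x y)) \<le> ennreal (- ln (dist a y) + ln 2)" by (rule ennreal_leI)
  also have "\<dots> = ennreal (- ln (dist a y)) + ennreal (ln 2)"
    using False A a(1) y dist_Sph_le_1[of a y] by (intro ennreal_plus) (auto simp: ln_le_zero_iff)
  finally show ?thesis using False by (simp add: lk_eq)
qed

text \<open>Smallness spreads from \<open>A\<close> to all of \<open>Sph\<close>: the loss
  \<open>ln 2\<close> in passing to a nearest point of \<open>A\<close> is absorbed by raising the
  cap, and the bound 2 on \<open>g\<close> by asking for tails below \<open>e / 2\<close>.\<close>

lemma R_uniformly_small:
  assumes e: "0 < e"
  obtains L where "0 \<le> L" "\<And>x L'. x \<in> Sph \<Longrightarrow> L \<le> L' \<Longrightarrow> R L' x \<le> ennreal e"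
proof -
  obtain L where L: "0 \<le> L" "\<And>a. a \<in> A \<Longrightarrow> tail \<mu> L a \<le> ennreal (e / 2)"
    using small e unfolding unif_small_tails_def by (meson half_gt_zero)
  show thesis
  proof
    show "0 \<le> L + ln 2" using L by simp
    fix x L' assume x: "x \<in> Sph" and L': "L + ln 2 \<le> L'"
    obtain a where a: "a \<in> A" "\<And>y. y \<in> A \<Longrightarrow> dist x a \<le> dist x y"
      using distance_attains_inf[OF compact_imp_closed[OF A(1)] A(3), of x] by blast
    have "R L' x \<le> (\<integral>\<^sup>+ y. 2 * (lk a y - ennreal L) \<partial>\<mu>)"
      unfolding R_def
    proof (rule nn_integral_mono)
      fix y
      show "ennreal (g y) * (lk x y - ennreal L') \<le> 2 * (lk a y - ennreal L)"
      proof (cases "y \<in> A")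
        case True
        have "lk x y - ennreal L' \<le> (lk a y + ennreal (ln 2)) - ennreal (L + ln 2)"
          using L' lk_nearest[OF a True x] by (intro ennreal_minus_mono ennreal_leI) auto
        also have "\<dots> \<le> lk a y - ennreal L"
          using L(1) by (cases "lk a y") (auto simp: ennreal_minus simp flip: ennreal_plus)
        finally show ?thesis
          using g_le[of y] by (intro mult_mono) (auto intro: ennreal_leI simp flip: ennreal_numeral)
      qed (simp add: g_off)
    qed
    also have "\<dots> = 2 * tail \<mu> L a"
      unfolding tail_def by (rule nn_integral_cmult) measurable
    also have "\<dots> \<le> 2 * ennreal (e / 2)"
      using L(2)[OF a(1)] by (intro mult_left_mono) auto
    also have "\<dots> = ennreal e"
      using e by (simp flip: ennreal_mult' ennreal_numeral)
    finally show "R L' x \<le> ennreal e" .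
  qed
qed

lemma potential_finite:
  assumes x: "x \<in> Sph"
  shows "(\<integral>\<^sup>+ y. ennreal (g y) * lk x y \<partial>\<mu>) = ennreal (W x)" "(\<integral>\<^sup>+ y. ennreal (g y) * lk x y \<partial>\<mu>) < \<infinity>"
proof -
  obtain L where L: "0 \<le> L" "\<And>x L'. x \<in> Sph \<Longrightarrow> L \<le> L' \<Longrightarrow> R L' x \<le> ennreal 1"
    using R_uniformly_small[of 1] by auto
  have "R L x < \<infinity>" using L(2)[OF x order_refl] by (auto simp: less_top[symmetric] top_unique)
  then show fin: "(\<integral>\<^sup>+ y. ennreal (g y) * lk x y \<partial>\<mu>) < \<infinity>"
    unfolding split_potential[OF x L(1)] by (simp flip: less_top)
  then show "(\<integral>\<^sup>+ y. ennreal (g y) * lk x y \<partial>\<mu>) = ennreal (W x)"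
    by (simp add: W_def less_top)
qed

lemma WL_le_W:
  assumes x: "x \<in> Sph" and L: "0 \<le> L"
  shows "WL L x \<le> W x"
proof -
  have "ennreal (WL L x) \<le> ennreal (W x)"
    unfolding potential_finite(1)[OF x, symmetric] split_potential[OF x L] by simp
  then show ?thesis by (subst (asm) ennreal_le_iff) (simp add: W_def)
qed

lemma W_le_WL:
  assumes x: "x \<in> Sph" and L: "0 \<le> L" and R: "R L x \<le> ennreal e" "0 \<le> e"
  shows "W x \<le> WL L x + e"
proof -
  have "ennreal (W x) \<le> ennreal (WL L x) + ennreal e"
    unfolding potential_finite(1)[OF x, symmetric] split_potential[OF x L] using R by (intro add_left_mono)
  also have "\<dots> = ennreal (WL L x + e)"
    using WL_nonneg[OF x L] R by simp
  finally show ?thesis using WL_nonneg[OF x L] R by (subst (asm) ennreal_le_iff) auto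
qed

lemma continuous_WL:
  assumes L: "0 \<le> L"
  shows "continuous_on Sph (WL L)"
  unfolding continuous_on_sequentially
proof (intro allI ballI impI, elim conjE)
  fix u x assume u: "\<forall>n. u n \<in> Sph" "x \<in> Sph" "u \<longlonglongrightarrow> x"
  show "(WL L \<circ> u) \<longlonglongrightarrow> WL L x"
    unfolding comp_def WL_def
  proof (rule integral_dominated_convergence[where w = "\<lambda>_. 2 * L"])
    show "AE y in \<mu>. (\<lambda>n. g y * trunc_kern L (u n) y) \<longlonglongrightarrow> g y * trunc_kern L x y"
      by (intro AE_I2 tendsto_intros tendsto_trunc_kern u)
    show "AE y in \<mu>. norm (g y * trunc_kern L (u n) y) \<le> 2 * L" for n
      using probs_Sph_AE[OF \<mu>] by eventually_elim (use WL_bound[OF _ L] u in auto)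
  qed auto
qed

text \<open>The truncated potentials are continuous and, by \<open>R_uniformly_small\<close>,
  converge uniformly.\<close>

lemma continuous_W: "continuous_on Sph W"
proof (rule uniform_limit_theorem[of _ "\<lambda>n. WL (real n)" sequentially])
  show "eventually (\<lambda>n. continuous_on Sph (WL (real n))) sequentially"
    by (intro always_eventually allI continuous_WL) simp
  show "uniform_limit Sph (\<lambda>n. WL (real n)) W sequentially"
  proof (rule uniform_limitI)
    fix e :: real assume "e > 0"
    obtain L where L: "0 \<le> L" "\<And>x L'. x \<in> Sph \<Longrightarrow> L \<le> L' \<Longrightarrow> R L' x \<le> ennreal (e / 2)"
      using R_uniformly_small[of "e / 2"] \<open>e > 0\<close> by auto
    obtain m :: nat where m: "L \<le> real m" using real_arch_simple by blast
    have "dist (WL (real n) x) (W x) < e" if "n \<ge> m" "x \<in> Sph" for n x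
    proof -
      have "R (real n) x \<le> ennreal (e / 2)" using L(2)[OF that(2), of "real n"] that m by auto
      from W_le_WL[OF that(2) _ this] WL_le_W[OF that(2), of "real n"] \<open>e > 0\<close>
      show ?thesis by (simp add: dist_real_def)
    qed
    then show "eventually (\<lambda>n. \<forall>x\<in>Sph. dist (WL (real n) x) (W x) < e) sequentially"
      unfolding eventually_sequentially by blast
  qed
qed simp

text \<open>At distance \<open>d\<close> from \<open>A\<close> the kernel stays below
  \<open>- ln d\<close>, so capping at that level loses nothing and \<open>W\<close> is an ordinary
  integral, to which four-point averages apply.\<close>

lemma W_off:
  assumes x: "x \<in> Sph" and d: "0 < d" "\<And>y. y \<in> A \<Longrightarrow> d \<le> dist x y"
  shows "integrable \<mu> (\<lambda>y. g y * - ln (dist x y))" "W x = (\<integral>y. g y * - ln (dist x y) \<partial>\<mu>)"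
proof -
  obtain y0 where "y0 \<in> A" using A by blast
  then have "d \<le> 1" using d(2)[of y0] dist_Sph_le_1[OF x, of y0] A by auto
  define L where "L = - ln d"
  have L: "0 \<le> L" using d \<open>d \<le> 1\<close> by (simp add: L_def)
  have eL: "exp (- L) = d" using d by (simp add: L_def)
  have eq: "g y * trunc_kern L x y = g y * - ln (dist x y)" for y
  proof (cases "y \<in> A")
    case True
    then have "d \<le> dist x y" by (rule d)
    moreover from this have "x \<noteq> y" using d by auto
    ultimately show ?thesis by (simp add: trunc_kern_eq eL)
  qed (simp add: g_off)
  have R0: "R L x = 0"
  proof -
    have "ennreal (g y) * (lk x y - ennreal L) = 0" for y
    proof (cases "y \<in> A")
      case True
      then have "d \<le> dist x y" by (rule d)
      then have "x \<noteq> y" using d by auto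
      have "ln d \<le> ln (dist x y)" using \<open>d \<le> dist x y\<close> d by (subst ln_le_cancel_iff) auto
      then have "lk x y \<le> ennreal L" using \<open>x \<noteq> y\<close> by (auto simp: lk_eq L_def intro: ennreal_leI)
      then show ?thesis by (simp add: diff_eq_0_ennreal[OF le_less_trans[OF _ ennreal_less_top]])
    qed (simp add: g_off)
    then show ?thesis by (simp only: R_def nn_integral_const mult_zero_left)
  qed
  show "integrable \<mu> (\<lambda>y. g y * - ln (dist x y))"
    using WL_integrable[OF x L] unfolding eq .
  have "W x = WL L x"
    using WL_le_W[OF x L] W_le_WL[OF x L, of 0] R0 by simp
  then show "W x = (\<integral>y. g y * - ln (dist x y) \<partial>\<mu>)"
    unfolding WL_def eq .
qed

end

section \<open>A maximum principle for potentials combined with distance products\<close>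

definition dist_prod :: "(nat \<Rightarrow> pt) \<Rightarrow> nat \<Rightarrow> pt \<Rightarrow> real" where
  "dist_prod xs k x = (\<Prod>j=1..k. dist x (xs j))"

lemma dist_prod_nonneg: "0 \<le> dist_prod xs k x"
  by (simp add: dist_prod_def prod_nonneg)

lemma continuous_dist_prod: "continuous_on S (dist_prod xs k)"
  unfolding dist_prod_def by (intro continuous_intros)

lemma ln_dist_prod:
  assumes "\<And>j. j \<in> {1..k} \<Longrightarrow> x \<noteq> xs j"
  shows "0 < dist_prod xs k x" "ln (dist_prod xs k x) = (\<Sum>j=1..k. ln (dist x (xs j)))"
  unfolding dist_prod_def using assms by (auto intro!: prod_pos ln_prod)

context small_tails
begin

text \<open>Total mass larger than \<open>1\<close> makes the function whose maximum is studied strictly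
  subharmonic off \<open>A\<close>, so that averaging over the four points near a maximum already gives a contradiction.\<close>

lemma maximum_principle:
  assumes mass: "1 < (\<integral>y. g y \<partial>\<mu>)" and k: "0 < k" and xs: "\<And>j. j \<in> {1..k} \<Longrightarrow> xs j \<in> Sph"
    and C: "0 \<le> C" and onA: "\<And>y. y \<in> A \<Longrightarrow> exp (real k * W y) * dist_prod xs k y \<le> C"
    and x: "x \<in> Sph"
  shows "exp (real k * W x) * dist_prod xs k x \<le> C"
proof (rule ccontr)
  \<comment> \<open>The exponential form stays continuous at the zeros of \<open>dist_prod\<close>,
    so a maximum exists. Its value exceeds \<open>C\<close>, hence 0, so it is not attained at a
    zero.\<close>
  define f where "f x = exp (real k * W x) * dist_prod xs k x" for x
  define m where "m = (\<integral>y. g y \<partial>\<mu>)"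
  assume "\<not> ?thesis"
  then have "C < f x" by (simp add: f_def)
  have "continuous_on Sph f"
    unfolding f_def by (intro continuous_intros continuous_W continuous_dist_prod)
  then obtain x0 where x0: "x0 \<in> Sph" and max: "\<And>y. y \<in> Sph \<Longrightarrow> f y \<le> f x0"
    using continuous_attains_sup[OF compact_Sph, of f] x by auto
  have fx0: "C < f x0" using max[OF x] \<open>C < f x\<close> by simp
  then have "x0 \<notin> A" using onA[of x0] by (auto simp: f_def)
  have "dist_prod xs k x0 \<noteq> 0" using fx0 C by (auto simp: f_def)
  then have x0_xs: "x0 \<notin> xs ` {1..k}" by (auto simp: dist_prod_def)
  obtain d1 where d1: "0 < d1" "\<And>y. y \<in> A \<Longrightarrow> d1 \<le> dist x0 y"
    using separate_point_closed[OF compact_imp_closed[OF A(1)] \<open>x0 \<notin> A\<close>] by blast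
  obtain d2 where d2: "0 < d2" "\<And>y. y \<in> xs ` {1..k} \<Longrightarrow> d2 \<le> dist x0 y"
    using separate_point_closed[OF finite_imp_closed x0_xs] by blast
  define d where "d = min d1 d2"
  have d: "0 < d" "\<And>y. y \<in> A \<Longrightarrow> d \<le> dist x0 y" "\<And>j. j \<in> {1..k} \<Longrightarrow> d \<le> dist x0 (xs j)"
    using d1 d2 by (auto simp: d_def min_le_iff_disj)
  have d_le: "d \<le> 1"
  proof -
    obtain y where "y \<in> A" using A by blast
    then show ?thesis using d(2)[of y] dist_Sph_le_1[OF x0, of y] A by auto
  qed
  have gi: "integrable \<mu> g"
    by (rule integrable_const_bound[of _ 2]) (use g_nonneg g_le in auto)
  have "m \<le> (\<integral>y. 2 \<partial>\<mu>)" unfolding m_def by (rule integral_mono[OF gi]) (use g_le in auto)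
  then have m: "1 < m" "m \<le> 2" using mass by (auto simp: m_def prob_space)
  \<comment> \<open>A radius of order \<open>d\<^sup>2\<close> makes the error
    \<open>2 * r ^ 4 / d ^ 4\<close> a small multiple of \<open>r\<^sup>2 * (m - 1)\<close>. The 7
    leaves the factor 6/49 < 1 in \<open>key\<close> and also gives
    \<open>2 * r \<le> d\<close>.\<close>
  define r where "r = d\<^sup>2 * (m - 1) / 7"
  have r0: "0 < r" using d m by (simp add: r_def)
  have dd: "d\<^sup>2 \<le> d" using d d_le by (simp add: power2_eq_square mult_left_le)
  have "d\<^sup>2 * (m - 1) \<le> d * 1" using dd m d by (intro mult_mono) auto
  then have r1: "2 * r \<le> d" using r0 by (simp add: r_def)
  have r_half: "r \<le> 1/2" using r1 d_le by simp
  have r2: "r\<^sup>2 / d ^ 4 \<le> (m - 1) / 49"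
  proof -
    have "r\<^sup>2 / d ^ 4 = (m - 1)\<^sup>2 / 49"
      using d by (simp add: r_def power_divide power_mult_distrib flip: power_mult)
    also have "\<dots> \<le> (m - 1) / 49"
      using m by (simp add: power2_eq_square mult_left_le)
    finally show ?thesis .
  qed
  define E where "E = 2 * r ^ 4 / d ^ 4"
  define l where "l = 2 * ln (1 + r\<^sup>2)"
  \<comment> \<open>Apart from the factor \<open>k\<close>, the potential gains at least
    \<open>(l - E) * m\<close> over the four points and the logarithms of the distances lose at most
    \<open>l + E\<close>; this says that the balance is positive.\<close>
  have key: "E * (m + 1) < l * (m - 1)"
  proof -
    have r2_le: "r\<^sup>2 \<le> 1/4" using r0 r_half power_mono[of r "1/2" 2] by (simp add: power_divide)
    have "E = 2 * r\<^sup>2 * (r\<^sup>2 / d ^ 4)" by (simp add: E_def flip: power_add)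
    also have "\<dots> \<le> 2 * r\<^sup>2 * ((m - 1) / 49)" using r2 by (intro mult_left_mono) auto
    finally have "E * (m + 1) \<le> 2 * r\<^sup>2 * ((m - 1) / 49) * 3"
      using m r0 d by (intro mult_mono) (auto simp: E_def)
    also have "\<dots> < r\<^sup>2 * (m - 1)" using r0 m by simp
    also have "\<dots> \<le> l * (m - 1)"
    proof -
      have "r\<^sup>2 - (r\<^sup>2)\<^sup>2 \<le> ln (1 + r\<^sup>2)"
        using r2_le by (intro ln_one_plus_pos_lower_bound) auto
      moreover have "(r\<^sup>2)\<^sup>2 \<le> r\<^sup>2 * (1/4)"
        unfolding power2_eq_square[of "r\<^sup>2"] using r2_le by (intro mult_left_mono) auto
      ultimately have "r\<^sup>2 \<le> l" using zero_le_power2[of r] unfolding l_def by linarith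
      then show ?thesis using m by (intro mult_right_mono) auto
    qed
    finally show ?thesis .
  qed
  obtain X where XS: "\<And>j r. j < 4 \<Longrightarrow> X j r \<in> Sph"
    and Xd: "\<And>j r. j < (4::nat) \<Longrightarrow> 0 \<le> r \<Longrightarrow> dist (X j r) x0 \<le> r"
    and X4: "\<And>v r d. v \<in> Sph \<Longrightarrow> 0 < d \<Longrightarrow> d \<le> dist x0 v \<Longrightarrow> 0 < r \<Longrightarrow> 2 * r \<le> d \<Longrightarrow>
      \<bar>(\<Sum>j<4. ln (dist (X j r) v)) - 4 * ln (dist x0 v) + 2 * ln (1 + r\<^sup>2)\<bar> \<le> 2 * r ^ 4 / d ^ 4"
    by (rule four_points[OF x0]) (rule that)
  define Y where "Y j = X j r" for j
  have YS: "Y j \<in> Sph" if "j < 4" for j using XS[OF that] by (simp add: Y_def)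
  have Yd: "d / 2 \<le> dist (Y j) v" if "j < 4" "d \<le> dist x0 v" for j v
    using Xd[OF that(1), of r] r0 r1 that(2) dist_triangle[of x0 v "X j r"] dist_commute[of x0 "X j r"]
    unfolding Y_def by linarith
  have Y4: "\<bar>(\<Sum>j<4. ln (dist (Y j) v)) - 4 * ln (dist x0 v) + l\<bar> \<le> E" if "v \<in> Sph" "d \<le> dist x0 v" for v
    using X4[OF that(1) d(1) that(2) r0 r1] unfolding Y_def l_def E_def .
  have Woff: "integrable \<mu> (\<lambda>y. g y * - ln (dist (Y j) y))" "W (Y j) = (\<integral>y. g y * - ln (dist (Y j) y) \<partial>\<mu>)"
    if "j < 4" for j
    using W_off[OF YS[OF that], of "d / 2"] d(1) Yd[OF that] d(2) by auto
  have W0: "integrable \<mu> (\<lambda>y. g y * - ln (dist x0 y))" "W x0 = (\<integral>y. g y * - ln (dist x0 y) \<partial>\<mu>)"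
    using W_off[OF x0 d(1,2)] by auto
  have sumW: "4 * W x0 + (l - E) * m \<le> (\<Sum>j<4. W (Y j))"
  proof -
    have "4 * W x0 + (l - E) * m = (\<integral>y. 4 * (g y * - ln (dist x0 y)) + (l - E) * g y \<partial>\<mu>)"
      unfolding W0(2) m_def using W0(1) gi by simp
    also have "\<dots> \<le> (\<integral>y. (\<Sum>j<4. g y * - ln (dist (Y j) y)) \<partial>\<mu>)"
    proof (rule integral_mono)
      show "integrable \<mu> (\<lambda>y. 4 * (g y * - ln (dist x0 y)) + (l - E) * g y)"
        by (intro Bochner_Integration.integrable_add integrable_mult_right W0 gi)
      show "integrable \<mu> (\<lambda>y. \<Sum>j<4. g y * - ln (dist (Y j) y))"
        by (intro Bochner_Integration.integrable_sum Woff) auto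
      fix y
      show "4 * (g y * - ln (dist x0 y)) + (l - E) * g y \<le> (\<Sum>j<4. g y * - ln (dist (Y j) y))"
      proof (cases "y \<in> A")
        case True
        then have "\<bar>(\<Sum>j<4. ln (dist (Y j) y)) - 4 * ln (dist x0 y) + l\<bar> \<le> E"
          using Y4[of y] d(2)[of y] A by auto
        then have "4 * - ln (dist x0 y) + (l - E) \<le> - (\<Sum>j<4. ln (dist (Y j) y))"
          by linarith
        then have "g y * (4 * - ln (dist x0 y) + (l - E)) \<le> g y * - (\<Sum>j<4. ln (dist (Y j) y))"
          using g_nonneg by (rule mult_left_mono)
        then show ?thesis by (simp add: algebra_simps sum_distrib_left sum_negf)
      qed (simp add: g_off)
    qed
    also have "\<dots> = (\<Sum>j<4. W (Y j))"
      by (subst Bochner_Integration.integral_sum) (use Woff in auto)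
    finally show ?thesis .
  qed
  have neY: "Y j \<noteq> xs i" if "j < 4" "i \<in> {1..k}" for i j
    using Yd[OF that(1) d(3)[OF that(2)]] d(1) by auto
  have ne0: "x0 \<noteq> xs i" if "i \<in> {1..k}" for i
    using d(3)[OF that] d(1) by auto
  have le: "real k * W (Y j) + (\<Sum>i=1..k. ln (dist (Y j) (xs i))) \<le> real k * W x0 + (\<Sum>i=1..k. ln (dist x0 (xs i)))"
    if j: "j < 4" for j
  proof -
    have pY: "0 < dist_prod xs k (Y j)" and lY: "ln (dist_prod xs k (Y j)) = (\<Sum>i=1..k. ln (dist (Y j) (xs i)))"
      using ln_dist_prod[of k "Y j" xs] neY[OF j] by auto
    have p0: "0 < dist_prod xs k x0" and l0: "ln (dist_prod xs k x0) = (\<Sum>i=1..k. ln (dist x0 (xs i)))"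
      using ln_dist_prod[of k x0 xs] ne0 by auto
    have "ln (f (Y j)) \<le> ln (f x0)"
      using max[OF YS[OF j]] pY p0 by (subst ln_le_cancel_iff) (auto simp: f_def)
    then show ?thesis
      using pY p0 by (simp add: f_def ln_mult_pos lY l0)
  qed
  have "(\<Sum>j<4. real k * W (Y j) + (\<Sum>i=1..k. ln (dist (Y j) (xs i))))
      \<le> (\<Sum>j<(4::nat). real k * W x0 + (\<Sum>i=1..k. ln (dist x0 (xs i))))"
    by (intro sum_mono le) auto
  then have "real k * (\<Sum>j<4. W (Y j)) + (\<Sum>i=1..k. \<Sum>j<4. ln (dist (Y j) (xs i)))
      \<le> 4 * (real k * W x0 + (\<Sum>i=1..k. ln (dist x0 (xs i))))"
    by (simp add: sum.distrib sum_distrib_left sum.swap[of _ "{..<4}"])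
  moreover have "(\<Sum>i=1..k. 4 * ln (dist x0 (xs i)) - l - E) \<le> (\<Sum>i=1..k. \<Sum>j<4. ln (dist (Y j) (xs i)))"
  proof (rule sum_mono)
    fix i assume i: "i \<in> {1..k}"
    show "4 * ln (dist x0 (xs i)) - l - E \<le> (\<Sum>j<4. ln (dist (Y j) (xs i)))"
      using Y4[OF xs[OF i] d(3)[OF i]] by linarith
  qed
  moreover have "(\<Sum>i=1..k. 4 * ln (dist x0 (xs i)) - l - E) = 4 * (\<Sum>i=1..k. ln (dist x0 (xs i))) - real k * (l + E)"
    by (simp add: sum_subtractf sum_distrib_left algebra_simps)
  moreover have "real k * (4 * W x0 + (l - E) * m) \<le> real k * (\<Sum>j<4. W (Y j))"
    using sumW by (intro mult_left_mono) auto
  ultimately have "real k * ((l - E) * m - (l + E)) \<le> 0"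
    by (simp add: algebra_simps)
  then have "(l - E) * m - (l + E) \<le> 0"
    using k by (simp add: mult_le_0_iff)
  with key show False by (simp add: algebra_simps)
qed

end

section \<open>From parts of the measure to the whole measure\<close>

lemma trunc_kern_mono: "L \<le> L' \<Longrightarrow> trunc_kern L x y \<le> trunc_kern L' x y"
  unfolding trunc_kern_def by (auto intro!: ln_mono simp: less_max_iff_disj intro: max.coboundedI2)

lemma trunc_kern_integrable:
  assumes \<mu>: "\<mu> \<in> probs Sph" and x: "x \<in> Sph" and L: "0 \<le> L"
  shows "integrable \<mu> (trunc_kern L x)" "0 \<le> (\<integral>y. trunc_kern L x y \<partial>\<mu>)"
    "(\<integral>\<^sup>+ y. ennreal (trunc_kern L x y) \<partial>\<mu>) = ennreal (\<integral>y. trunc_kern L x y \<partial>\<mu>)"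
proof -
  interpret prob_space \<mu> using probsD[OF \<mu>] by simp
  have [measurable_cong]: "sets \<mu> = sets borel" using probsD[OF \<mu>] by simp
  have AE: "AE y in \<mu>. 0 \<le> trunc_kern L x y"
    using probs_Sph_AE[OF \<mu>] by eventually_elim (rule trunc_kern_nonneg[OF x _ L])
  show i: "integrable \<mu> (trunc_kern L x)"
    by (rule integrable_const_bound[of _ L]) (use AE trunc_kern_le[of L x] in auto)
  show "0 \<le> (\<integral>y. trunc_kern L x y \<partial>\<mu>)" using AE by (rule integral_nonneg_AE)
  show "(\<integral>\<^sup>+ y. ennreal (trunc_kern L x y) \<partial>\<mu>) = ennreal (\<integral>y. trunc_kern L x y \<partial>\<mu>)"
    by (rule nn_integral_eq_integral[OF i AE])
qed

lemma Upot_SUP_trunc: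
  assumes \<mu>: "\<mu> \<in> probs Sph" and x: "x \<in> Sph"
  shows "Upot \<mu> x = (SUP n::nat. ennreal (\<integral>y. trunc_kern (real n) x y \<partial>\<mu>))"
proof -
  have [measurable_cong]: "sets \<mu> = sets borel" using probsD[OF \<mu>] by simp
  have "Upot \<mu> x = (\<integral>\<^sup>+ y. (SUP n::nat. ennreal (trunc_kern (real n) x y)) \<partial>\<mu>)"
    unfolding Upot_def
    by (rule nn_integral_cong_AE, use probs_Sph_AE[OF \<mu>] in eventually_elim) (rule lk_SUP_trunc[OF x])
  also have "\<dots> = (SUP n::nat. \<integral>\<^sup>+ y. ennreal (trunc_kern (real n) x y) \<partial>\<mu>)"
    by (rule nn_integral_monotone_convergence_SUP)
       (auto simp: incseq_def le_fun_def intro!: ennreal_leI trunc_kern_mono)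
  finally show ?thesis
    by (simp add: trunc_kern_integrable[OF \<mu> x])
qed

text \<open>The mass outside a compact set \<open>A\<close> of measure above \<open>1 - e\<close> is
  dropped. For the truncated kernel this costs at most \<open>L * e\<close>, whereas the full kernel
  admits no such bound. A little extra mass on \<open>A0\<close> lets
  \<open>maximum_principle\<close> apply, and then \<open>e\<close> tends to 0.\<close>

lemma domination_truncated:
  assumes \<mu>: "\<mu> \<in> probs Sph" and k: "0 < k" and xs: "\<And>j. j \<in> {1..k} \<Longrightarrow> xs j \<in> Sph" and C: "0 \<le> C"
    and AE: "AE x in \<mu>. Upot \<mu> x < \<infinity> \<and> exp (real k * enn2real (Upot \<mu> x)) * dist_prod xs k x \<le> C"
    and x: "x \<in> Sph" and L: "0 \<le> L"
  shows "exp (real k * (\<integral>y. trunc_kern L x y \<partial>\<mu>)) * dist_prod xs k x \<le> C"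
proof -
  interpret prob_space \<mu> using probsD[OF \<mu>] by simp
  have sets [measurable_cong]: "sets \<mu> = sets borel" and space: "space \<mu> = UNIV" using probsD[OF \<mu>] by auto
  note [measurable] = measurable_Upot[OF \<mu>] borel_measurable_continuous_onI[OF continuous_dist_prod]
  define G where "G = {x. Upot \<mu> x < \<infinity> \<and> exp (real k * enn2real (Upot \<mu> x)) * dist_prod xs k x \<le> C}"
  have G: "G \<in> sets borel" unfolding G_def by measurable
  have AEG: "AE x in \<mu>. x \<in> G" using AE by (simp add: G_def)
  have finG: "Upot \<mu> x < \<infinity>" if "x \<in> G" for x using that by (simp add: G_def)
  obtain A0 where A0: "compact A0" "A0 \<subseteq> G \<inter> Sph" "1 - 1/2 < measure \<mu> A0" "unif_small_tails \<mu> A0"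
    by (rule exists_unif_small_tails[OF \<mu> G AEG finG, of "1/2"]) auto
  have A0_ne: "A0 \<noteq> {}" using A0(3) by auto
  have A0m [measurable]: "A0 \<in> sets borel" using A0(1) by (simp add: compact_imp_closed)
  interpret I0: small_tails \<mu> A0 "indicator A0"
    by unfold_locales (use \<mu> A0 A0_ne in \<open>auto simp: indicator_def\<close>)
  \<comment> \<open>\<open>A0\<close> is fixed before \<open>e\<close>, so this bound for its
    continuous potential does not depend on \<open>e\<close>, and the correction
    \<open>4 * e * B\<close> disappears in the limit.\<close>
  obtain B where B: "\<And>x. x \<in> Sph \<Longrightarrow> I0.W x \<le> B" "0 \<le> B"
  proof -
    obtain y where "y \<in> Sph" "\<And>x. x \<in> Sph \<Longrightarrow> I0.W x \<le> I0.W y"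
      using continuous_attains_sup[OF compact_Sph _ I0.continuous_W] x by auto
    then show thesis using that[of "I0.W y"] by (auto simp: I0.W_def)
  qed
  define T where "T = (\<integral>y. trunc_kern L x y \<partial>\<mu>)"
  have approx: "exp (real k * (T - L * e)) * dist_prod xs k x \<le> C * exp (real k * (4 * e * B))"
    if e: "0 < e" "e \<le> 1/8" for e
  proof -
    obtain A' where A': "compact A'" "A' \<subseteq> G \<inter> Sph" "1 - e < measure \<mu> A'" "unif_small_tails \<mu> A'"
      by (rule exists_unif_small_tails[OF \<mu> G AEG finG e(1)]) auto
    define A where "A = A0 \<union> A'"
    have A: "compact A" "A \<subseteq> G" "A \<subseteq> Sph" "A \<noteq> {}" "unif_small_tails \<mu> A"
      using A0 A' A0_ne unif_small_tails_Un unfolding A_def by auto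
    have Am [measurable]: "A \<in> sets borel" using A(1) by (simp add: compact_imp_closed)
    have "measure \<mu> A' \<le> measure \<mu> A"
    proof (rule finite_measure_mono)
      show "A' \<subseteq> A" by (auto simp: A_def)
      show "A \<in> sets \<mu>" by (simp add: sets Am)
    qed
    then have mA: "1 - e < measure \<mu> A" using A'(3) by simp
    \<comment> \<open>Since \<open>A0\<close> has measure above 1/2, the total mass exceeds
      \<open>(1 - e) + 2 * e\<close>; and \<open>e \<le> 1/8\<close> keeps \<open>g\<close> below
      the bound 2 of the locale.\<close>
    define g :: "pt \<Rightarrow> real" where "g y = indicator A y + 4 * e * indicator A0 y" for y
    have gm [measurable]: "g \<in> borel_measurable borel" unfolding g_def by measurable
    interpret I: small_tails \<mu> A g
      by unfold_locales (use \<mu> A e in \<open>auto simp: g_def indicator_def A_def\<close>)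
    have "(\<integral>y. g y \<partial>\<mu>) = measure \<mu> A + 4 * e * measure \<mu> A0"
      unfolding g_def by (subst Bochner_Integration.integral_add) (auto simp: sets space less_top[symmetric])
    moreover have "4 * e * (1/2) < 4 * e * measure \<mu> A0" using A0(3) e by (intro mult_strict_left_mono) auto
    ultimately have mass: "1 < (\<integral>y. g y \<partial>\<mu>)" using mA e(1) by linarith
    have W_le: "I.W y \<le> enn2real (Upot \<mu> y) + 4 * e * B" if y: "y \<in> A" for y
    proof -
      have yS: "y \<in> Sph" and fin: "Upot \<mu> y < \<infinity>" using y A finG by auto
      have e1: "ennreal (1 + 4 * e) = 1 + ennreal (4 * e)"
        using e by (subst ennreal_plus) auto
      have "ennreal (I.W y) = (\<integral>\<^sup>+ z. indicator A z * lk y z + ennreal (4 * e) * (ennreal (indicator A0 z) * lk y z) \<partial>\<mu>)"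
        unfolding I.potential_finite(1)[OF yS, symmetric] g_def
        using e1 A_def by (intro nn_integral_cong) (auto simp: indicator_def distrib_right)
      also have "\<dots> = (\<integral>\<^sup>+ z. indicator A z * lk y z \<partial>\<mu>) + ennreal (4 * e) * (\<integral>\<^sup>+ z. ennreal (indicator A0 z) * lk y z \<partial>\<mu>)"
        by (subst nn_integral_add) (auto simp: nn_integral_cmult)
      also have "\<dots> \<le> Upot \<mu> y + ennreal (4 * e) * ennreal B"
        unfolding I0.potential_finite(1)[OF yS] Upot_def
        using B(1)[OF yS] by (intro add_mono mult_left_mono nn_integral_mono ennreal_leI) (auto simp: indicator_def)
      also have "\<dots> = ennreal (enn2real (Upot \<mu> y) + 4 * e * B)"
        using fin e B(2) by (subst ennreal_plus) (auto simp: ennreal_mult less_top)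
      finally show ?thesis
        using e B(2) by (subst (asm) ennreal_le_iff) auto
    qed
    have "exp (real k * I.W x) * dist_prod xs k x \<le> C * exp (real k * (4 * e * B))"
    proof (rule I.maximum_principle[OF mass k xs _ _ x])
      show "0 \<le> C * exp (real k * (4 * e * B))" using C by simp
      fix y assume y: "y \<in> A"
      have "exp (real k * I.W y) * dist_prod xs k y \<le> exp (real k * (enn2real (Upot \<mu> y) + 4 * e * B)) * dist_prod xs k y"
        using W_le[OF y] by (intro mult_right_mono dist_prod_nonneg) (auto intro: mult_left_mono)
      also have "\<dots> = (exp (real k * enn2real (Upot \<mu> y)) * dist_prod xs k y) * exp (real k * (4 * e * B))"
        by (simp add: distrib_left exp_add)
      also have "\<dots> \<le> C * exp (real k * (4 * e * B))"
        using y A(2) by (intro mult_right_mono) (auto simp: G_def)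
      finally show "exp (real k * I.W y) * dist_prod xs k y \<le> C * exp (real k * (4 * e * B))" .
    qed
    moreover have "T - L * e \<le> I.W x"
    proof -
      note ti = trunc_kern_integrable(1)[OF \<mu> x L]
      \<comment> \<open>On \<open>A\<close> the density is at least 1, so only the complement
        contributes, and there the kernel is at most \<open>L\<close>.\<close>
      have "T - I.WL L x = (\<integral>y. trunc_kern L x y - g y * trunc_kern L x y \<partial>\<mu>)"
        unfolding T_def I.WL_def using ti I.WL_integrable[OF x L] by simp
      also have "\<dots> \<le> (\<integral>y. L * (1 - indicator A y) \<partial>\<mu>)"
      proof (rule integral_mono_AE)
        show "integrable \<mu> (\<lambda>y. trunc_kern L x y - g y * trunc_kern L x y)"
          using ti I.WL_integrable[OF x L] by simp
        show "integrable \<mu> (\<lambda>y. L * (1 - indicator A y))"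
          by (intro integrable_const_bound[of _ L]) (use L in \<open>auto simp: indicator_def\<close>)
        show "AE y in \<mu>. trunc_kern L x y - g y * trunc_kern L x y \<le> L * (1 - indicator A y)"
          using probs_Sph_AE[OF \<mu>]
        proof eventually_elim
          fix y assume "y \<in> Sph"
          have t: "0 \<le> trunc_kern L x y" "trunc_kern L x y \<le> L"
            using trunc_kern_nonneg[OF x \<open>y \<in> Sph\<close> L] trunc_kern_le by auto
          show "trunc_kern L x y - g y * trunc_kern L x y \<le> L * (1 - indicator A y)"
            using t e by (auto simp: g_def indicator_def A_def algebra_simps)
        qed
      qed
      also have "\<dots> = L * (1 - measure \<mu> A)"
        by (subst integral_mult_right_zero, subst Bochner_Integration.integral_diff)
           (auto simp: prob_space[unfolded space] sets space less_top[symmetric])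
      also have "\<dots> \<le> L * e" using mA L by (intro mult_left_mono) auto
      finally show ?thesis using I.WL_le_W[OF x L] by simp
    qed
    then have "exp (real k * (T - L * e)) * dist_prod xs k x \<le> exp (real k * I.W x) * dist_prod xs k x"
      by (intro mult_right_mono dist_prod_nonneg) (auto intro: mult_left_mono)
    ultimately show ?thesis by linarith
  qed
  define \<epsilon> :: "nat \<Rightarrow> real" where "\<epsilon> n = 1 / (real n + 8)" for n
  have \<epsilon>: "0 < \<epsilon> n" "\<epsilon> n \<le> 1/8" for n by (auto simp: \<epsilon>_def field_simps)
  have \<epsilon>0: "\<epsilon> \<longlonglongrightarrow> 0" unfolding \<epsilon>_def by real_asymp
  have "exp (real k * (T - L * 0)) * dist_prod xs k x \<le> C * exp (real k * (4 * 0 * B))"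
  proof (rule LIMSEQ_le)
    show "(\<lambda>n. exp (real k * (T - L * \<epsilon> n)) * dist_prod xs k x) \<longlonglongrightarrow> exp (real k * (T - L * 0)) * dist_prod xs k x"
      by (intro tendsto_intros \<epsilon>0)
    show "(\<lambda>n. C * exp (real k * (4 * \<epsilon> n * B))) \<longlonglongrightarrow> C * exp (real k * (4 * 0 * B))"
      by (intro tendsto_intros \<epsilon>0)
    show "\<exists>N. \<forall>n\<ge>N. exp (real k * (T - L * \<epsilon> n)) * dist_prod xs k x \<le> C * exp (real k * (4 * \<epsilon> n * B))"
      using approx[OF \<epsilon>] by blast
  qed
  then show ?thesis by (simp add: T_def)
qed

text \<open>At a point where the product is positive, all truncated potentials obey one bound
  \<open>t\<close>, and monotone convergence passes it to \<open>Upot\<close>. At a zero of the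
  product the inequality would say nothing about the potential.\<close>

lemma domination_principle:
  assumes \<mu>: "\<mu> \<in> probs Sph" and k: "0 < k" and xs: "\<And>j. j \<in> {1..k} \<Longrightarrow> xs j \<in> Sph" and C: "0 \<le> C"
    and AE: "AE x in \<mu>. Upot \<mu> x < \<infinity> \<and> exp (real k * enn2real (Upot \<mu> x)) * dist_prod xs k x \<le> C"
    and x: "x \<in> Sph" and nz: "dist_prod xs k x \<noteq> 0"
  obtains u where "0 \<le> u" "Upot \<mu> x = ennreal u" "exp (real k * u) * dist_prod xs k x \<le> C"
proof -
  have pos: "0 < dist_prod xs k x" using nz dist_prod_nonneg[of xs k x] by simp
  define T where "T n = (\<integral>y. trunc_kern (real n) x y \<partial>\<mu>)" for n :: nat
  have T: "exp (real k * T n) * dist_prod xs k x \<le> C" for n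
    unfolding T_def by (rule domination_truncated[OF \<mu> k xs C AE x]) auto
  have T0: "0 \<le> T n" for n
    unfolding T_def by (rule trunc_kern_integrable(2)[OF \<mu> x]) simp
  have "0 < exp (real k * T 0) * dist_prod xs k x" using pos by simp
  with T[of 0] have C0: "0 < C" by linarith
  define t where "t = ln (C / dist_prod xs k x) / real k"
  have Tt: "T n \<le> t" for n
  proof -
    have "exp (real k * T n) \<le> C / dist_prod xs k x" using T[of n] pos by (simp add: field_simps)
    then have "ln (exp (real k * T n)) \<le> ln (C / dist_prod xs k x)" by (rule ln_mono) simp
    then show ?thesis using k by (simp add: t_def field_simps)
  qed
  have t0: "0 \<le> t" using T0[of 0] Tt[of 0] by simp
  have "Upot \<mu> x \<le> ennreal t"
    unfolding Upot_SUP_trunc[OF \<mu> x] T_def[symmetric] by (intro SUP_least ennreal_leI Tt)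
  then obtain u where u: "0 \<le> u" "Upot \<mu> x = ennreal u" "u \<le> t"
    using t0 by (cases "Upot \<mu> x") (auto simp: top_unique)
  have "exp (real k * u) * dist_prod xs k x \<le> exp (real k * t) * dist_prod xs k x"
    using u pos by (intro mult_right_mono) (auto intro: mult_left_mono)
  also have "\<dots> = C" using k pos C0 by (simp add: t_def)
  finally show thesis using u that by blast
qed

text \<open>The space is second countable, so the complement of the support is covered by countably
  many basic sets of measure 0.\<close>

lemma msupp_AE:
  assumes \<mu>: "\<mu> \<in> probs K"
  shows "AE x in \<mu>. x \<in> msupp \<mu>"
proof -
  have sets: "sets \<mu> = sets borel" using probsD[OF \<mu>] by simp
  obtain B :: "pt set set" where B: "countable B" "topological_basis B"
    using ex_countable_basis by blast
  define N where "N = (\<Union>b\<in>{b\<in>B. emeasure \<mu> b = 0}. b)"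
  have Bs: "b \<in> sets \<mu>" if "b \<in> B" for b
    using topological_basis_open[OF B(2) that] by (simp add: sets)
  have N0: "N \<in> null_sets \<mu>"
    unfolding N_def by (intro null_sets_UN') (use B(1) Bs in \<open>auto simp: null_sets_def\<close>)
  show ?thesis
  proof (rule AE_I'[OF N0], rule subsetI)
    fix x assume "x \<in> {x \<in> space \<mu>. x \<notin> msupp \<mu>}"
    then obtain e where e: "e > 0" "emeasure \<mu> (ball x e) = 0"
      by (auto simp: msupp_def not_gr_zero)
    obtain b where b: "b \<in> B" "x \<in> b" "b \<subseteq> ball x e"
      using topological_basisE[OF B(2), of "ball x e" x] e by auto
    have "emeasure \<mu> b \<le> emeasure \<mu> (ball x e)"
      using b(3) by (rule emeasure_mono) (simp add: sets)
    then show "x \<in> N" using b e by (auto simp: N_def)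
  qed
qed

context weighted_problem
begin

text \<open>Makes the definite description in \<open>eqmeasure\<close> denote:
  \<open>wenergy\<close> differs from \<open>J\<close> by the finite constant \<open>2 * q\<close>,
  so both have the same minimizers, and finite \<open>J\<close> yields uniqueness.\<close>

lemma eqmeasure_properties:
  assumes "\<not> log_polar {x\<in>K. Q x < \<infinity>}"
  shows "eqmeasure K Q \<in> probs K" "J (eqmeasure K Q) < \<infinity>"
    "\<And>\<nu>. \<nu> \<in> probs K \<Longrightarrow> J (eqmeasure K Q) \<le> J \<nu>" "Vw K Q = wenergy K Q (eqmeasure K Q)"
proof -
  obtain \<mu>1 where \<mu>1: "\<mu>1 \<in> probs K" "J \<mu>1 < \<infinity>" using exists_finite_J[OF assms] by blast
  obtain \<mu>0 where \<mu>0: "\<mu>0 \<in> probs K" and min: "\<And>\<nu>. \<nu> \<in> probs K \<Longrightarrow> J \<mu>0 \<le> J \<nu>"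
    using exists_minimizer \<mu>1 by blast
  have fin: "J \<mu>0 < \<infinity>" using min[OF \<mu>1(1)] \<mu>1(2) by simp
  have V: "Vw K Q = wenergy K Q \<mu>0"
    unfolding Vw_def
  proof (rule INF_eqI)
    fix \<nu> assume "\<nu> \<in> probs K"
    then show "wenergy K Q \<mu>0 \<le> wenergy K Q \<nu>"
      unfolding wenergy_eq[OF \<mu>0] wenergy_eq[OF \<open>\<nu> \<in> probs K\<close>]
      using min by (intro ereal_minus_mono) (auto simp: less_eq_ennreal.rep_eq)
  qed (use \<mu>0 in auto)
  have "eqmeasure K Q = \<mu>0"
    unfolding eqmeasure_def
  proof (rule the_equality)
    show "\<mu>0 \<in> probs K \<and> wenergy K Q \<mu>0 = Vw K Q" using \<mu>0 V by simp
    fix \<nu> assume \<nu>: "\<nu> \<in> probs K \<and> wenergy K Q \<nu> = Vw K Q"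
    then have "enn2ereal (J \<nu>) - ereal (2 * q) = enn2ereal (J \<mu>0) - ereal (2 * q)"
      using V wenergy_eq[OF \<mu>0] wenergy_eq[of \<nu>] by simp
    then have "enn2ereal (J \<nu>) = enn2ereal (J \<mu>0)"
      by (cases "enn2ereal (J \<nu>)"; cases "enn2ereal (J \<mu>0)") auto
    then have "J \<nu> = J \<mu>0" by (simp add: enn2ereal_inject)
    then show "\<nu> = \<mu>0"
      using minimizer_unique[of \<mu>0 \<nu>] \<mu>0 \<nu> min fin by simp
  qed
  then show "eqmeasure K Q \<in> probs K" "J (eqmeasure K Q) < \<infinity>"
    "\<And>\<nu>. \<nu> \<in> probs K \<Longrightarrow> J (eqmeasure K Q) \<le> J \<nu>" "Vw K Q = wenergy K Q (eqmeasure K Q)"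
    using \<mu>0 fin min V by auto
qed

end

section \<open>The weighted Bernstein-Walsh inequality\<close>

theorem theorem8p1:
  fixes K :: "pt set" and Q :: "pt \<Rightarrow> ereal" and k :: nat
    and xs :: "nat \<Rightarrow> pt" and M :: real and P :: "pt set"
  assumes "closed K" and "K \<subseteq> Sph" and "\<not> log_polar K"
    and "admissible K Q"
    and "\<forall>j\<in>{1..k}. xs j \<in> Sph"
    and "P \<in> sets borel" and "log_polar P"
    and "\<forall>x\<in>Sw K Q - P.
           ereal (\<Prod>j=1..k. dist x (xs j)) * eexp (- (ereal (real k) * Q x)) \<le> ereal M"
  shows "(\<forall>x\<in>Sph. ereal (\<Prod>j=1..k. dist x (xs j))
            \<le> ereal M * eexp (ereal (real k) * (- potential (eqmeasure K Q) x + Fw K Q)))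
       \<and> (\<exists>P'. P' \<in> sets borel \<and> log_polar P' \<and>
            (\<forall>x\<in>K - P'. ereal (\<Prod>j=1..k. dist x (xs j)) * eexp (- (ereal (real k) * Q x)) \<le> ereal M))"
proof -
  have lsc: "lsc_on K Q" and Q_ninf: "\<And>x. x \<in> K \<Longrightarrow> Q x \<noteq> -\<infinity>"
    and npolar: "\<not> log_polar {x\<in>K. Q x < \<infinity>}"
    using \<open>admissible K Q\<close> by (auto simp: admissible_def)
  have "compact K"
    using compact_Int_closed[OF compact_Sph \<open>closed K\<close>] \<open>K \<subseteq> Sph\<close> by (simp add: Int_absorb1)
  then obtain q where q: "q \<ge> 0" "\<And>x. x \<in> K \<Longrightarrow> - ereal q \<le> Q x"
    using lsc_on_bounded_below[OF lsc _ Q_ninf] by blast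
  interpret weighted_problem K Q q
    by standard (use \<open>closed K\<close> \<open>K \<subseteq> Sph\<close> lsc q in auto)
  define \<mu> where "\<mu> = eqmeasure K Q"
  note eq = eqmeasure_properties[OF npolar, folded \<mu>_def]
  have \<mu>S: "\<mu> \<in> probs Sph" by (rule probs_K_Sph[OF eq(1)])
  interpret prob_space \<mu> using probsD[OF eq(1)] by simp
  have finE: "mutual \<mu> \<mu> < \<infinity>" and finQ: "(\<integral>\<^sup>+ x. Qp x \<partial>\<mu>) < \<infinity>"
    using eq(2) by (auto simp: J_def ennreal_mult_eq_top_iff simp flip: less_top)
  obtain a p where a: "mutual \<mu> \<mu> = ennreal a" "0 \<le> a" and p: "(\<integral>\<^sup>+ x. Qp x \<partial>\<mu>) = ennreal p" "0 \<le> p"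
    using finE finQ by (auto simp: less_top_ennreal)
  \<comment> \<open>\<open>Vw\<close> equals \<open>a + 2 * p - 2 * q\<close> and the integral of
    \<open>Q\<close> equals \<open>p - q\<close>; the difference is \<open>Fw\<close>.\<close>
  define F where "F = a + p - q"
  have J: "J \<mu> = ennreal (a + 2 * p)"
    unfolding J_def a p using a p by (simp add: ennreal_plus ennreal_mult flip: ennreal_numeral)
  have "enn2ereal (ennreal (a + 2 * p)) = ereal (a + 2 * p)" "enn2ereal (ennreal p) = ereal p"
    using a p by (simp_all only: enn2ereal_ennreal add_nonneg_nonneg mult_nonneg_nonneg zero_le_numeral)
  then have Fw: "Fw K Q = ereal F"
    unfolding Fw_def \<mu>_def[symmetric] eq(4) wenergy_eq[OF eq(1)] intQ_eq[OF eq(1)] J p F_def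
    by simp
  have Qp_real: "Qp x = ennreal (c + q)" "0 \<le> c + q" if "x \<in> K" "Q x = ereal c" for x c
    using that Q_lower[OF that(1)] by (auto simp: Qp_def e2ennreal_ereal)
  have frost: "AE x in \<mu>. Upot \<mu> x + Qp x = ennreal (a + p)"
    using frostman_AE[OF eq(1,2,3)] a p by simp
  have AE_P: "AE x in \<mu>. x \<notin> P"
    using log_polar_null[OF \<mu>S finE \<open>P \<in> sets borel\<close> \<open>log_polar P\<close>] \<open>P \<in> sets borel\<close> probsD[OF eq(1)]
    by (intro AE_I[of _ _ P]) auto
  let ?C = "M * exp (real k * F)"
  \<comment> \<open>The Frostman equality replaces the weight \<open>exp (- k * Q)\<close> by
    \<open>exp (k * (Upot - F))\<close>, the form that domination asks for.\<close>
  have AE_bound: "AE x in \<mu>. Upot \<mu> x < \<infinity> \<and> exp (real k * enn2real (Upot \<mu> x)) * dist_prod xs k x \<le> ?C"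
    using frost AE_P probs_K_AE[OF eq(1)] msupp_AE[OF eq(1)]
  proof eventually_elim
    fix x assume x: "Upot \<mu> x + Qp x = ennreal (a + p)" "x \<notin> P" "x \<in> K" "x \<in> msupp \<mu>"
    have "Upot \<mu> x + Qp x < \<infinity>" using x(1) by simp
    then have fin: "Upot \<mu> x < \<infinity>" "Qp x < \<infinity>" by (auto simp flip: less_top)
    then obtain u where u: "Upot \<mu> x = ennreal u" "0 \<le> u" by (auto simp: less_top_ennreal)
    obtain c where c: "Q x = ereal c"
      using fin(2) Q_ninf[OF x(3)] x(3) by (cases "Q x") (auto simp: Qp_def)
    have "ennreal (u + (c + q)) = ennreal (a + p)"
      using x(1) u Qp_real[OF x(3) c] by simp
    then have uF: "u = F - c"
      using u a p Qp_real[OF x(3) c] by (subst (asm) ennreal_inj) (auto simp: F_def)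
    have "x \<in> Sw K Q - P" using x by (simp add: Sw_def \<mu>_def)
    then have "ereal (dist_prod xs k x) * eexp (- (ereal (real k) * Q x)) \<le> ereal M"
      using assms(8) unfolding dist_prod_def by blast
    then have "dist_prod xs k x * exp (- (real k * c)) \<le> M" by (simp add: c eexp_def)
    then have "dist_prod xs k x * exp (- (real k * c)) * exp (real k * F) \<le> ?C"
      by (intro mult_right_mono) auto
    also have "dist_prod xs k x * exp (- (real k * c)) * exp (real k * F) = exp (real k * u) * dist_prod xs k x"
      unfolding uF by (simp add: mult.assoc algebra_simps flip: exp_add)
    finally show "Upot \<mu> x < \<infinity> \<and> exp (real k * enn2real (Upot \<mu> x)) * dist_prod xs k x \<le> ?C"
      using u fin by simp
  qed
  \<comment> \<open>The sign of \<open>M\<close> is not given; a single point where the bound holds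
    yields \<open>0 \<le> M\<close>, and \<open>1 \<le> M\<close> when \<open>k = 0\<close>.\<close>
  have "\<exists>x. Upot \<mu> x < \<infinity> \<and> exp (real k * enn2real (Upot \<mu> x)) * dist_prod xs k x \<le> ?C"
  proof (rule ccontr)
    assume none: "\<not> ?thesis"
    from AE_bound have "AE x in \<mu>. False"
      by (rule eventually_mono) (use none in blast)
    then show False by (simp add: AE_False)
  qed
  then obtain y where y: "exp (real k * enn2real (Upot \<mu> y)) * dist_prod xs k y \<le> ?C" by blast
  have C: "0 \<le> ?C"
    using y dist_prod_nonneg[of xs k y] by (meson exp_ge_zero mult_nonneg_nonneg order_trans)
  then have M: "0 \<le> M" by (simp add: zero_le_mult_iff)
  have M1: "1 \<le> M" if "k = 0"
    using y that by (simp add: dist_prod_def)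
  have dom: "dist_prod xs k x = 0 \<or> (\<exists>u\<ge>0. Upot \<mu> x = ennreal u \<and> exp (real k * u) * dist_prod xs k x \<le> ?C)"
    if "0 < k" "x \<in> Sph" for x
  proof (cases "dist_prod xs k x = 0")
    case False
    show ?thesis
      by (rule domination_principle[OF \<mu>S that(1) _ C AE_bound that(2) False]) (use assms(5) in auto)
  qed simp
  have eexp_0: "eexp 0 = 1"
    by (simp add: eexp_def zero_ereal_def one_ereal_def)
  have eexp_nonneg: "0 \<le> eexp t" for t
    by (cases t) (auto simp: eexp_def)
  have first: "ereal (dist_prod xs k x) \<le> ereal M * eexp (ereal (real k) * (- potential \<mu> x + Fw K Q))"
    if x: "x \<in> Sph" for x
  proof (cases "k = 0")
    \<comment> \<open>For \<open>k = 0\<close> the exponent is 0 even where the potential is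
      infinite, since \<open>0 * \<infinity> = 0\<close> in \<open>ereal\<close>; the claim becomes
      \<open>1 \<le> M\<close>.\<close>
    case True
    then show ?thesis using M1 by (simp add: dist_prod_def eexp_0 flip: zero_ereal_def one_ereal_def)
  next
    case False
    then consider "dist_prod xs k x = 0" | u where "0 \<le> u" "Upot \<mu> x = ennreal u" "exp (real k * u) * dist_prod xs k x \<le> ?C"
      using dom[OF _ x] by auto
    then show ?thesis
    proof cases
      case 1
      then show ?thesis
        using M ereal_0_le_mult[OF _ eexp_nonneg, of "ereal M"] by (simp flip: zero_ereal_def)
    next
      case 2
      have "dist_prod xs k x = exp (- (real k * u)) * (exp (real k * u) * dist_prod xs k x)"
        by (simp add: exp_minus)
      also have "\<dots> \<le> exp (- (real k * u)) * ?C"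
        using 2(3) by (intro mult_left_mono) auto
      also have "\<dots> = M * exp (real k * (- u + F))"
        by (simp add: algebra_simps flip: exp_add)
      finally show ?thesis
        using 2 by (simp add: potential_eq[OF \<mu>S x] Fw enn2ereal_ennreal eexp_def)
    qed
  qed
  \<comment> \<open>Off this set Frostman gives \<open>F - Upot \<le> Q\<close>, so the larger
    \<open>Q\<close> can only shrink the weight.\<close>
  define P' where "P' = {x \<in> K. Upot \<mu> x + Qp x < mutual \<mu> \<mu> + (\<integral>\<^sup>+ x. Qp x \<partial>\<mu>)}"
  have "P' \<in> sets borel"
    unfolding P'_def using measurable_Upot[OF eq(1)] by measurable
  moreover have "log_polar P'"
    unfolding P'_def by (rule frostman_log_polar[OF eq(1,2,3)])
  moreover have "ereal (dist_prod xs k x) * eexp (- (ereal (real k) * Q x)) \<le> ereal M" if x: "x \<in> K - P'" for x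
  proof (cases "k = 0")
    case True
    then show ?thesis using M1 by (simp add: dist_prod_def eexp_0 flip: zero_ereal_def one_ereal_def)
  next
    case False
    have xS: "x \<in> Sph" using x K_Sph by auto
    show ?thesis
    proof (cases "Q x")
      case (real c)
      consider "dist_prod xs k x = 0" | u where "0 \<le> u" "Upot \<mu> x = ennreal u" "exp (real k * u) * dist_prod xs k x \<le> ?C"
        using dom[OF _ xS] False by auto
      then show ?thesis
      proof cases
        case 1
        then show ?thesis using M by (simp flip: zero_ereal_def)
      next
        case 2
        have "ennreal (a + p) \<le> Upot \<mu> x + Qp x"
          using x a p by (auto simp: P'_def)
        also have "\<dots> = ennreal (u + (c + q))"
          using 2 Qp_real[of x c] x real by simp
        finally have "a + p \<le> u + (c + q)"
          using 2 Qp_real(2)[of x c] x real by (subst (asm) ennreal_le_iff) auto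
        then have "F - u \<le> c" by (simp add: F_def)
        then have "real k * (F - u) \<le> real k * c"
          by (intro mult_left_mono) auto
        then have cu: "exp (- (real k * c)) \<le> exp (- (real k * F)) * exp (real k * u)"
          by (simp add: algebra_simps flip: exp_add)
        have "dist_prod xs k x * exp (- (real k * c)) \<le> exp (- (real k * F)) * (exp (real k * u) * dist_prod xs k x)"
          using mult_left_mono[OF cu dist_prod_nonneg[of xs k x]] by (simp only: mult_ac)
        also have "\<dots> \<le> exp (- (real k * F)) * ?C"
          using 2(3) by (intro mult_left_mono) auto
        also have "\<dots> = M" by (simp add: exp_minus)
        finally show ?thesis by (simp add: real eexp_def)
      qed
    next
      \<comment> \<open>The weight is \<open>eexp (- \<infinity>) = 0\<close> because
        \<open>k > 0\<close>, so \<open>0 \<le> M\<close> suffices.\<close>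
      case PInf
      then show ?thesis using False M by (simp add: eexp_def)
    next
      case MInf
      then show ?thesis using Q_ninf x by auto
    qed
  qed
  ultimately show ?thesis
    using first unfolding dist_prod_def \<mu>_def by blast
qed

end
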